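(* Fix non-negative integers $s$ and $k$, and an integer $d\in[2^s,2^{s+1})$. For each non-negative integer $r$, let $y_r$ be the largest integer for which $d>y_r2^r$. Let $a$ be a non-negative integer, and $\epsilon$ an integer with $\epsilon\equiv k\pmod 2$. (Realizability, as defined in the context, is with respect to $(s,k,d)$.) (1) If $k\geq d$, then all integers in $k+2\mathbb{N}$ are realizable. Moreover, if $d=2^s$ and $s\geq 2$, then all integers in $k+2\mathbb{N}$ are realizable with $p$ a quasi-Pfister neighbour, and also realizable with $p$ not a quasi-Pfister neighbour. (2) If $k<d=2^s$, $a\geq 1$ and $\epsilon\in[-k,k]$, then $a2^{s+1}+\epsilon$ is realizable with $p$ a quasi-Pfister neighbour. (3) If $d>\max\{k,2^s\}$, $a\geq 1$ and $\epsilon\in[-k,k]$, then $a2^{s+2}+\epsilon$ is realizable. (4) Let $r\leq s-2$ be a non-negative integer, and $x$ a positive integer $\leq 2^{s-2-r}$. If $d=2^s$, $k\in[2^s-2^r,2^s)$ and $\epsilon\in[(x-1)2^{r+1}+2^{s+1}-k,\;x2^{r+1}+k]$, then $a2^{s+2}+\epsilon$ and, when $a\geq 1$, $a2^{s+2}-\epsilon$ are realizable with $p$ not a quasi-Pfister neighbour. (5) Let $r\leq s-1$ be a non-negative integer, and $x$ a positive integer $<2^{s+1-r}-y_r$. If $d>2^s$, $k\in[y_r2^r,d)$ and $\epsilon\in[(x+y_r)2^{r+1}-k,\;x2^{r+1}+k]$, then $a2^{s+2}+\epsilon$ is realizable.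
   Context: Here $\mathbb{N}=\{1,2,3,\dots\}$. A quasilinear quadratic form over a field $F$ of characteristic $2$ is a map $\varphi\colon V_\varphi\to F$ on a finite-dimensional $F$-vector space with $\varphi(av+w)=a^2\varphi(v)+\varphi(w)$ for all $a\in F$, $v,w\in V_\varphi$; $\dim\varphi:=\dim V_\varphi$. The zero set $\{v:\varphi(v)=0\}$ is a subspace; its dimension is the isotropy index $\mathfrak{i}_0(\varphi)$, and $\varphi$ is anisotropic if $\mathfrak{i}_0(\varphi)=0$. $\varphi_L$ denotes scalar extension to a field $L\supseteq F$. $\langle a_1,\dots,a_n\rangle$ is the form $\sum a_ix_i^2$ on $F^n$; $\langle a_i\rangle_i\otimes\langle b_j\rangle_j=\langle a_ib_j\rangle_{i,j}$. A form $\psi$ is a subform of $\varphi$ if $\varphi\simeq\psi\perp\sigma$ for some quasilinear $\sigma$; two forms are similar if one is isomorphic to a nonzero scalar multiple of the other. If $\varphi$ is anisotropic of dimension $\geq 2$, $F(\varphi)$ is the function field of the integral affine quadric $\{\varphi=0\}\subset\mathbb{A}(V_\varphi)$; $\mathfrak{i}_1(\varphi):=\mathfrak{i}_0(\varphi_{F(\varphi)})$; $\dim_{\mathrm{Izh}}\varphi:=\dim\varphi-\mathfrak{i}_1(\varphi)$. A quasi-Pfister form is a form isomorphic to $\langle 1\rangle$ or $\langle 1,a_1\rangle\otimes\cdots\otimes\langle 1,a_m\rangle$. An anisotropic form $\varphi$ of dimension $\geq 2$ is a quasi-Pfister neighbour if it is similar to a subform of an anisotropic quasi-Pfister form $\pi$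 of dimension $\geq 2$ with $\dim\varphi>\dim_{\mathrm{Izh}}\pi$ (here $\dim_{\mathrm{Izh}}\pi=\frac{1}{2}\dim\pi$). Realizability: for fixed $s,k,d$, an integer $n\in k+2\mathbb{N}$ is realizable if there exist a field $F$ of characteristic $2$ and anisotropic quasilinear quadratic forms $p$ and $q$ over $F$ such that $2^s<\dim p\leq 2^{s+1}$, $\dim_{\mathrm{Izh}} p=d$, $\dim q=n$ and $\dim q-2\,\mathfrak{i}_0(q_{F(p)})=k$. If such a triple $(F,p,q)$ exists with $p$ a quasi-Pfister neighbour (resp. not a quasi-Pfister neighbour), then $n$ is realizable with $p$ a quasi-Pfister neighbour (resp. realizable with $p$ not a quasi-Pfister neighbour). *)

theory Defs
  imports
    "Jordan_Normal_Form.Missing_VectorSpace"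
    "HOL-Algebra.Indexed_Polynomials"
    "HOL-Algebra.QuotRing"
    "HOL-Library.Infinite_Typeclass"
    "HOL-Number_Theory.Cong"
begin

section \<open>Quasilinear quadratic forms\<close>

text \<open>
  Fields are HOL-Algebra structures, so that one can quantify over them. A finite-dimensional
  vector space is represented, through a choice of basis, by a coordinate space: a form of
  dimension \<open>n\<close> over \<open>F\<close> is a map on the space \<open>F^n\<close> of extensional functions
  \<open>{..<n} \<rightarrow>\<^sub>E carrier F\<close>. The value of the map outside \<open>F^n\<close> is irrelevant.
\<close>

definition coord_space :: "('a, 'm) ring_scheme \<Rightarrow> nat \<Rightarrow> ('a, nat \<Rightarrow> 'a) module" where
  "coord_space F n = ring.func_space F {..<n}"

definition unit_coord :: "('a, 'm) ring_scheme \<Rightarrow> nat \<Rightarrow> nat \<Rightarrow> nat \<Rightarrow> 'a" where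
  "unit_coord F n i = (\<lambda>j\<in>{..<n}. if j = i then \<one>\<^bsub>F\<^esub> else \<zero>\<^bsub>F\<^esub>)"

record 'a qform =
  qdim :: nat
  qmap :: "(nat \<Rightarrow> 'a) \<Rightarrow> 'a"

definition qspace :: "('a, 'm) ring_scheme \<Rightarrow> 'a qform \<Rightarrow> ('a, nat \<Rightarrow> 'a) module" where
  "qspace F \<phi> = coord_space F (qdim \<phi>)"

definition quasilinear_form :: "('a, 'm) ring_scheme \<Rightarrow> 'a qform \<Rightarrow> bool" where
  "quasilinear_form F \<phi> \<longleftrightarrow>
     qmap \<phi> \<in> carrier (qspace F \<phi>) \<rightarrow> carrier F \<and>
     (\<forall>a\<in>carrier F. \<forall>v\<in>carrier (qspace F \<phi>). \<forall>w\<in>carrier (qspace F \<phi>).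
        qmap \<phi> (a \<odot>\<^bsub>qspace F \<phi>\<^esub> v \<oplus>\<^bsub>qspace F \<phi>\<^esub> w)
          = a [^]\<^bsub>F\<^esub> (2::nat) \<otimes>\<^bsub>F\<^esub> qmap \<phi> v \<oplus>\<^bsub>F\<^esub> qmap \<phi> w)"

definition isotropy_index :: "('a, 'm) ring_scheme \<Rightarrow> 'a qform \<Rightarrow> nat" where
  "isotropy_index F \<phi> =
     vectorspace.dim F
       (qspace F \<phi>\<lparr>carrier := {v \<in> carrier (qspace F \<phi>). qmap \<phi> v = \<zero>\<^bsub>F\<^esub>}\<rparr>)"

definition anisotropic :: "('a, 'm) ring_scheme \<Rightarrow> 'a qform \<Rightarrow> bool" where
  "anisotropic F \<phi> \<longleftrightarrow> quasilinear_form F \<phi> \<and> isotropy_index F \<phi> = 0"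

definition isomorphic_forms :: "('a, 'm) ring_scheme \<Rightarrow> 'a qform \<Rightarrow> 'a qform \<Rightarrow> bool" where
  "isomorphic_forms F \<phi> \<psi> \<longleftrightarrow>
     (\<exists>T. linear_map F (qspace F \<phi>) (qspace F \<psi>) T \<and>
          bij_betw T (carrier (qspace F \<phi>)) (carrier (qspace F \<psi>)) \<and>
          (\<forall>v\<in>carrier (qspace F \<phi>). qmap \<psi> (T v) = qmap \<phi> v))"

definition scale_form :: "('a, 'm) ring_scheme \<Rightarrow> 'a \<Rightarrow> 'a qform \<Rightarrow> 'a qform" where
  "scale_form F c \<phi> = \<lparr>qdim = qdim \<phi>, qmap = (\<lambda>v. c \<otimes>\<^bsub>F\<^esub> qmap \<phi> v)\<rparr>"

definition similar_forms :: "('a, 'm) ring_scheme \<Rightarrow> 'a qform \<Rightarrow> 'a qform \<Rightarrow> bool" where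
  "similar_forms F \<phi> \<psi> \<longleftrightarrow>
     (\<exists>c\<in>carrier F - {\<zero>\<^bsub>F\<^esub>}. isomorphic_forms F \<phi> (scale_form F c \<psi>))"

definition orth_sum :: "('a, 'm) ring_scheme \<Rightarrow> 'a qform \<Rightarrow> 'a qform \<Rightarrow> 'a qform" where
  "orth_sum F \<phi> \<psi> =
     \<lparr>qdim = qdim \<phi> + qdim \<psi>,
      qmap = (\<lambda>v. qmap \<phi> (\<lambda>i\<in>{..<qdim \<phi>}. v i)
                \<oplus>\<^bsub>F\<^esub> qmap \<psi> (\<lambda>i\<in>{..<qdim \<psi>}. v (qdim \<phi> + i)))\<rparr>"

definition subform :: "('a, 'm) ring_scheme \<Rightarrow> 'a qform \<Rightarrow> 'a qform \<Rightarrow> bool" where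
  "subform F \<psi> \<phi> \<longleftrightarrow>
     quasilinear_form F \<psi> \<and>
     (\<exists>\<sigma>. quasilinear_form F \<sigma> \<and> isomorphic_forms F \<phi> (orth_sum F \<psi> \<sigma>))"

definition diag_form :: "('a, 'm) ring_scheme \<Rightarrow> 'a list \<Rightarrow> 'a qform" where
  "diag_form F as =
     \<lparr>qdim = length as,
      qmap = (\<lambda>v. \<Oplus>\<^bsub>F\<^esub>i\<in>{..<length as}. as ! i \<otimes>\<^bsub>F\<^esub> v i [^]\<^bsub>F\<^esub> (2::nat))\<rparr>"

text \<open>Tensor products are only needed for diagonal forms, given by their coefficient lists.\<close>

definition tensor_coeffs :: "('a, 'm) ring_scheme \<Rightarrow> 'a list \<Rightarrow> 'a list \<Rightarrow> 'a list" where
  "tensor_coeffs F as bs = [a \<otimes>\<^bsub>F\<^esub> b. a \<leftarrow> as, b \<leftarrow> bs]"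

definition quasi_Pfister :: "('a, 'm) ring_scheme \<Rightarrow> 'a qform \<Rightarrow> bool" where
  "quasi_Pfister F \<pi> \<longleftrightarrow>
     quasilinear_form F \<pi> \<and>
     (\<exists>as. set as \<subseteq> carrier F \<and>
        isomorphic_forms F \<pi>
          (diag_form F (foldr (\<lambda>a. tensor_coeffs F [\<one>\<^bsub>F\<^esub>, a]) as [\<one>\<^bsub>F\<^esub>])))"

text \<open>
  Scalar extension along a homomorphism \<open>h\<close> from the base field to \<open>L\<close>: the unique quasilinear
  form on \<open>L^n\<close> whose value at the \<open>i\<close>-th standard basis vector is \<open>h (\<phi> e\<^sub>i)\<close>.
\<close>

definition extend_form ::
  "('a, 'm) ring_scheme \<Rightarrow> ('b, 'n) ring_scheme \<Rightarrow> ('a \<Rightarrow> 'b) \<Rightarrow> 'a qform \<Rightarrow> 'b qform" where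
  "extend_form F L h \<phi> =
     \<lparr>qdim = qdim \<phi>,
      qmap = (\<lambda>x. \<Oplus>\<^bsub>L\<^esub>i\<in>{..<qdim \<phi>}.
                h (qmap \<phi> (unit_coord F (qdim \<phi>) i)) \<otimes>\<^bsub>L\<^esub> x i [^]\<^bsub>L\<^esub> (2::nat))\<rparr>"

section \<open>The function field of a quasilinear quadric\<close>

text \<open>
  The polynomial ring \<open>R[X\<^sub>i | i \<in> I]\<close> on the carrier of indexed polynomials: monomials are
  multisets of variables, a polynomial maps a monomial to its coefficient.
\<close>

definition mpoly_ring :: "('a, 'm) ring_scheme \<Rightarrow> 'i set \<Rightarrow> ('i multiset \<Rightarrow> 'a) ring" where
  "mpoly_ring R I =
     \<lparr>carrier = ring.indexed_pset R I (carrier R),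
      monoid.mult = (\<lambda>P Q m. \<Oplus>\<^bsub>R\<^esub>l\<in>{l. l \<subseteq># m}. P l \<otimes>\<^bsub>R\<^esub> Q (m - l)),
      one = ring.indexed_const R \<one>\<^bsub>R\<^esub>,
      zero = ring.indexed_const R \<zero>\<^bsub>R\<^esub>,
      add = ring.indexed_padd R\<rparr>"

text \<open>The field of fractions of a domain; \<open>frac_of R a b\<close> is the class of \<open>a / b\<close>.\<close>

definition frac_rel :: "('a, 'm) ring_scheme \<Rightarrow> (('a \<times> 'a) \<times> ('a \<times> 'a)) set" where
  "frac_rel R =
     {((a, b), (c, d)) | a b c d.
        a \<in> carrier R \<and> b \<in> carrier R - {\<zero>\<^bsub>R\<^esub>} \<and> c \<in> carrier R \<and> d \<in> carrier R - {\<zero>\<^bsub>R\<^esub>} \<and>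
        a \<otimes>\<^bsub>R\<^esub> d = c \<otimes>\<^bsub>R\<^esub> b}"

definition frac_of :: "('a, 'm) ring_scheme \<Rightarrow> 'a \<Rightarrow> 'a \<Rightarrow> ('a \<times> 'a) set" where
  "frac_of R a b = frac_rel R `` {(a, b)}"

definition frac_field :: "('a, 'm) ring_scheme \<Rightarrow> ('a \<times> 'a) set ring" where
  "frac_field R =
     \<lparr>carrier = (carrier R \<times> (carrier R - {\<zero>\<^bsub>R\<^esub>})) // frac_rel R,
      monoid.mult = (\<lambda>A B. \<Union>(a, b)\<in>A. \<Union>(c, d)\<in>B. frac_of R (a \<otimes>\<^bsub>R\<^esub> c) (b \<otimes>\<^bsub>R\<^esub> d)),
      one = frac_of R \<one>\<^bsub>R\<^esub> \<one>\<^bsub>R\<^esub>,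
      zero = frac_of R \<zero>\<^bsub>R\<^esub> \<one>\<^bsub>R\<^esub>,
      add = (\<lambda>A B. \<Union>(a, b)\<in>A. \<Union>(c, d)\<in>B.
               frac_of R (a \<otimes>\<^bsub>R\<^esub> d \<oplus>\<^bsub>R\<^esub> c \<otimes>\<^bsub>R\<^esub> b) (b \<otimes>\<^bsub>R\<^esub> d))\<rparr>"

text \<open>\<open>\<phi>\<close> as a polynomial function on affine space: \<open>\<Sum>i. \<phi>(e\<^sub>i) X\<^sub>i\<^sup>2\<close>.\<close>

definition form_poly :: "('a, 'm) ring_scheme \<Rightarrow> 'a qform \<Rightarrow> nat multiset \<Rightarrow> 'a" where
  "form_poly F \<phi> =
     (let P = mpoly_ring F {..<qdim \<phi>} in
      \<Oplus>\<^bsub>P\<^esub>i\<in>{..<qdim \<phi>}.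
        ring.indexed_const F (qmap \<phi> (unit_coord F (qdim \<phi>) i))
          \<otimes>\<^bsub>P\<^esub> ring.indexed_var F i [^]\<^bsub>P\<^esub> (2::nat))"

definition quadric_coord_ring :: "('a, 'm) ring_scheme \<Rightarrow> 'a qform \<Rightarrow> (nat multiset \<Rightarrow> 'a) set ring"
  where
  "quadric_coord_ring F \<phi> =
     (let P = mpoly_ring F {..<qdim \<phi>} in P Quot (PIdl\<^bsub>P\<^esub> (form_poly F \<phi>)))"

definition function_field ::
  "('a, 'm) ring_scheme \<Rightarrow> 'a qform
     \<Rightarrow> ((nat multiset \<Rightarrow> 'a) set \<times> (nat multiset \<Rightarrow> 'a) set) set ring" where
  "function_field F \<phi> = frac_field (quadric_coord_ring F \<phi>)"

definition function_field_const ::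
  "('a, 'm) ring_scheme \<Rightarrow> 'a qform
     \<Rightarrow> 'a \<Rightarrow> ((nat multiset \<Rightarrow> 'a) set \<times> (nat multiset \<Rightarrow> 'a) set) set" where
  "function_field_const F \<phi> c =
     (let P = mpoly_ring F {..<qdim \<phi>}; Q = quadric_coord_ring F \<phi> in
      frac_of Q ((PIdl\<^bsub>P\<^esub> (form_poly F \<phi>)) +>\<^bsub>P\<^esub> ring.indexed_const F c) \<one>\<^bsub>Q\<^esub>)"

definition isotropy_index_over :: "('a, 'm) ring_scheme \<Rightarrow> 'a qform \<Rightarrow> 'a qform \<Rightarrow> nat" where
  "isotropy_index_over F \<phi> \<psi> =
     isotropy_index (function_field F \<phi>)
       (extend_form F (function_field F \<phi>) (function_field_const F \<phi>) \<psi>)"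

definition first_isotropy_index :: "('a, 'm) ring_scheme \<Rightarrow> 'a qform \<Rightarrow> nat" where
  "first_isotropy_index F \<phi> = isotropy_index_over F \<phi> \<phi>"

text \<open>The subtraction does not truncate, as an isotropy index is at most the dimension.\<close>

definition Izhboldin_dim :: "('a, 'm) ring_scheme \<Rightarrow> 'a qform \<Rightarrow> nat" where
  "Izhboldin_dim F \<phi> = qdim \<phi> - first_isotropy_index F \<phi>"

definition quasi_Pfister_neighbour :: "('a, 'm) ring_scheme \<Rightarrow> 'a qform \<Rightarrow> bool" where
  "quasi_Pfister_neighbour F \<phi> \<longleftrightarrow>
     anisotropic F \<phi> \<and> 2 \<le> qdim \<phi> \<and>
     (\<exists>\<pi> \<psi>. quasi_Pfister F \<pi> \<and> anisotropic F \<pi> \<and> 2 \<le> qdim \<pi> \<and>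
            subform F \<psi> \<pi> \<and> similar_forms F \<phi> \<psi> \<and>
            Izhboldin_dim F \<pi> < qdim \<phi>)"

section \<open>Realizability\<close>

definition realizing_triple ::
  "('a, 'm) ring_scheme \<Rightarrow> 'a qform \<Rightarrow> 'a qform \<Rightarrow> nat \<Rightarrow> nat \<Rightarrow> nat \<Rightarrow> int \<Rightarrow> bool" where
  "realizing_triple F p q s k d n \<longleftrightarrow>
     field F \<and> \<one>\<^bsub>F\<^esub> \<oplus>\<^bsub>F\<^esub> \<one>\<^bsub>F\<^esub> = \<zero>\<^bsub>F\<^esub> \<and>
     anisotropic F p \<and> anisotropic F q \<and>
     2 ^ s < qdim p \<and> qdim p \<le> 2 ^ (s + 1) \<and>
     Izhboldin_dim F p = d \<and>
     int (qdim q) = n \<and>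
     int (qdim q) - 2 * int (isotropy_index_over F p q) = int k"

text \<open>The set \<open>k + 2\<nat>\<close>, with \<open>0 \<notin> \<nat>\<close>\<close>

definition candidates :: "nat \<Rightarrow> int set" where
  "candidates k = {int k + 2 * int j | j. 1 \<le> j}"

text \<open>
  HOL cannot quantify over types inside a formula, so the type carrying the elements of the
  field \<open>F\<close> is a parameter \<open>'u\<close>. It has to be infinite: an anisotropic form of dimension at
  least 2 lives over an imperfect, hence infinite field.
\<close>

definition realizable :: "'u::infinite itself \<Rightarrow> nat \<Rightarrow> nat \<Rightarrow> nat \<Rightarrow> int \<Rightarrow> bool" where
  "realizable U s k d n \<longleftrightarrow>
     n \<in> candidates k \<and>
     (\<exists>(F :: 'u ring) p q. realizing_triple F p q s k d n)"

definition realizable_neighbour :: "'u::infinite itself \<Rightarrow> nat \<Rightarrow> nat \<Rightarrow> nat \<Rightarrow> int \<Rightarrow> bool" where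
  "realizable_neighbour U s k d n \<longleftrightarrow>
     n \<in> candidates k \<and>
     (\<exists>(F :: 'u ring) p q. realizing_triple F p q s k d n \<and> quasi_Pfister_neighbour F p)"

definition realizable_non_neighbour ::
  "'u::infinite itself \<Rightarrow> nat \<Rightarrow> nat \<Rightarrow> nat \<Rightarrow> int \<Rightarrow> bool" where
  "realizable_non_neighbour U s k d n \<longleftrightarrow>
     n \<in> candidates k \<and>
     (\<exists>(F :: 'u ring) p q. realizing_triple F p q s k d n \<and> \<not> quasi_Pfister_neighbour F p)"

definition y_index :: "nat \<Rightarrow> nat \<Rightarrow> int" where
  "y_index d r = (GREATEST y. y * 2 ^ r < int d)"

end

(*
Let F have characteristic 2 and 2-independent elements t_0, t_1, ... . Write mu(a) for the product of
the t_i over the binary digits of a, so that mu(a) mu(b) is mu(a xor b) times a square. An isotropy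
index over L is the dimension minus the rank over L^2 of the coefficients. Take for p the form with
coefficients mu(a), a in P0, and mu(2^M), where P0 is contained in {0..<2^M}: over F(p) the last
coefficient lies in the span of the others, while mu(0), ..., mu(2^M - 1) stay independent. So p has
Izhboldin dimension |P0|. If E and X are sets below 2^M with E xor P0 in X, the coefficients mu(x),
x in X, and mu(2^M + e), e in E, have isotropy index at least |E|. As exchanging one coefficient
changes an isotropy index by at most one, k + 2i is realized by p as soon as some E with |E| = i
satisfies |E xor P0| <= i + k. The five claims reduce to choices of P0 and E, mostly intervals, since
a xor b <= a + b also holds blockwise.

The function field of a form with coefficients b_0, ..., b_N is modelled through its Frobenius image:
X_i goes to Y_i for i < N and X_N to the sum of (b_i / b_N) Y_i, with coefficients squared.
*)

theory Submission
  imports Defs "HOL-Library.Poly_Mapping" "HOL-Library.Multiset_Order"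
    "HOL-Computational_Algebra.Fraction_Field" "HOL-Library.Z2" "HOL-Library.Countable_Set"
begin

text \<open>Why Frobenius: isotropy over an extension \<open>L\<close> concerns coefficients modulo
  squares of \<open>L\<close>, and the function field of a quadric contains new square roots. On the
  quadric, \<open>X_N^2\<close> is the sum of \<open>(b_i / b_N) X_i^2\<close>, so the square of
  every function is a polynomial in \<open>Y_i = X_i^2\<close>, \<open>i < N\<close>, over
  \<open>F\<close> itself. The squares of the function field thus form a subfield of a rational
  function field over \<open>F\<close>, where elements can be compared coefficient by coefficient.
  There a form with coefficients \<open>c_i\<close> vanishes exactly where the linear form with the
  same coefficients does, and isotropy becomes rank over a subfield.

  The delicate half is the lower bound on ranks: enough monomials must stay independent over the
  function field. For this, an intermediate field \<open>E\<close> between the squares and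
  \<open>F\<close> is needed that misses a ratio of two coefficients of \<open>p\<close>. The last
  coefficient of \<open>p\<close> is a fresh variable in order to provide such an \<open>E\<close>.

  An explicit family bounds the isotropy index on one side only, while its exact value is
  prescribed; hence the exchange argument. It may run through arbitrary sets of monomials, since all
  of them are anisotropic over \<open>F\<close>.\<close>

class ring_char2 = comm_ring_1 +
  assumes one_plus_one_char2: "1 + 1 = 0"
begin

lemma add_self_char2 [simp]: "x + x = 0"
  using one_plus_one_char2 by (metis distrib_left mult_1_right mult_zero_right)

lemma uminus_char2 [simp]: "- x = x"
  using add_self_char2 minus_unique by blast

lemma minus_char2: "x - y = x + y"
  by (metis uminus_char2 diff_conv_add_uminus)

lemma add_eq_0_char2: "x + y = 0 \<longleftrightarrow> x = y"
  by (metis uminus_char2 add_eq_0_iff)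

lemma eq_add_char2: "a = h + x \<Longrightarrow> x = a + h"
  by (metis minus_char2 add_diff_cancel_left')

lemma power2_add_char2: "(x + y)^2 = x^2 + y^2"
proof -
  have "(x + y)^2 = x^2 + y^2 + (x * y + x * y)"
    unfolding power2_eq_square distrib_left distrib_right mult.commute[of y x] by (simp only: ac_simps)
  then show ?thesis by simp
qed

lemma power2_sum_char2: "(sum f A)^2 = (\<Sum>a\<in>A. (f a)^2)"
  by (induction A rule: infinite_finite_induct) (simp_all add: power2_add_char2)

end

instance bit :: ring_char2
  by standard simp

instance poly_mapping :: (comm_monoid_add, ring_char2) ring_char2
proof
  show "1 + 1 = (0 :: 'a \<Rightarrow>\<^sub>0 'b)"
    by (metis one_plus_one_char2 single_add single_one single_zero)
qed

instance fract :: ("{idom, ring_char2}") ring_char2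
  by standard (simp add: One_fract_def Zero_fract_def eq_fract)

lemma power2_eq_iff_char2: "x^2 = y^2 \<longleftrightarrow> x = y" for x y :: "'a::{idom, ring_char2}"
  by (metis add_eq_0_char2 power2_add_char2 zero_eq_power2)

section \<open>Polynomials\<close>

abbreviation "keys \<equiv> Poly_Mapping.keys"
abbreviation "lookup \<equiv> Poly_Mapping.lookup"
abbreviation "single \<equiv> Poly_Mapping.single"

type_synonym 'a mp = "nat multiset \<Rightarrow>\<^sub>0 'a"

abbreviation mconst :: "'a::zero \<Rightarrow> 'a mp" where
  "mconst \<equiv> single {#}"

abbreviation mvar :: "nat \<Rightarrow> 'a::zero_neq_one mp" where
  "mvar i \<equiv> single {#i#} 1"

text \<open>All polynomials live in one ring with a variable for every natural number. Cutting out
  those in the variables from \<open>I\<close> avoids conversions between rings with different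
  numbers of variables.\<close>

definition mpolys :: "nat set \<Rightarrow> 'a::zero mp set" where
  "mpolys I = {f. \<forall>m\<in>keys f. set_mset m \<subseteq> I}"

lemma mp_induct [case_names single add]:
  fixes f :: "'b \<Rightarrow>\<^sub>0 'a::comm_monoid_add"
  assumes "\<And>m c. P (single m c)" "\<And>f g. P f \<Longrightarrow> P g \<Longrightarrow> P (f + g)"
  shows "P f"
proof (induction f rule: update_induct)
  case const
  \<comment> \<open>The zero function is a monomial with coefficient 0, so the two cases
    suffice.\<close>
  show ?case using assms(1)[of undefined 0] by simp
next
  case (update f a b)
  have "Poly_Mapping.update a b f = f + single a b"
    using update(1) by (intro poly_mapping_eqI)
      (auto simp: lookup_update lookup_add lookup_single in_keys_iff)
  then show ?case using assms update by simp
qed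

lemma mp_eq_sum: "f = (\<Sum>m\<in>keys f. single m (lookup f m))"
  for f :: "'b \<Rightarrow>\<^sub>0 'a::comm_monoid_add"
  by (rule poly_mapping_eqI) (auto simp: lookup_sum lookup_single when_def in_keys_iff)

lemma mpolys_induct [consumes 1, case_names single add]:
  fixes f :: "'a::comm_monoid_add mp"
  assumes "f \<in> mpolys I" "\<And>m c. set_mset m \<subseteq> I \<Longrightarrow> P (single m c)"
    "\<And>f g. f \<in> mpolys I \<Longrightarrow> g \<in> mpolys I \<Longrightarrow> P f \<Longrightarrow> P g \<Longrightarrow> P (f + g)"
  shows "P f"
proof -
  \<comment> \<open>Membership in \<open>mpolys I\<close> is carried along because the case of sums
    asks for it for both summands.\<close>
  have "P (\<Sum>m\<in>A. single m (lookup f m)) \<and> (\<Sum>m\<in>A. single m (lookup f m)) \<in> mpolys I"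
    if "finite A" "A \<subseteq> keys f" for A
    using that
  proof (induction A)
    case empty
    show ?case using assms(2)[of "{#}" 0] by (simp add: mpolys_def)
  next
    case (insert m A)
    have m: "set_mset m \<subseteq> I" using insert assms(1) by (auto simp: mpolys_def)
    have "single m (lookup f m) \<in> mpolys I" using m by (auto simp: mpolys_def)
    moreover from this have "single m (lookup f m) + (\<Sum>m\<in>A. single m (lookup f m)) \<in> mpolys I"
      using insert Poly_Mapping.keys_add unfolding mpolys_def by fastforce
    ultimately show ?case using insert assms(2)[OF m] assms(3) by simp
  qed
  from this[of "keys f"] show ?thesis using mp_eq_sum[of f] by simp
qed

lemma mpolys_add: "f \<in> mpolys I \<Longrightarrow> g \<in> mpolys I \<Longrightarrow> f + g \<in> mpolys I"
  for f g :: "'a::comm_monoid_add mp"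
  using Poly_Mapping.keys_add unfolding mpolys_def by fastforce

lemma mpolys_mult: "f \<in> mpolys I \<Longrightarrow> g \<in> mpolys I \<Longrightarrow> f * g \<in> mpolys I"
  for f g :: "'a::comm_semiring_0 mp"
  using Poly_Mapping.keys_mult[of f g] unfolding mpolys_def by fastforce

lemma mpolys_single: "set_mset m \<subseteq> I \<Longrightarrow> single m c \<in> mpolys I"
  by (auto simp: mpolys_def)

lemma mpolys_0 [simp]: "0 \<in> mpolys I"
  by (simp add: mpolys_def)

lemma mpolys_1 [simp]: "(1 :: 'a::comm_semiring_1 mp) \<in> mpolys I"
  by (simp add: mpolys_def)

lemma mpolys_sum: "(\<And>i. i \<in> A \<Longrightarrow> f i \<in> mpolys I) \<Longrightarrow> sum f A \<in> mpolys I"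
  for f :: "_ \<Rightarrow> 'a::comm_monoid_add mp"
  by (induction A rule: infinite_finite_induct) (auto intro: mpolys_add)

lemma mpolys_mono: "I \<subseteq> J \<Longrightarrow> mpolys I \<subseteq> mpolys J"
  by (auto simp: mpolys_def)

text \<open>Coefficients are transported by an arbitrary map \<open>\<kappa>\<close> because the
  substitutions used below square them.\<close>

definition mp_eval :: "('a::zero \<Rightarrow> 'c) \<Rightarrow> (nat \<Rightarrow> 'c) \<Rightarrow> 'a mp \<Rightarrow> 'c::comm_ring_1" where
  "mp_eval \<kappa> y f = (\<Sum>m\<in>keys f. \<kappa> (lookup f m) * (\<Prod>i\<in>#m. y i))"

locale mp_evaluation =
  fixes \<kappa> :: "'a::comm_ring_1 \<Rightarrow> 'c::comm_ring_1" and y :: "nat \<Rightarrow> 'c"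
  assumes hom_add: "\<kappa> (a + b) = \<kappa> a + \<kappa> b" and hom_mult: "\<kappa> (a * b) = \<kappa> a * \<kappa> b"
    and hom_1: "\<kappa> 1 = 1"
begin

lemma hom_0: "\<kappa> 0 = 0"
  using hom_add[of 0 0] by simp

lemma eval_superset:
  assumes "finite A" "keys f \<subseteq> A"
  shows "mp_eval \<kappa> y f = (\<Sum>m\<in>A. \<kappa> (lookup f m) * (\<Prod>i\<in>#m. y i))"
  unfolding mp_eval_def using assms
  by (intro sum.mono_neutral_left) (auto simp: in_keys_iff hom_0)

lemma eval_add: "mp_eval \<kappa> y (f + g) = mp_eval \<kappa> y f + mp_eval \<kappa> y g"
  using eval_superset[of "keys f \<union> keys g" "f + g"] eval_superset[of "keys f \<union> keys g" f]
    eval_superset[of "keys f \<union> keys g" g] Poly_Mapping.keys_add[of f g]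
  by (simp add: lookup_add hom_add distrib_right sum.distrib)

lemma eval_single: "mp_eval \<kappa> y (single m c) = \<kappa> c * (\<Prod>i\<in>#m. y i)"
  by (simp add: mp_eval_def hom_0)

lemma eval_0: "mp_eval \<kappa> y 0 = 0"
  by (simp add: mp_eval_def)

lemma eval_1: "mp_eval \<kappa> y 1 = 1"
  using eval_single[of "{#}" 1] by (simp add: hom_1)

lemma eval_mult: "mp_eval \<kappa> y (f * g) = mp_eval \<kappa> y f * mp_eval \<kappa> y g"
proof (induction f rule: mp_induct)
  case (single m c)
  show ?case
    by (induction g rule: mp_induct)
       (simp_all add: mult_single eval_single hom_mult eval_add algebra_simps)
next
  case (add f h)
  then show ?case by (simp add: eval_add algebra_simps)
qed

lemma eval_sum: "mp_eval \<kappa> y (sum f A) = (\<Sum>a\<in>A. mp_eval \<kappa> y (f a))"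
  by (induction A rule: infinite_finite_induct) (simp_all add: eval_0 eval_add)

end

section \<open>Linear algebra over a subfield\<close>

text \<open>\<open>S\<close> is a bare set, so that one notion serves the squares of the base field
  and the copies of function fields. Sums over infinite sets are 0, so the notion is meant for
  finite \<open>I\<close>.\<close>

definition indep :: "'k::comm_ring_1 set \<Rightarrow> ('i \<Rightarrow> 'k) \<Rightarrow> 'i set \<Rightarrow> bool" where
  "indep S \<beta> I \<longleftrightarrow> (\<forall>w. (\<forall>i\<in>I. w i \<in> S) \<longrightarrow> (\<Sum>i\<in>I. \<beta> i * w i) = 0 \<longrightarrow> (\<forall>i\<in>I. w i = 0))"

definition sq_subfield :: "'a::field set \<Rightarrow> bool" where
  "sq_subfield E \<longleftrightarrow> (\<forall>x. x^2 \<in> E) \<and> (\<forall>x\<in>E. \<forall>y\<in>E. x + y \<in> E \<and> x * y \<in> E)"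

lemma sq_subfieldD:
  assumes "sq_subfield E"
  shows "x^2 \<in> E" "x \<in> E \<Longrightarrow> y \<in> E \<Longrightarrow> x + y \<in> E" "x \<in> E \<Longrightarrow> y \<in> E \<Longrightarrow> x * y \<in> E"
    "0 \<in> E" "1 \<in> E"
  using assms unfolding sq_subfield_def by (auto simp: power2_eq_square dest: spec[of _ 0] spec[of _ 1])

text \<open>Since \<open>1 / x = x * (1 / x)^2\<close>, a set that contains all squares and is
  closed under products is closed under inverses.\<close>

lemma sq_subfield_inverse:
  assumes "sq_subfield E" "x \<in> E"
  shows "inverse x \<in> E"
proof -
  have "inverse x = x * (inverse x)^2" by (cases "x = 0") (simp_all add: power2_eq_square)
  then show ?thesis using sq_subfieldD[OF assms(1)] assms(2) by metis
qed

lemma sq_subfield_divide: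
  assumes "sq_subfield E" "x \<in> E" "y \<in> E"
  shows "x / y \<in> E"
  using sq_subfieldD(3)[OF assms(1,2) sq_subfield_inverse[OF assms(1,3)]]
  by (simp add: divide_inverse)

lemma sq_subfield_sum:
  assumes "sq_subfield E" "\<And>i. i \<in> A \<Longrightarrow> f i \<in> E"
  shows "sum f A \<in> E"
  using assms(2) by (induction A rule: infinite_finite_induct) (auto simp: sq_subfieldD[OF assms(1)])

abbreviation squares :: "'a::power set" where
  "squares \<equiv> range (\<lambda>x. x^2)"

lemma sq_subfield_squares: "sq_subfield (squares :: 'a::{field,ring_char2} set)"
  unfolding sq_subfield_def
  by (auto simp flip: power2_add_char2 power_mult_distrib)

section \<open>A model of the function field\<close>

lemma lookup_single_mult:
  "lookup (single {#i#} c * f) m = (if i \<in># m then c * lookup f (m - {#i#}) else 0)"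
  for f :: "'a::comm_ring_1 mp"
proof (induction f rule: mp_induct)
  case (single m' d)
  have "add_mset i m' = m \<longleftrightarrow> i \<in># m \<and> m' = m - {#i#}"
    by auto
  then show ?case by (auto simp: mult_single lookup_single when_def)
next
  case (add f g)
  then show ?case by (simp add: distrib_left lookup_add)
qed

lemma lookup_mconst_mult: "lookup (mconst c * f) m = c * lookup f m"
  for f :: "'a::comm_ring_1 mp"
  by (induction f rule: mp_induct)
     (simp_all add: mult_single lookup_single when_def distrib_left lookup_add)

text \<open>This is \<open>f^2\<close> with every \<open>X_i^2\<close> renamed to a variable:
  coefficients are squared, exponents are kept.\<close>

definition frob :: "'a::comm_ring_1 mp \<Rightarrow> 'a mp" where
  "frob = mp_eval (\<lambda>a. mconst (a^2)) mvar"

interpretation frob: mp_evaluation "\<lambda>a::'a::ring_char2. mconst (a^2)" mvar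
  by standard (simp_all add: power2_add_char2 single_add mult_single power_mult_distrib)

lemma prod_mset_mvar: "(\<Prod>i\<in>#m. mvar i) = (single m 1 :: 'a::comm_ring_1 mp)"
  by (induction m) (simp_all add: mult_single)

lemma lookup_frob: "lookup (frob f) m = (lookup f m)^2" for f :: "'a::ring_char2 mp"
  unfolding frob_def
  by (induction f rule: mp_induct)
     (simp_all add: frob.eval_add frob.eval_single prod_mset_mvar mult_single lookup_single when_def
        lookup_add power2_add_char2)

lemma frob_0 [simp]: "frob 0 = (0 :: 'a::ring_char2 mp)"
  by (simp add: frob_def mp_eval_def)

lemma frob_eq_0_iff: "frob f = 0 \<longleftrightarrow> f = 0" for f :: "'a::{idom,ring_char2} mp"
  by (auto simp: poly_mapping_eq_iff fun_eq_iff lookup_frob)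

abbreviation emb :: "'a::{field,ring_char2} mp \<Rightarrow> 'a mp fract" where
  "emb f \<equiv> Fract f 1"

abbreviation embc :: "'a::{field,ring_char2} \<Rightarrow> 'a mp fract" where
  "embc a \<equiv> emb (mconst a)"

lemma emb_simps:
  fixes f g :: "'a::{field,ring_char2} mp"
  shows "emb (f + g) = emb f + emb g" "emb (f * g) = emb f * emb g" "emb (0 :: 'a mp) = 0" "emb (1 :: 'a mp) = 1"
  "emb f = 0 \<longleftrightarrow> f = 0" "emb f = emb g \<longleftrightarrow> f = g"
proof -
  have eq: "emb f = emb g \<longleftrightarrow> f = g" for f g :: "'a mp" by (simp add: eq_fract)
  show "emb (0 :: 'a mp) = 0" "emb (1 :: 'a mp) = 1" by (simp_all only: Zero_fract_def One_fract_def)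
  then show "emb f = 0 \<longleftrightarrow> f = 0" using eq[of f 0] by argo
qed (simp_all add: eq_fract)

lemma embc_simps:
  fixes x y :: "'a::{field,ring_char2}"
  shows "embc (x + y) = embc x + embc y" "embc (x * y) = embc x * embc y" "embc (0 :: 'a) = 0" "embc (1 :: 'a) = 1"
  "embc x = 0 \<longleftrightarrow> x = 0" "embc x = embc y \<longleftrightarrow> x = y"
proof -
  show "embc (x + y) = embc x + embc y" by (simp add: single_add flip: emb_simps)
  show "embc (x * y) = embc x * embc y" by (simp add: mult_single flip: emb_simps)
  show "embc x = 0 \<longleftrightarrow> x = 0" by (simp add: emb_simps) (metis lookup_single_eq lookup_zero single_zero)
  show "embc x = embc y \<longleftrightarrow> x = y" by (simp add: emb_simps) (metis lookup_single_eq)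
qed (simp_all add: emb_simps)

lemma emb_sum: "emb (sum f A) = (\<Sum>a\<in>A. emb (f a))"
  by (induction A rule: infinite_finite_induct) (simp_all add: emb_simps)

text \<open>The non-square ratio excludes that \<open>qpoly\<close> is a scalar times the square of
  a linear form, and so makes the coordinate ring a domain. An anisotropic form provides it for any
  two of its coefficients.\<close>

locale quadric =
  fixes b :: "nat \<Rightarrow> 'a::{field,ring_char2}" and N :: nat
  assumes N: "0 < N" and bN: "b N \<noteq> 0" and nonsquare: "b 0 / b N \<notin> squares"
begin

text \<open>The value of \<open>X_N^2\<close> on the quadric, written in
  \<open>Y_i = X_i^2\<close>.\<close>

definition lin :: "'a mp" where
  "lin = (\<Sum>i<N. single {#i#} (b i / b N))"

definition Phi :: "'a mp \<Rightarrow> 'a mp" where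
  "Phi = mp_eval (\<lambda>a. mconst (a^2)) (\<lambda>i. if i < N then mvar i else lin)"

definition qpoly :: "'a mp" where
  "qpoly = (\<Sum>i<Suc N. single {#i, i#} (b i))"

sublocale Phi: mp_evaluation "\<lambda>a::'a. mconst (a^2)" "\<lambda>i. if i < N then mvar i else lin"
  by standard (simp_all add: power2_add_char2 single_add mult_single power_mult_distrib)

lemma Phi_simps: "Phi (f + g) = Phi f + Phi g" "Phi (f * g) = Phi f * Phi g" "Phi 0 = 0" "Phi 1 = 1"
  "Phi (mconst c) = mconst (c^2)" "Phi (mvar i) = (if i < N then mvar i else lin)"
  by (simp_all add: Phi_def Phi.eval_add Phi.eval_mult Phi.eval_0 Phi.eval_1 Phi.eval_single)

text \<open>The first \<open>N\<close> terms go to the squares of \<open>b_i Y_i\<close>, and the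
  last one to the square of their sum; in characteristic 2 these cancel.\<close>

lemma Phi_qpoly: "Phi qpoly = 0"
proof -
  have Phi_sq: "Phi (single {#i, i#} c) = (mconst c * (if i < N then mvar i else lin))^2" for i c
    unfolding Phi_def Phi.eval_single power_mult_distrib by (simp add: power2_eq_square mult_single)
  have "Phi qpoly = (\<Sum>i<Suc N. Phi (single {#i, i#} (b i)))"
    unfolding qpoly_def Phi_def Phi.eval_sum ..
  also have "\<dots> = (\<Sum>i<N. (single {#i#} (b i))^2) + (mconst (b N) * lin)^2"
    by (simp add: Phi_sq mult_single ac_simps)
  also have "mconst (b N) * lin = (\<Sum>i<N. single {#i#} (b i))"
    using bN by (simp add: lin_def sum_distrib_left mult_single)
  finally show ?thesis by (simp add: power2_sum_char2)
qed

text \<open>Take a monomial \<open>m\<close> of \<open>\<omega>\<close> with the largest exponent of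
  \<open>Y_i0\<close>. The coefficient of \<open>lin * \<omega>\<close> at \<open>Y_i0 * m\<close>
  comes from a single product, namely \<open>b i0 / b N\<close> times the coefficient of
  \<open>\<omega>\<close> at \<open>m\<close>. If both coefficients were in \<open>E\<close>, so
  would be their ratio.\<close>

lemma lin_mult_coeffs:
  assumes E: "sq_subfield E" and i0: "i0 < N" "b i0 / b N \<notin> E"
    and \<omega>: "\<And>m. lookup \<omega> m \<in> E" and lin: "\<And>m. lookup (lin * \<omega>) m \<in> E"
  shows "\<omega> = 0"
proof (rule ccontr)
  assume "\<omega> \<noteq> 0"
  then have "keys \<omega> \<noteq> {}" by simp
  then have "Max ((\<lambda>m. count m i0) ` keys \<omega>) \<in> (\<lambda>m. count m i0) ` keys \<omega>"
    by (intro Max_in) auto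
  then obtain m where m0: "m \<in> keys \<omega>" "count m i0 = Max ((\<lambda>m. count m i0) ` keys \<omega>)"
    by auto
  have m: "m \<in> keys \<omega>" "\<And>m'. m' \<in> keys \<omega> \<Longrightarrow> count m' i0 \<le> count m i0"
    using m0 by auto
  let ?m = "add_mset i0 m"
  have "lookup (lin * \<omega>) ?m = (\<Sum>i<N. lookup (single {#i#} (b i / b N) * \<omega>) ?m)"
    by (simp add: lin_def sum_distrib_right lookup_sum)
  also have "\<dots> = (\<Sum>i<N. if i = i0 then b i0 / b N * lookup \<omega> m else 0)"
  proof (rule sum.cong)
    fix i assume "i \<in> {..<N}"
    show "lookup (single {#i#} (b i / b N) * \<omega>) ?m = (if i = i0 then b i0 / b N * lookup \<omega> m else 0)"
    proof (cases "i = i0")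
      case True
      then show ?thesis by (simp add: lookup_single_mult)
    next
      case False
      \<comment> \<open>For \<open>i \<noteq> i0\<close> the cofactor of \<open>Y_i\<close> has a
        larger exponent of \<open>Y_i0\<close> than \<open>m\<close>, so it does not occur in
        \<open>\<omega>\<close>.\<close>
      then have "count (?m - {#i#}) i0 = Suc (count m i0)" by simp
      then have "?m - {#i#} \<notin> keys \<omega>" using m(2)[of "?m - {#i#}"] by auto
      then show ?thesis using False by (simp add: lookup_single_mult in_keys_iff)
    qed
  qed simp
  also have "\<dots> = b i0 / b N * lookup \<omega> m" using i0 by simp
  finally have "b i0 / b N * lookup \<omega> m \<in> E" using lin by metis
  then have "b i0 / b N * lookup \<omega> m / lookup \<omega> m \<in> E"
    using sq_subfield_divide[OF E] \<omega> by blast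
  then show False using i0 m(1) by (simp add: in_keys_iff)
qed

text \<open>As a polynomial in \<open>X_N\<close>, \<open>qpoly\<close> is quadratic with the unit
  \<open>b N\<close> as leading coefficient and no linear term, so division with remainder works
  over the polynomials in the other variables.\<close>

lemma qpoly_division:
  assumes "f \<in> mpolys {..<Suc N}"
  shows "\<exists>Q\<in>mpolys {..<Suc N}. \<exists>r0\<in>mpolys {..<N}. \<exists>r1\<in>mpolys {..<N}. f = qpoly * Q + r0 + r1 * mvar N"
    (is "?D f")
proof -
  have lt: "mpolys {..<N} \<subseteq> (mpolys {..<Suc N} :: 'a mp set)" by (intro mpolys_mono) auto
  have D_add: "?D (f + g)" if D: "?D f" "?D g" for f g
  proof -
    obtain Q r0 r1 Q' r0' r1' where "Q \<in> mpolys {..<Suc N}" "r0 \<in> mpolys {..<N}" "r1 \<in> mpolys {..<N}"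
      "Q' \<in> mpolys {..<Suc N}" "r0' \<in> mpolys {..<N}" "r1' \<in> mpolys {..<N}"
      "f = qpoly * Q + r0 + r1 * mvar N" "g = qpoly * Q' + r0' + r1' * mvar N"
      using D by blast
    then show ?thesis
      by (intro bexI[of _ "Q + Q'"] bexI[of _ "r0 + r0'"] bexI[of _ "r1 + r1'"])
         (auto simp: algebra_simps intro: mpolys_add)
  qed
  have D_var: "?D (mvar i * f)" if D: "?D f" and i: "i < Suc N" for f i
  proof -
    obtain Q r0 r1 where Q: "Q \<in> mpolys {..<Suc N}" "r0 \<in> mpolys {..<N}" "r1 \<in> mpolys {..<N}"
      "f = qpoly * Q + r0 + r1 * mvar N"
      using D by blast
    have vQ: "mvar i * Q \<in> mpolys {..<Suc N}"
      using Q(1) i by (intro mpolys_mult mpolys_single) auto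
    show ?thesis
    proof (cases "i < N")
      case True
      have "mvar i * r0 \<in> mpolys {..<N}" "mvar i * r1 \<in> mpolys {..<N}"
        using Q True by (auto intro!: mpolys_mult mpolys_single)
      moreover have "mvar i * f = qpoly * (mvar i * Q) + mvar i * r0 + mvar i * r1 * mvar N"
        unfolding Q(4) by (simp only: algebra_simps)
      ultimately show ?thesis using vQ by blast
    next
      case False
      with i have i: "i = N" by simp
      let ?h = "\<Sum>i<N. single {#i, i#} (b i / b N)"
      have "mconst (1 / b N) * qpoly = ?h + mvar N * mvar N"
        using bN by (simp add: qpoly_def distrib_left sum_distrib_left mult_single)
      then have "mvar N * mvar N = mconst (1 / b N) * qpoly + ?h"
        by (rule eq_add_char2)
      moreover have "mvar i * f = qpoly * (mvar N * Q) + mvar N * r0 + r1 * (mvar N * mvar N)"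
        unfolding Q(4) i by (simp only: algebra_simps)
      ultimately have "mvar i * f = qpoly * (mvar N * Q + mconst (1 / b N) * r1) + r1 * ?h + r0 * mvar N"
        by (simp only: algebra_simps)
      moreover have "r1 * ?h \<in> mpolys {..<N}"
        by (intro mpolys_mult mpolys_sum mpolys_single Q) auto
      moreover have "mvar N * Q + mconst (1 / b N) * r1 \<in> mpolys {..<Suc N}"
        using Q(3) lt by (intro mpolys_add[OF vQ[unfolded i]] mpolys_mult mpolys_single) auto
      ultimately show ?thesis using Q(2) by blast
    qed
  qed
  have D_const: "?D (mconst c)" for c
    by (intro bexI[of _ 0] bexI[of _ "mconst c"]) (auto intro: mpolys_single)
  have D_single: "?D (single m c)" if "set_mset m \<subseteq> {..<Suc N}" for m c
    using that
  proof (induction m)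
    case empty
    show ?case by (rule D_const)
  next
    case (add i m)
    then have "?D (mvar i * single m c)" by (intro D_var) auto
    then show ?case by (simp add: mult_single)
  qed
  show ?thesis using assms
    by (induction f rule: mpolys_induct) (use D_single D_add in blast)+
qed

lemma Phi_frob:
  assumes "r \<in> mpolys {..<N}"
  shows "Phi r = frob r"
  using assms
proof (induction r rule: mpolys_induct)
  case (single m c)
  then have "(\<Prod>i\<in>#m. if i < N then mvar i else lin) = (\<Prod>i\<in>#m. mvar i :: 'a mp)"
    by (intro arg_cong[of _ _ prod_mset] image_mset_cong) auto
  then show ?case unfolding Phi_def frob_def Phi.eval_single frob.eval_single by simp
next
  case (add f g)
  then show ?case unfolding Phi_def frob_def Phi.eval_add frob.eval_add by simp
qed

lemma Phi_decompose:
  assumes "f \<in> mpolys {..<Suc N}"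
  obtains Q r0 r1 where "Q \<in> mpolys {..<Suc N}" "f = qpoly * Q + r0 + r1 * mvar N"
    "Phi f = frob r0 + lin * frob r1"
proof -
  obtain Q r0 r1 where Q: "Q \<in> mpolys {..<Suc N}" "r0 \<in> mpolys {..<N}" "r1 \<in> mpolys {..<N}"
      "f = qpoly * Q + r0 + r1 * mvar N"
    using qpoly_division[OF assms] by blast
  have "Phi f = frob r0 + lin * frob r1"
    unfolding Q(4) Phi_simps Phi_qpoly using Phi_frob Q(2,3) by (simp add: mult.commute)
  with Q that show ?thesis by blast
qed

text \<open>Dividing each \<open>Z i\<close> by \<open>qpoly\<close> writes the sum as
  \<open>\<alpha> + lin * \<omega>\<close>. The coefficients of \<open>\<alpha>\<close> and
  \<open>\<omega>\<close> lie in \<open>E\<close>, since those of \<open>frob\<close> are squares.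
  So \<open>lin * \<omega> = \<alpha>\<close> has coefficients in \<open>E\<close>, which forces
  \<open>\<omega> = 0\<close> and then \<open>\<alpha> = 0\<close>. In both, every coefficient is a
  relation between the \<open>t i\<close> over the squares, so all remainders vanish.\<close>

lemma Phi_indep:
  assumes E: "sq_subfield E" and i0: "i0 < N" "b i0 / b N \<notin> E" and T: "finite T"
    and t: "\<And>i. i \<in> T \<Longrightarrow> t i \<in> E" and ind: "indep squares t T"
    and Z: "\<And>i. i \<in> T \<Longrightarrow> Z i \<in> mpolys {..<Suc N}"
    and eq: "(\<Sum>i\<in>T. mconst (t i) * Phi (Z i)) = 0" and i: "i \<in> T"
  shows "Phi (Z i) = 0"
proof -
  have "\<forall>i\<in>T. \<exists>r0 r1. Phi (Z i) = frob r0 + lin * frob r1"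
    using Z Phi_decompose by metis
  then obtain r0 r1 where r: "\<And>i. i \<in> T \<Longrightarrow> Phi (Z i) = frob (r0 i) + lin * frob (r1 i)"
    by metis
  define \<alpha> where "\<alpha> = (\<Sum>i\<in>T. mconst (t i) * frob (r0 i))"
  define \<omega> where "\<omega> = (\<Sum>i\<in>T. mconst (t i) * frob (r1 i))"
  have "(\<Sum>i\<in>T. mconst (t i) * Phi (Z i)) = \<alpha> + lin * \<omega>"
    unfolding \<alpha>_def \<omega>_def sum_distrib_left sum.distrib[symmetric]
    by (rule sum.cong) (simp_all add: r algebra_simps)
  then have \<alpha>\<omega>: "\<alpha> = lin * \<omega>" using eq by (simp add: add_eq_0_char2)
  have E_coeff: "lookup (\<Sum>i\<in>T. mconst (t i) * frob (r i)) m \<in> E" for r m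
    unfolding lookup_sum lookup_mconst_mult lookup_frob
    by (intro sq_subfield_sum[OF E] sq_subfieldD[OF E] t)
  have zero: "r i = 0" if "(\<Sum>i\<in>T. mconst (t i) * frob (r i)) = 0" for r
  proof (rule poly_mapping_eqI)
    fix m
    have "(\<Sum>i\<in>T. t i * (lookup (r i) m)^2) = 0"
      using arg_cong[OF that, of "\<lambda>f. lookup f m"] by (simp add: lookup_sum lookup_mconst_mult lookup_frob)
    then have "(lookup (r i) m)^2 = 0"
      using ind i unfolding indep_def by fastforce
    then show "lookup (r i) m = lookup 0 m" by simp
  qed
  have "\<omega> = 0"
  proof (rule lin_mult_coeffs[OF E i0])
    show "lookup \<omega> m \<in> E" for m unfolding \<omega>_def by (rule E_coeff)
    show "lookup (lin * \<omega>) m \<in> E" for m unfolding \<alpha>\<omega>[symmetric] unfolding \<alpha>_def by (rule E_coeff)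
  qed
  then show ?thesis
    using zero[of r0] zero[of r1] \<alpha>\<omega> r[OF i] unfolding \<omega>_def \<alpha>_def by (simp add: frob_eq_0_iff)
qed

text \<open>The same argument with \<open>E\<close> the field of squares: a remainder
  \<open>r0 + r1 X_N\<close> in the kernel gives \<open>frob r0 = lin * frob r1\<close>, where both
  \<open>frob\<close> terms have square coefficients, so \<open>r0 = r1 = 0\<close>.\<close>

lemma Phi_kernel:
  assumes "f \<in> mpolys {..<Suc N}"
  shows "Phi f = 0 \<longleftrightarrow> (\<exists>Q\<in>mpolys {..<Suc N}. f = qpoly * Q)"
proof
  assume "Phi f = 0"
  obtain Q r0 r1 where Q: "Q \<in> mpolys {..<Suc N}" "f = qpoly * Q + r0 + r1 * mvar N"
    "Phi f = frob r0 + lin * frob r1"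
    using Phi_decompose[OF assms] .
  then have eq: "frob r0 = lin * frob r1" using \<open>Phi f = 0\<close> by (simp add: add_eq_0_char2)
  have "frob r1 = 0"
  proof (rule lin_mult_coeffs[OF sq_subfield_squares N])
    show "lookup (lin * frob r1) m \<in> squares" for m
      unfolding eq[symmetric] by (simp add: lookup_frob)
  qed (use nonsquare in \<open>auto simp: lookup_frob\<close>)
  then have "r0 = 0" "r1 = 0" using eq by (auto simp: frob_eq_0_iff)
  then show "\<exists>Q\<in>mpolys {..<Suc N}. f = qpoly * Q" using Q by auto
next
  assume "\<exists>Q\<in>mpolys {..<Suc N}. f = qpoly * Q"
  then show "Phi f = 0" by (auto simp: Phi_simps Phi_qpoly)
qed

text \<open>A copy of the function field, realized as its own subfield of squares inside the
  rational functions in the \<open>Y_i\<close>.\<close>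

definition fracs :: "'a mp fract set" where
  "fracs = {emb (Phi f) / emb (Phi g) | f g.
     f \<in> mpolys {..<Suc N} \<and> g \<in> mpolys {..<Suc N} \<and> Phi g \<noteq> 0}"

text \<open>\<open>Phi_indep\<close> after clearing denominators. This is the criterion that keeps
  ranks from dropping: elements of \<open>E\<close> that are independent over the squares stay
  independent over the function field.\<close>

lemma fracs_indep:
  assumes E: "sq_subfield E" and i0: "i0 < N" "b i0 / b N \<notin> E" and T: "finite T"
    and t: "\<And>i. i \<in> T \<Longrightarrow> t i \<in> E" and ind: "indep squares t T"
  shows "indep fracs (\<lambda>i. embc (t i)) T"
  unfolding indep_def
proof (intro allI impI ballI)
  fix w i assume w: "\<forall>i\<in>T. w i \<in> fracs" and eq: "(\<Sum>i\<in>T. embc (t i) * w i) = 0" and i: "i \<in> T"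
  have "\<forall>i\<in>T. \<exists>f g. w i = emb (Phi f) / emb (Phi g) \<and> f \<in> mpolys {..<Suc N} \<and> g \<in> mpolys {..<Suc N} \<and> Phi g \<noteq> 0"
    using w unfolding fracs_def by blast
  then obtain f g where fg: "\<And>i. i \<in> T \<Longrightarrow> w i = emb (Phi (f i)) / emb (Phi (g i))"
      "\<And>i. i \<in> T \<Longrightarrow> f i \<in> mpolys {..<Suc N}" "\<And>i. i \<in> T \<Longrightarrow> g i \<in> mpolys {..<Suc N}"
      "\<And>i. i \<in> T \<Longrightarrow> Phi (g i) \<noteq> 0"
    by metis
  \<comment> \<open>The image of \<open>h i\<close> under \<open>Phi\<close> is \<open>w i\<close>
    multiplied by all denominators.\<close>
  define h where "h i = f i * (\<Prod>j\<in>T - {i}. g j)" for i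
  have prod_g: "(\<Prod>j\<in>A. g j) \<in> mpolys {..<Suc N}" "emb (Phi (\<Prod>j\<in>A. g j)) = (\<Prod>j\<in>A. emb (Phi (g j)))"
    if "A \<subseteq> T" for A
  proof -
    have "finite A" using that T finite_subset by auto
    then show "(\<Prod>j\<in>A. g j) \<in> mpolys {..<Suc N}" "emb (Phi (\<Prod>j\<in>A. g j)) = (\<Prod>j\<in>A. emb (Phi (g j)))"
      using that by (induction A) (auto simp: fg Phi_simps emb_simps intro: mpolys_mult)
  qed
  have h: "h i \<in> mpolys {..<Suc N}" "emb (Phi (h i)) = (\<Prod>j\<in>T. emb (Phi (g j))) * w i" if "i \<in> T" for i
  proof -
    show "h i \<in> mpolys {..<Suc N}" unfolding h_def using prod_g(1) fg(2) that by (intro mpolys_mult) auto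
    have "(\<Prod>j\<in>T. emb (Phi (g j))) * w i = emb (Phi (g i)) * w i * (\<Prod>j\<in>T-{i}. emb (Phi (g j)))"
      using that T by (simp add: prod.remove)
    also have "emb (Phi (g i)) * w i = emb (Phi (f i))"
      using emb_simps(5)[of "Phi (g i)"] fg(4)[OF that] unfolding fg(1)[OF that]
      by (metis nonzero_mult_div_cancel_left times_divide_eq_right)
    finally show "emb (Phi (h i)) = (\<Prod>j\<in>T. emb (Phi (g j))) * w i"
      unfolding h_def Phi_simps emb_simps by (simp add: prod_g)
  qed
  have "emb (\<Sum>i\<in>T. mconst (t i) * Phi (h i)) = (\<Prod>j\<in>T. emb (Phi (g j))) * (\<Sum>i\<in>T. embc (t i) * w i)"
    unfolding emb_sum sum_distrib_left by (rule sum.cong) (simp_all add: emb_simps h)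
  then have "(\<Sum>i\<in>T. mconst (t i) * Phi (h i)) = 0" using eq by (simp add: emb_simps)
  then have "Phi (h i) = 0"
    using t ind h(1) i by (intro Phi_indep[OF E i0 T, where t = t and Z = h]) assumption+
  then have "(\<Prod>j\<in>T. emb (Phi (g j))) * w i = 0" using h(2)[OF i] by (simp add: emb_simps)
  moreover have "(\<Prod>j\<in>T. emb (Phi (g j))) \<noteq> 0" using fg(4) T by (simp add: emb_simps)
  ultimately show "w i = 0" by simp
qed

text \<open>The coordinates of the generic point of the quadric. As \<open>x i\<close> stands for
  the square of the \<open>i\<close>-th coordinate, the equation is linear and \<open>b i\<close>
  enters unsquared. That no \<open>x i\<close> vanishes allows solving for any chosen
  coefficient.\<close>

lemma generic_zero:
  "\<exists>x. (\<forall>i<Suc N. x i \<in> fracs \<and> x i \<noteq> 0) \<and> (\<Sum>i<Suc N. embc (b i) * x i) = 0"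
proof (intro exI[of _ "\<lambda>i. emb (Phi (mvar i))"] conjI allI impI)
  fix i assume i: "i < Suc N"
  have "mvar i \<in> mpolys {..<Suc N}" using i by (intro mpolys_single) auto
  then show "emb (Phi (mvar i)) \<in> fracs"
    unfolding fracs_def
    by (intro CollectI exI[of _ "mvar i"] exI[of _ 1]) (simp add: Phi_simps emb_simps)
  have "lookup lin {#0#} = (\<Sum>j<N. if j = 0 then b 0 / b N else 0)"
    unfolding lin_def lookup_sum by (rule sum.cong) (auto simp: lookup_single when_def)
  also have "\<dots> \<noteq> 0" using N nonsquare by (auto simp: image_iff dest: spec[of _ 0])
  finally have "lin \<noteq> 0" by auto
  moreover have "mvar i \<noteq> (0 :: 'a mp)" by (metis lookup_single_eq lookup_zero zero_neq_one)
  ultimately show "emb (Phi (mvar i)) \<noteq> 0" by (simp add: emb_simps Phi_simps)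
next
  have "(\<Sum>i<Suc N. mconst (b i) * Phi (mvar i)) = (\<Sum>i<N. single {#i#} (b i)) + mconst (b N) * lin"
    by (simp add: Phi_simps mult_single)
  also have "mconst (b N) * lin = (\<Sum>i<N. single {#i#} (b i))"
    using bN by (simp add: lin_def sum_distrib_left mult_single)
  finally have "emb (\<Sum>i<Suc N. mconst (b i) * Phi (mvar i)) = 0" by (simp add: emb_simps)
  then show "(\<Sum>i<Suc N. embc (b i) * emb (Phi (mvar i))) = 0"
    unfolding emb_sum emb_simps .
qed

end

section \<open>Embeddings into typed rings\<close>

text \<open>Neither ring axioms nor closure are presupposed for \<open>R\<close>: an injective map
  that respects the operations is enough to pull the axioms back from a typed ring.\<close>

definition embeds :: "('r, 'm) ring_scheme \<Rightarrow> ('r \<Rightarrow> 'k::comm_ring_1) \<Rightarrow> bool" where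
  "embeds R \<theta> \<longleftrightarrow>
     inj_on \<theta> (carrier R) \<and> \<zero>\<^bsub>R\<^esub> \<in> carrier R \<and> \<one>\<^bsub>R\<^esub> \<in> carrier R \<and>
     \<theta> \<zero>\<^bsub>R\<^esub> = 0 \<and> \<theta> \<one>\<^bsub>R\<^esub> = 1 \<and>
     (\<forall>x\<in>carrier R. \<forall>y\<in>carrier R.
        x \<oplus>\<^bsub>R\<^esub> y \<in> carrier R \<and> \<theta> (x \<oplus>\<^bsub>R\<^esub> y) = \<theta> x + \<theta> y \<and>
        x \<otimes>\<^bsub>R\<^esub> y \<in> carrier R \<and> \<theta> (x \<otimes>\<^bsub>R\<^esub> y) = \<theta> x * \<theta> y)"

lemma embedsD:
  assumes "embeds R \<theta>"
  shows "\<zero>\<^bsub>R\<^esub> \<in> carrier R" "\<one>\<^bsub>R\<^esub> \<in> carrier R" "\<theta> \<zero>\<^bsub>R\<^esub> = 0" "\<theta> \<one>\<^bsub>R\<^esub> = 1"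
    "x \<in> carrier R \<Longrightarrow> y \<in> carrier R \<Longrightarrow> x \<oplus>\<^bsub>R\<^esub> y \<in> carrier R"
    "x \<in> carrier R \<Longrightarrow> y \<in> carrier R \<Longrightarrow> x \<otimes>\<^bsub>R\<^esub> y \<in> carrier R"
    "x \<in> carrier R \<Longrightarrow> y \<in> carrier R \<Longrightarrow> \<theta> (x \<oplus>\<^bsub>R\<^esub> y) = \<theta> x + \<theta> y"
    "x \<in> carrier R \<Longrightarrow> y \<in> carrier R \<Longrightarrow> \<theta> (x \<otimes>\<^bsub>R\<^esub> y) = \<theta> x * \<theta> y"
    "x \<in> carrier R \<Longrightarrow> y \<in> carrier R \<Longrightarrow> \<theta> x = \<theta> y \<longleftrightarrow> x = y"
    "x \<in> carrier R \<Longrightarrow> \<theta> x = 0 \<longleftrightarrow> x = \<zero>\<^bsub>R\<^esub>"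
  using assms unfolding embeds_def inj_on_def by (fast | metis)+

text \<open>Every axiom is an identity that can be checked in the typed ring. The one existence
  axiom, for negatives, is met in characteristic 2 by the element itself.\<close>

lemma embeds_cring:
  fixes \<theta> :: "'r \<Rightarrow> 'k::ring_char2"
  assumes "embeds R \<theta>"
  shows "cring R"
proof -
  note D = embedsD[OF assms]
  have eqI: "x = y" if "x \<in> carrier R" "y \<in> carrier R" "\<theta> x = \<theta> y" for x y
    using that D(9) by blast
  show ?thesis
  proof (intro cringI abelian_groupI comm_monoidI)
    fix x y z assume x: "x \<in> carrier R" and y: "y \<in> carrier R"
    show "x \<oplus>\<^bsub>R\<^esub> y \<in> carrier R" "x \<otimes>\<^bsub>R\<^esub> y \<in> carrier R" by (rule D x y)+
    show "\<exists>y\<in>carrier R. y \<oplus>\<^bsub>R\<^esub> x = \<zero>\<^bsub>R\<^esub>"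
    proof
      show "x \<oplus>\<^bsub>R\<^esub> x = \<zero>\<^bsub>R\<^esub>" by (rule eqI) (simp_all add: D(1-8) x)
    qed (rule x)
    show "x \<oplus>\<^bsub>R\<^esub> y = y \<oplus>\<^bsub>R\<^esub> x" "x \<otimes>\<^bsub>R\<^esub> y = y \<otimes>\<^bsub>R\<^esub> x"
      by (rule eqI; simp add: D(1-8) x y ac_simps)+
    show "\<zero>\<^bsub>R\<^esub> \<oplus>\<^bsub>R\<^esub> x = x" "\<one>\<^bsub>R\<^esub> \<otimes>\<^bsub>R\<^esub> x = x"
      by (rule eqI; simp add: D(1-8) x)+
    assume z: "z \<in> carrier R"
    show "x \<oplus>\<^bsub>R\<^esub> y \<oplus>\<^bsub>R\<^esub> z = x \<oplus>\<^bsub>R\<^esub> (y \<oplus>\<^bsub>R\<^esub> z)" "x \<otimes>\<^bsub>R\<^esub> y \<otimes>\<^bsub>R\<^esub> z = x \<otimes>\<^bsub>R\<^esub> (y \<otimes>\<^bsub>R\<^esub> z)"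
      by (rule eqI; simp add: D(1-8) x y z ac_simps)+
    show "(x \<oplus>\<^bsub>R\<^esub> y) \<otimes>\<^bsub>R\<^esub> z = x \<otimes>\<^bsub>R\<^esub> z \<oplus>\<^bsub>R\<^esub> y \<otimes>\<^bsub>R\<^esub> z"
      by (rule eqI) (simp_all add: D(1-8) x y z distrib_right)
  qed (rule D)+
qed

lemma embeds_field:
  fixes \<theta> :: "'r \<Rightarrow> 'k::{field,ring_char2}"
  assumes "embeds R \<theta>"
    and inv: "\<And>x. x \<in> carrier R \<Longrightarrow> x \<noteq> \<zero>\<^bsub>R\<^esub> \<Longrightarrow> \<exists>y\<in>carrier R. \<theta> x * \<theta> y = 1"
  shows "field R"
proof -
  note D = embedsD[OF assms(1)]
  interpret cring R by (rule embeds_cring[OF assms(1)])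
  show ?thesis
  proof (rule cring_fieldI2)
    show "\<zero>\<^bsub>R\<^esub> \<noteq> \<one>\<^bsub>R\<^esub>" using D(3,4) by (metis zero_neq_one)
    show "\<exists>b\<in>carrier R. a \<otimes>\<^bsub>R\<^esub> b = \<one>\<^bsub>R\<^esub>" if a: "a \<in> carrier R" "a \<noteq> \<zero>\<^bsub>R\<^esub>" for a
    proof -
      obtain b where b: "b \<in> carrier R" "\<theta> a * \<theta> b = 1" using inv[OF a] by blast
      then have "\<theta> (a \<otimes>\<^bsub>R\<^esub> b) = \<theta> \<one>\<^bsub>R\<^esub>" using a D(8,4) by simp
      then show ?thesis using b a D(2,6,9) by blast
    qed
  qed
qed

lemma embeds_finsum:
  fixes \<theta> :: "'r \<Rightarrow> 'k::ring_char2"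
  assumes "embeds R \<theta>" "\<And>i. i \<in> A \<Longrightarrow> f i \<in> carrier R"
  shows "\<theta> (\<Oplus>\<^bsub>R\<^esub>i\<in>A. f i) = (\<Sum>i\<in>A. \<theta> (f i))"
proof -
  note D = embedsD[OF assms(1)]
  interpret cring R by (rule embeds_cring[OF assms(1)])
  show ?thesis using assms(2)
  proof (induction A rule: infinite_finite_induct)
    case (insert a A)
    then have "finsum R f (insert a A) = f a \<oplus>\<^bsub>R\<^esub> finsum R f A"
      by (intro finsum_insert) auto
    moreover have "finsum R f A \<in> carrier R" using insert by (intro finsum_closed) auto
    ultimately show ?case using insert by (simp add: D)
  qed (simp_all add: D finsum_infinite)
qed

lemma embeds_pow:
  fixes \<theta> :: "'r \<Rightarrow> 'k::ring_char2"
  assumes "embeds R \<theta>" "x \<in> carrier R"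
  shows "\<theta> (x [^]\<^bsub>R\<^esub> (n::nat)) = \<theta> x ^ n"
proof -
  note D = embedsD[OF assms(1)]
  interpret cring R by (rule embeds_cring[OF assms(1)])
  show ?thesis using assms(2) by (induction n) (simp_all add: D mult.commute)
qed

section \<open>Typed rings as structures, and quotients by kernels\<close>

definition univ_ring :: "'k::comm_ring_1 itself \<Rightarrow> 'k ring" where
  "univ_ring _ = \<lparr>carrier = UNIV, monoid.mult = (*), one = 1, zero = 0, add = (+)\<rparr>"

lemma univ_ring_simps [simp]:
  "carrier (univ_ring TYPE('k::comm_ring_1)) = UNIV"
  "x \<otimes>\<^bsub>univ_ring TYPE('k)\<^esub> y = x * y" "x \<oplus>\<^bsub>univ_ring TYPE('k)\<^esub> y = x + y"
  "\<one>\<^bsub>univ_ring TYPE('k)\<^esub> = 1" "\<zero>\<^bsub>univ_ring TYPE('k)\<^esub> = 0"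
  by (simp_all add: univ_ring_def)

lemma cring_univ_ring: "cring (univ_ring TYPE('k::ring_char2))"
  by (rule embeds_cring[of _ id]) (simp add: embeds_def)

text \<open>First isomorphism theorem; it is applied to \<open>Phi\<close>, whose kernel is the
  ideal of the quadric.\<close>

lemma embeds_quotient:
  fixes g :: "'r \<Rightarrow> 'k::ring_char2"
  assumes "cring P"
    and g: "\<And>x y. x \<in> carrier P \<Longrightarrow> y \<in> carrier P \<Longrightarrow> g (x \<oplus>\<^bsub>P\<^esub> y) = g x + g y"
      "\<And>x y. x \<in> carrier P \<Longrightarrow> y \<in> carrier P \<Longrightarrow> g (x \<otimes>\<^bsub>P\<^esub> y) = g x * g y" "g \<one>\<^bsub>P\<^esub> = 1"
    and I: "I = {x \<in> carrier P. g x = 0}"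
  obtains \<theta> where "embeds (P Quot I) \<theta>" "\<And>x. x \<in> carrier P \<Longrightarrow> \<theta> (I +>\<^bsub>P\<^esub> x) = g x"
    "\<And>x. x \<in> carrier P \<Longrightarrow> I +>\<^bsub>P\<^esub> x \<in> carrier (P Quot I)"
    "carrier (P Quot I) = (\<lambda>x. I +>\<^bsub>P\<^esub> x) ` carrier P"
proof -
  let ?U = "univ_ring TYPE('k)"
  interpret P: cring P by fact
  interpret U: cring ?U by (rule cring_univ_ring)
  have "g \<in> ring_hom P ?U" using g by (auto simp: ring_hom_def)
  then interpret h: ring_hom_ring P ?U g
    by (intro ring_hom_ringI2 P.ring_axioms U.ring_axioms)
  have I': "a_kernel P ?U g = I" unfolding I a_kernel_def' by simp
  let ?\<theta> = "\<lambda>C. the_elem (g ` C)"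
  have hom: "?\<theta> \<in> ring_hom (P Quot I) ?U" using h.the_elem_hom unfolding I' .
  have "ideal I P" using h.kernel_is_ideal unfolding I' .
  then interpret Q: ring "P Quot I" by (rule ideal.quotient_is_ring)
  have car: "carrier (P Quot I) = (\<lambda>x. I +>\<^bsub>P\<^esub> x) ` carrier P"
    by (auto simp: FactRing_def A_RCOSETS_def')
  have val: "?\<theta> (I +>\<^bsub>P\<^esub> x) = g x" if "x \<in> carrier P" for x
    using h.the_elem_simp[OF that] unfolding I' .
  have "inj_on ?\<theta> (carrier (P Quot I))"
    using h.the_elem_inj unfolding I' by (intro inj_onI)
  moreover have "?\<theta> \<zero>\<^bsub>P Quot I\<^esub> = 0" "?\<theta> \<one>\<^bsub>P Quot I\<^esub> = 1"
    using ring_hom_zero[OF hom Q.ring_axioms U.ring_axioms] ring_hom_one[OF hom] by auto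
  ultimately have "embeds (P Quot I) ?\<theta>"
    unfolding embeds_def using ring_hom_mult[OF hom] ring_hom_add[OF hom] by auto
  then show ?thesis using that val car by blast
qed

lemma Fract_eq_divide: "Fract a b = Fract a 1 / Fract b 1" for a b :: "'k::idom"
  by (cases "b = 0") (simp_all add: Fract_def[symmetric] fract_collapse)

section \<open>Fields of fractions\<close>

context
  fixes R :: "('r, 'm) ring_scheme" and \<theta> :: "'r \<Rightarrow> 'k::{idom,ring_char2}"
  assumes emb: "embeds R \<theta>"
begin

private lemmas D = embedsD[OF emb]

lemma frac_rel_iff:
  "((a, b), (c, d)) \<in> frac_rel R \<longleftrightarrow>
     a \<in> carrier R \<and> b \<in> carrier R - {\<zero>\<^bsub>R\<^esub>} \<and> c \<in> carrier R \<and> d \<in> carrier R - {\<zero>\<^bsub>R\<^esub>} \<and>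
     Fract (\<theta> a) (\<theta> b) = Fract (\<theta> c) (\<theta> d)"
proof -
  have "a \<otimes>\<^bsub>R\<^esub> d = c \<otimes>\<^bsub>R\<^esub> b \<longleftrightarrow> Fract (\<theta> a) (\<theta> b) = Fract (\<theta> c) (\<theta> d)"
    if "a \<in> carrier R" "b \<in> carrier R" "b \<noteq> \<zero>\<^bsub>R\<^esub>" "c \<in> carrier R" "d \<in> carrier R" "d \<noteq> \<zero>\<^bsub>R\<^esub>"
    using that D(9)[of "a \<otimes>\<^bsub>R\<^esub> d" "c \<otimes>\<^bsub>R\<^esub> b"] by (simp add: eq_fract D)
  then show ?thesis unfolding frac_rel_def by auto
qed

definition frac_val :: "('r \<times> 'r) set \<Rightarrow> 'k fract" where
  "frac_val A = (case SOME x. x \<in> A of (a, b) \<Rightarrow> Fract (\<theta> a) (\<theta> b))"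

lemma frac_of_eq:
  assumes "a \<in> carrier R" "b \<in> carrier R - {\<zero>\<^bsub>R\<^esub>}"
  shows "frac_of R a b = {(c, d). c \<in> carrier R \<and> d \<in> carrier R - {\<zero>\<^bsub>R\<^esub>} \<and>
     Fract (\<theta> c) (\<theta> d) = Fract (\<theta> a) (\<theta> b)}"
  using assms unfolding frac_of_def by (auto simp: frac_rel_iff)

lemma frac_of_mem: "a \<in> carrier R \<Longrightarrow> b \<in> carrier R - {\<zero>\<^bsub>R\<^esub>} \<Longrightarrow> (a, b) \<in> frac_of R a b"
  by (simp add: frac_of_eq)

lemma frac_val_frac_of:
  assumes "a \<in> carrier R" "b \<in> carrier R - {\<zero>\<^bsub>R\<^esub>}"
  shows "frac_val (frac_of R a b) = Fract (\<theta> a) (\<theta> b)"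
proof -
  obtain c d where cd: "(SOME x. x \<in> frac_of R a b) = (c, d)" by fastforce
  have "(SOME x. x \<in> frac_of R a b) \<in> frac_of R a b"
    by (rule someI) (rule frac_of_mem[OF assms])
  then have "(c, d) \<in> frac_of R a b" unfolding cd .
  then have "Fract (\<theta> c) (\<theta> d) = Fract (\<theta> a) (\<theta> b)" unfolding frac_of_eq[OF assms] by simp
  then show ?thesis by (simp add: frac_val_def cd)
qed

lemma frac_carrier:
  "carrier (frac_field R) = {frac_of R a b | a b. a \<in> carrier R \<and> b \<in> carrier R - {\<zero>\<^bsub>R\<^esub>}}"
  by (auto simp: frac_field_def frac_of_def quotient_def)

text \<open>The operations of \<open>frac_field\<close> are unions over all representatives. Such a
  union collapses to one class because the value of the result depends on the values of the
  arguments alone, through \<open>g\<close>. The numerator \<open>f\<close> is left open so that sum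
  and product are covered together.\<close>

lemma frac_op:
  assumes A: "a \<in> carrier R" "b \<in> carrier R - {\<zero>\<^bsub>R\<^esub>}" "c \<in> carrier R" "d \<in> carrier R - {\<zero>\<^bsub>R\<^esub>}"
    and f: "\<And>a b c d. a \<in> carrier R \<Longrightarrow> b \<in> carrier R - {\<zero>\<^bsub>R\<^esub>} \<Longrightarrow> c \<in> carrier R \<Longrightarrow> d \<in> carrier R - {\<zero>\<^bsub>R\<^esub>} \<Longrightarrow>
        f a b c d \<in> carrier R \<and> b \<otimes>\<^bsub>R\<^esub> d \<in> carrier R - {\<zero>\<^bsub>R\<^esub>} \<and>
        Fract (\<theta> (f a b c d)) (\<theta> (b \<otimes>\<^bsub>R\<^esub> d)) = g (Fract (\<theta> a) (\<theta> b)) (Fract (\<theta> c) (\<theta> d))"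
  shows "(\<Union>(a, b)\<in>frac_of R a b. \<Union>(c, d)\<in>frac_of R c d. frac_of R (f a b c d) (b \<otimes>\<^bsub>R\<^esub> d)) =
     frac_of R (f a b c d) (b \<otimes>\<^bsub>R\<^esub> d)"
proof -
  have "frac_of R (f a' b' c' d') (b' \<otimes>\<^bsub>R\<^esub> d') = frac_of R (f a b c d) (b \<otimes>\<^bsub>R\<^esub> d)"
    if "(a', b') \<in> frac_of R a b" "(c', d') \<in> frac_of R c d" for a' b' c' d'
  proof -
    have P: "a' \<in> carrier R" "b' \<in> carrier R - {\<zero>\<^bsub>R\<^esub>}" "c' \<in> carrier R" "d' \<in> carrier R - {\<zero>\<^bsub>R\<^esub>}"
      "Fract (\<theta> a') (\<theta> b') = Fract (\<theta> a) (\<theta> b)" "Fract (\<theta> c') (\<theta> d') = Fract (\<theta> c) (\<theta> d)"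
      using that A by (auto simp: frac_of_eq)
    show ?thesis using f[OF A] f[OF P(1-4)] P(5,6) by (simp add: frac_of_eq)
  qed
  then show ?thesis using frac_of_mem[OF A(1,2)] frac_of_mem[OF A(3,4)] by fast
qed

lemma frac_ops:
  assumes "a \<in> carrier R" "b \<in> carrier R - {\<zero>\<^bsub>R\<^esub>}" "c \<in> carrier R" "d \<in> carrier R - {\<zero>\<^bsub>R\<^esub>}"
  shows "frac_of R a b \<otimes>\<^bsub>frac_field R\<^esub> frac_of R c d = frac_of R (a \<otimes>\<^bsub>R\<^esub> c) (b \<otimes>\<^bsub>R\<^esub> d)"
    "frac_of R a b \<oplus>\<^bsub>frac_field R\<^esub> frac_of R c d = frac_of R (a \<otimes>\<^bsub>R\<^esub> d \<oplus>\<^bsub>R\<^esub> c \<otimes>\<^bsub>R\<^esub> b) (b \<otimes>\<^bsub>R\<^esub> d)"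
proof -
  have nz: "b \<otimes>\<^bsub>R\<^esub> d \<in> carrier R - {\<zero>\<^bsub>R\<^esub>}" if "b \<in> carrier R - {\<zero>\<^bsub>R\<^esub>}" "d \<in> carrier R - {\<zero>\<^bsub>R\<^esub>}" for b d
    using that D(10)[of "b \<otimes>\<^bsub>R\<^esub> d"] by (auto simp: D)
  show "frac_of R a b \<otimes>\<^bsub>frac_field R\<^esub> frac_of R c d = frac_of R (a \<otimes>\<^bsub>R\<^esub> c) (b \<otimes>\<^bsub>R\<^esub> d)"
    unfolding frac_field_def monoid.simps
    by (rule frac_op[OF assms, where g = "(*)"]) (use nz in \<open>auto simp: D\<close>)
  show "frac_of R a b \<oplus>\<^bsub>frac_field R\<^esub> frac_of R c d = frac_of R (a \<otimes>\<^bsub>R\<^esub> d \<oplus>\<^bsub>R\<^esub> c \<otimes>\<^bsub>R\<^esub> b) (b \<otimes>\<^bsub>R\<^esub> d)"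
    unfolding frac_field_def ring_record_simps
    by (rule frac_op[OF assms, where g = "(+)"]) (use nz in \<open>auto simp: D\<close>)
qed

lemma embeds_frac_field: "embeds (frac_field R) frac_val"
  unfolding embeds_def
proof (intro conjI ballI)
  have one: "\<one>\<^bsub>R\<^esub> \<in> carrier R - {\<zero>\<^bsub>R\<^esub>}" using D(2-4) by (metis DiffI singletonD zero_neq_one)
  have zo: "\<zero>\<^bsub>frac_field R\<^esub> = frac_of R \<zero>\<^bsub>R\<^esub> \<one>\<^bsub>R\<^esub>" "\<one>\<^bsub>frac_field R\<^esub> = frac_of R \<one>\<^bsub>R\<^esub> \<one>\<^bsub>R\<^esub>"
    by (simp_all add: frac_field_def)
  show "\<zero>\<^bsub>frac_field R\<^esub> \<in> carrier (frac_field R)" "\<one>\<^bsub>frac_field R\<^esub> \<in> carrier (frac_field R)"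
    unfolding zo frac_carrier using one D(1,2) by auto
  show "frac_val \<zero>\<^bsub>frac_field R\<^esub> = 0" "frac_val \<one>\<^bsub>frac_field R\<^esub> = 1"
    unfolding zo using frac_val_frac_of one D(1,2) by (simp_all add: D(3,4) fract_collapse)
  show "inj_on frac_val (carrier (frac_field R))"
  proof (rule inj_onI)
    fix x y assume "x \<in> carrier (frac_field R)" "y \<in> carrier (frac_field R)" "frac_val x = frac_val y"
    then obtain a b c d where x: "x = frac_of R a b" and y: "y = frac_of R c d" and
      A: "a \<in> carrier R" "b \<in> carrier R - {\<zero>\<^bsub>R\<^esub>}" "c \<in> carrier R" "d \<in> carrier R - {\<zero>\<^bsub>R\<^esub>}"
      and "frac_val (frac_of R a b) = frac_val (frac_of R c d)"
      unfolding frac_carrier by blast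
    then show "x = y" using frac_val_frac_of[OF A(1,2)] frac_val_frac_of[OF A(3,4)]
      unfolding x y frac_of_eq[OF A(1,2)] frac_of_eq[OF A(3,4)] by simp
  qed
  fix x y assume "x \<in> carrier (frac_field R)" "y \<in> carrier (frac_field R)"
  then obtain a b c d where x: "x = frac_of R a b" and y: "y = frac_of R c d" and
    A: "a \<in> carrier R" "b \<in> carrier R - {\<zero>\<^bsub>R\<^esub>}" "c \<in> carrier R" "d \<in> carrier R - {\<zero>\<^bsub>R\<^esub>}"
    unfolding frac_carrier by blast
  have nz: "b \<otimes>\<^bsub>R\<^esub> d \<in> carrier R - {\<zero>\<^bsub>R\<^esub>}"
    using A D(10)[of "b \<otimes>\<^bsub>R\<^esub> d"] by (auto simp: D)
  have car: "a \<otimes>\<^bsub>R\<^esub> c \<in> carrier R" "a \<otimes>\<^bsub>R\<^esub> d \<oplus>\<^bsub>R\<^esub> c \<otimes>\<^bsub>R\<^esub> b \<in> carrier R"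
    using A by (auto simp: D)
  show "x \<oplus>\<^bsub>frac_field R\<^esub> y \<in> carrier (frac_field R)" "x \<otimes>\<^bsub>frac_field R\<^esub> y \<in> carrier (frac_field R)"
    unfolding x y frac_ops[OF A] using nz car unfolding frac_carrier by blast+
  show "frac_val (x \<oplus>\<^bsub>frac_field R\<^esub> y) = frac_val x + frac_val y"
    "frac_val (x \<otimes>\<^bsub>frac_field R\<^esub> y) = frac_val x * frac_val y"
    unfolding x y frac_ops[OF A] frac_val_frac_of[OF car(1) nz] frac_val_frac_of[OF car(2) nz]
      frac_val_frac_of[OF A(1,2)] frac_val_frac_of[OF A(3,4)]
    using A by (auto simp: D)
qed

lemma frac_val_image:
  "frac_val ` carrier (frac_field R) = {Fract (\<theta> a) (\<theta> b) | a b. a \<in> carrier R \<and> b \<in> carrier R - {\<zero>\<^bsub>R\<^esub>}}"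
  unfolding frac_carrier by (auto simp: image_iff) (metis frac_val_frac_of DiffI singletonD)+

lemma field_frac_field: "field (frac_field R)"
proof (rule embeds_field[OF embeds_frac_field])
  fix x assume x: "x \<in> carrier (frac_field R)" "x \<noteq> \<zero>\<^bsub>frac_field R\<^esub>"
  then obtain a b where x': "x = frac_of R a b" and A: "a \<in> carrier R" "b \<in> carrier R - {\<zero>\<^bsub>R\<^esub>}"
    unfolding frac_carrier by blast
  have "frac_val x \<noteq> 0" using x embedsD(10)[OF embeds_frac_field] by blast
  then have "\<theta> a \<noteq> 0" unfolding x' frac_val_frac_of[OF A] by (auto simp: fract_collapse)
  then have "a \<in> carrier R - {\<zero>\<^bsub>R\<^esub>}" using A D(3) by auto
  then show "\<exists>y\<in>carrier (frac_field R). frac_val x * frac_val y = 1"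
    using A \<open>\<theta> a \<noteq> 0\<close> D(10)[of b]
    by (intro bexI[of _ "frac_of R b a"])
       (auto simp: x' frac_val_frac_of frac_carrier One_fract_def eq_fract)
qed

end

section \<open>The function field of a quadric\<close>

lemma finite_submultisets: "finite {l. l \<subseteq># m}"
proof (induction m)
  case empty
  then show ?case by simp
next
  case (add x m)
  have "{l. l \<subseteq># add_mset x m} \<subseteq> {l. l \<subseteq># m} \<union> add_mset x ` {l. l \<subseteq># m}"
  proof
    fix l assume l: "l \<in> {l. l \<subseteq># add_mset x m}"
    show "l \<in> {l. l \<subseteq># m} \<union> add_mset x ` {l. l \<subseteq># m}"
    proof (cases "x \<in># l")
      case True
      then have "l = add_mset x (l - {#x#})" by simp
      moreover from this l have "l - {#x#} \<subseteq># m" by (metis mem_Collect_eq mset_subset_eq_add_mset_cancel)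
      ultimately show ?thesis by blast
    next
      case False
      then have "l \<subseteq># m" using l
        by (metis mem_Collect_eq diff_single_trivial subset_eq_diff_conv add_mset_add_single)
      then show ?thesis by blast
    qed
  qed
  then show ?case using add finite_subset by blast
qed

text \<open>The product of \<open>mpoly_ring\<close> is defined by this sum over the divisors of a
  monomial; the formula identifies it with the product of finitely supported functions.\<close>

lemma lookup_mult_submultisets:
  "lookup (f * g) m = (\<Sum>l\<in>{l. l \<subseteq># m}. lookup f l * lookup g (m - l))"
  for f g :: "'a::comm_ring_1 mp"
proof (induction f rule: mp_induct)
  case (single k c)
  have "(\<Sum>l\<in>{l. l \<subseteq># m}. lookup (single k c) l * lookup g (m - l)) =
      (\<Sum>l\<in>{l. l \<subseteq># m}. if l = k then c * lookup g (m - k) else 0)"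
    by (rule sum.cong) (auto simp: lookup_single when_def)
  also have "\<dots> = (if k \<subseteq># m then c * lookup g (m - k) else 0)"
    by (simp add: sum.delta[OF finite_submultisets])
  also have "\<dots> = lookup (single k c * g) m"
  proof (induction g rule: mp_induct)
    case (single m' d)
    have "k + m' = m \<longleftrightarrow> k \<subseteq># m \<and> m' = m - k"
      by auto
    then show ?case by (auto simp: mult_single lookup_single when_def)
  next
    case (add f g)
    then show ?case by (simp add: distrib_left lookup_add split: if_splits)
  qed
  finally show ?case ..
next
  case (add f h)
  then show ?case by (simp add: distrib_right lookup_add sum.distrib)
qed

text \<open>Realizability speaks of structures on the type \<open>'u\<close>, while the algebra is
  done in a field given by type classes; \<open>\<sigma>\<close> is an isomorphism between the
  two.\<close>

locale field_model =
  fixes F :: "('u, 'm) ring_scheme" and \<sigma> :: "'u \<Rightarrow> 'a::{field,ring_char2}"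
  assumes F_field: "field F" and \<sigma>_embeds: "embeds F \<sigma>" and \<sigma>_surj: "\<sigma> ` carrier F = UNIV"
begin

sublocale F: field F by (rule F_field)

lemmas \<sigma> = embedsD[OF \<sigma>_embeds]

definition \<tau> :: "'a \<Rightarrow> 'u" where
  "\<tau> = inv_into (carrier F) \<sigma>"

lemma \<tau> [simp]: "\<tau> c \<in> carrier F" "\<sigma> (\<tau> c) = c"
  unfolding \<tau>_def using \<sigma>_surj by (auto intro: inv_into_into f_inv_into_f)

lemma \<tau>_\<sigma> [simp]: "x \<in> carrier F \<Longrightarrow> \<tau> (\<sigma> x) = x"
  using \<sigma>(9) \<tau> by blast

lemma \<tau>_simps: "\<tau> 0 = \<zero>\<^bsub>F\<^esub>" "\<tau> 1 = \<one>\<^bsub>F\<^esub>" "\<tau> (c + d) = \<tau> c \<oplus>\<^bsub>F\<^esub> \<tau> d" "\<tau> (c * d) = \<tau> c \<otimes>\<^bsub>F\<^esub> \<tau> d"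
  "\<tau> c = \<zero>\<^bsub>F\<^esub> \<longleftrightarrow> c = 0"
proof -
  show 0: "\<tau> 0 = \<zero>\<^bsub>F\<^esub>" and "\<tau> 1 = \<one>\<^bsub>F\<^esub>" using \<tau>_\<sigma> \<sigma>(1-4) by metis+
  show "\<tau> (c + d) = \<tau> c \<oplus>\<^bsub>F\<^esub> \<tau> d" "\<tau> (c * d) = \<tau> c \<otimes>\<^bsub>F\<^esub> \<tau> d"
    using \<sigma>(7,8)[of "\<tau> c" "\<tau> d"] \<tau>_\<sigma>[of "\<tau> c \<oplus>\<^bsub>F\<^esub> \<tau> d"] \<tau>_\<sigma>[of "\<tau> c \<otimes>\<^bsub>F\<^esub> \<tau> d"] by simp_all
  show "\<tau> c = \<zero>\<^bsub>F\<^esub> \<longleftrightarrow> c = 0" using 0 \<tau>(2) by metis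
qed

definition fromM :: "'a mp \<Rightarrow> nat multiset \<Rightarrow> 'u" where
  "fromM f m = \<tau> (lookup f m)"

definition toM :: "(nat multiset \<Rightarrow> 'u) \<Rightarrow> 'a mp" where
  "toM p = Abs_poly_mapping (\<lambda>m. \<sigma> (p m))"

lemma toM_fromM [simp]: "toM (fromM f) = f"
  by (simp add: toM_def fromM_def lookup_inverse)

lemma fromM_simps:
  "fromM (mconst c) = F.indexed_const (\<tau> c)"
  "fromM (f + g) = F.indexed_padd (fromM f) (fromM g)"
  "fromM (single (add_mset i m) c) = F.indexed_pmult (fromM (single m c)) i"
  by (auto simp: fromM_def fun_eq_iff F.indexed_const_def F.indexed_padd_def F.indexed_pmult_def
      lookup_single when_def lookup_add \<tau>_simps)

lemma fromM_zero: "fromM 0 = F.indexed_const \<zero>\<^bsub>F\<^esub>"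
  using fromM_simps(1)[of 0] by (simp add: \<tau>_simps)

lemma fromM_one: "fromM 1 = F.indexed_const \<one>\<^bsub>F\<^esub>"
  using fromM_simps(1)[of 1] by (simp add: \<tau>_simps)

lemma fromM_mpolys: "f \<in> mpolys I \<Longrightarrow> fromM f \<in> F.indexed_pset I (carrier F)"
proof (induction f rule: mpolys_induct)
  case (single m c)
  then show ?case
    by (induction m) (auto simp: fromM_simps intro: F.indexed_pset.intros)
next
  case (add f g)
  then show ?case by (auto simp: fromM_simps intro: F.indexed_pset.intros)
qed

lemma carrier_mpoly_ring: "carrier (mpoly_ring F I) = fromM ` mpolys I"
proof
  show "fromM ` mpolys I \<subseteq> carrier (mpoly_ring F I)"
    using fromM_mpolys by (auto simp: mpoly_ring_def)
  have "p \<in> fromM ` mpolys I" if "p \<in> F.indexed_pset I (carrier F)" for p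
    using that
  proof induction
    case (indexed_const k)
    then have "F.indexed_const k = fromM (mconst (\<sigma> k))" by (simp add: fromM_simps)
    then show ?case by (auto intro!: imageI mpolys_single)
  next
    case (indexed_padd P Q)
    then obtain f g where "f \<in> mpolys I" "g \<in> mpolys I" "P = fromM f" "Q = fromM g" by blast
    then show ?case by (auto simp flip: fromM_simps intro: mpolys_add)
  next
    case (indexed_pmult P i)
    then obtain f where f: "f \<in> mpolys I" "P = fromM f" by blast
    have "F.indexed_pmult P i = fromM (mvar i * f)"
      unfolding f(2) by (auto simp: fun_eq_iff fromM_def F.indexed_pmult_def lookup_single_mult \<tau>_simps)
    then show ?case using f indexed_pmult(2) by (auto intro!: mpolys_mult mpolys_single)
  qed
  then show "carrier (mpoly_ring F I) \<subseteq> fromM ` mpolys I" by (auto simp: mpoly_ring_def)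
qed

lemma mpoly_mult: "fromM f \<otimes>\<^bsub>mpoly_ring F I\<^esub> fromM g = fromM (f * g)"
proof
  fix m
  have "\<sigma> ((fromM f \<otimes>\<^bsub>mpoly_ring F I\<^esub> fromM g) m) = (\<Sum>l\<in>{l. l \<subseteq># m}. \<sigma> (fromM f l \<otimes>\<^bsub>F\<^esub> fromM g (m - l)))"
    unfolding mpoly_ring_def monoid.simps
    by (rule embeds_finsum[OF \<sigma>_embeds]) (simp add: fromM_def)
  also have "\<dots> = lookup (f * g) m"
    by (simp add: lookup_mult_submultisets fromM_def \<sigma>(8))
  finally have eq: "\<sigma> ((fromM f \<otimes>\<^bsub>mpoly_ring F I\<^esub> fromM g) m) = lookup (f * g) m" .
  have "(fromM f \<otimes>\<^bsub>mpoly_ring F I\<^esub> fromM g) m \<in> carrier F"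
    unfolding mpoly_ring_def monoid.simps by (rule F.finsum_closed) (simp add: fromM_def)
  then show "(fromM f \<otimes>\<^bsub>mpoly_ring F I\<^esub> fromM g) m = fromM (f * g) m"
    using \<tau>_\<sigma> eq unfolding fromM_def by metis
qed

lemma mpoly_ring_simps:
  "\<one>\<^bsub>mpoly_ring F I\<^esub> = fromM 1" "\<zero>\<^bsub>mpoly_ring F I\<^esub> = fromM 0"
  "fromM f \<oplus>\<^bsub>mpoly_ring F I\<^esub> fromM g = fromM (f + g)"
  "fromM f \<otimes>\<^bsub>mpoly_ring F I\<^esub> fromM g = fromM (f * g)"
proof -
  show "fromM f \<otimes>\<^bsub>mpoly_ring F I\<^esub> fromM g = fromM (f * g)" by (rule mpoly_mult)
qed (simp_all add: mpoly_ring_def fromM_one fromM_zero fromM_simps)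

lemma embeds_mpoly_ring: "embeds (mpoly_ring F I) toM"
proof -
  have "fromM f \<in> carrier (mpoly_ring F I)" if "f \<in> mpolys I" for f
    using that by (simp add: carrier_mpoly_ring)
  then show ?thesis unfolding embeds_def inj_on_def carrier_mpoly_ring
    by (auto simp: mpoly_ring_simps intro: mpolys_add mpolys_mult)
qed

lemma toM_carrier: "toM ` carrier (mpoly_ring F I) = mpolys I"
  by (auto simp: carrier_mpoly_ring image_image)

lemma indexed_var_eq: "F.indexed_var i = fromM (mvar i)"
  unfolding F.indexed_var_def using fromM_simps(3)[of i "{#}" 1] by (simp add: fromM_one)

lemma indexed_const_eq: "c \<in> carrier F \<Longrightarrow> F.indexed_const c = fromM (mconst (\<sigma> c))"
  by (simp add: fromM_simps)

end

locale quadric_model = field_model F \<sigma>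
  for F :: "('u, 'm) ring_scheme" and \<sigma> :: "'u \<Rightarrow> 'a::{field,ring_char2}" +
  fixes p :: "'u qform" and b :: "nat \<Rightarrow> 'a" and N :: nat
  assumes dim: "qdim p = Suc N"
    and p_closed: "\<And>i. i < Suc N \<Longrightarrow> qmap p (unit_coord F (Suc N) i) \<in> carrier F"
    and p_b: "\<And>i. i < Suc N \<Longrightarrow> \<sigma> (qmap p (unit_coord F (Suc N) i)) = b i"
    and quadric: "quadric b N"
begin

sublocale quadric b N by (rule quadric)

abbreviation "PR \<equiv> mpoly_ring F {..<Suc N}"

lemma form_poly: "form_poly F p \<in> carrier PR" "toM (form_poly F p) = qpoly"
proof -
  note E = embeds_mpoly_ring[of "{..<Suc N}"]
  note D = embedsD[OF E]
  interpret P: cring PR by (rule embeds_cring[OF E])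
  have v: "F.indexed_var i \<in> carrier PR" "F.indexed_const (qmap p (unit_coord F (Suc N) i)) \<in> carrier PR"
    "toM (F.indexed_var i) = mvar i" "toM (F.indexed_const (qmap p (unit_coord F (Suc N) i))) = mconst (b i)"
    if "i < Suc N" for i
    using that indexed_var_eq indexed_const_eq[OF p_closed[OF that]] p_b
    by (auto simp: carrier_mpoly_ring intro!: imageI mpolys_single)
  have eq: "form_poly F p = (\<Oplus>\<^bsub>PR\<^esub>i\<in>{..<Suc N}. F.indexed_const (qmap p (unit_coord F (Suc N) i))
          \<otimes>\<^bsub>PR\<^esub> F.indexed_var i [^]\<^bsub>PR\<^esub> (2::nat))"
    unfolding form_poly_def Let_def dim ..
  show "form_poly F p \<in> carrier PR"
    unfolding eq using v by (intro P.finsum_closed) auto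
  have "toM (form_poly F p) = (\<Sum>i<Suc N. toM (F.indexed_const (qmap p (unit_coord F (Suc N) i))
          \<otimes>\<^bsub>PR\<^esub> F.indexed_var i [^]\<^bsub>PR\<^esub> (2::nat)))"
    unfolding eq using v by (intro embeds_finsum[OF E]) auto
  also have "\<dots> = qpoly"
    unfolding qpoly_def using v
    by (intro sum.cong) (auto simp: D(8) embeds_pow[OF E] power2_eq_square mult_single)
  finally show "toM (form_poly F p) = qpoly" .
qed

lemma PIdl_form_poly: "PIdl\<^bsub>PR\<^esub> (form_poly F p) = {x \<in> carrier PR. Phi (toM x) = 0}"
proof -
  note E = embeds_mpoly_ring[of "{..<Suc N}"]
  note D = embedsD[OF E]
  have "x \<in> PIdl\<^bsub>PR\<^esub> (form_poly F p) \<longleftrightarrow> x \<in> carrier PR \<and> (\<exists>Q\<in>mpolys {..<Suc N}. toM x = qpoly * Q)" for x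
  proof
    assume "x \<in> PIdl\<^bsub>PR\<^esub> (form_poly F p)"
    then obtain y where "y \<in> carrier PR" "x = y \<otimes>\<^bsub>PR\<^esub> form_poly F p" unfolding cgenideal_def by auto
    then show "x \<in> carrier PR \<and> (\<exists>Q\<in>mpolys {..<Suc N}. toM x = qpoly * Q)"
      using form_poly D(6,8) toM_carrier[of "{..<Suc N}"]
      by (auto intro!: bexI[of _ "toM y"] simp: mult.commute)
  next
    assume x: "x \<in> carrier PR \<and> (\<exists>Q\<in>mpolys {..<Suc N}. toM x = qpoly * Q)"
    then obtain Q where Q: "Q \<in> mpolys {..<Suc N}" "toM x = qpoly * Q" by blast
    have "fromM Q \<in> carrier PR" using Q(1) by (simp add: carrier_mpoly_ring)
    moreover from this have "x = fromM Q \<otimes>\<^bsub>PR\<^esub> form_poly F p"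
      using x Q(2) D(6,8,9)[of "fromM Q" "form_poly F p"] D(9)[of x "fromM Q \<otimes>\<^bsub>PR\<^esub> form_poly F p"] form_poly
      by (simp add: mult.commute)
    ultimately show "x \<in> PIdl\<^bsub>PR\<^esub> (form_poly F p)" unfolding cgenideal_def by blast
  qed
  moreover have "Phi (toM x) = 0 \<longleftrightarrow> (\<exists>Q\<in>mpolys {..<Suc N}. toM x = qpoly * Q)" if "x \<in> carrier PR" for x
    by (rule Phi_kernel) (use that toM_carrier in blast)
  ultimately show ?thesis by blast
qed

text \<open>Constants arrive as squares because \<open>Phi\<close> squares coefficients. This fits
  the evaluation of forms: every term \<open>c_i x_i^2\<close> becomes a square as a whole.\<close>

theorem function_field_model:
  obtains \<psi> where "field (function_field F p)" "embeds (function_field F p) \<psi>"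
    "\<psi> ` carrier (function_field F p) = fracs"
    "\<And>c. c \<in> carrier F \<Longrightarrow> function_field_const F p c \<in> carrier (function_field F p)"
    "\<And>c. c \<in> carrier F \<Longrightarrow> \<psi> (function_field_const F p c) = (embc (\<sigma> c))^2"
proof -
  note E = embeds_mpoly_ring[of "{..<Suc N}"]
  note D = embedsD[OF E]
  let ?I = "PIdl\<^bsub>PR\<^esub> (form_poly F p)"
  let ?Q = "quadric_coord_ring F p"
  have Q: "?Q = PR Quot ?I"
    unfolding quadric_coord_ring_def Let_def dim ..
  obtain \<theta> where \<theta>: "embeds ?Q \<theta>" "\<And>x. x \<in> carrier PR \<Longrightarrow> \<theta> (?I +>\<^bsub>PR\<^esub> x) = Phi (toM x)"
    "\<And>x. x \<in> carrier PR \<Longrightarrow> ?I +>\<^bsub>PR\<^esub> x \<in> carrier ?Q"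
    "carrier ?Q = (\<lambda>x. ?I +>\<^bsub>PR\<^esub> x) ` carrier PR"
    using embeds_quotient[OF embeds_cring[OF E], of "\<lambda>x. Phi (toM x)" ?I] PIdl_form_poly D(4,7,8)
    unfolding Q by (auto simp: Phi_simps)
  note D\<theta> = embedsD[OF \<theta>(1)]
  let ?\<psi> = "frac_val \<theta>"
  have "field (function_field F p)" "embeds (function_field F p) ?\<psi>"
    unfolding function_field_def by (rule field_frac_field[OF \<theta>(1)] embeds_frac_field[OF \<theta>(1)])+
  moreover have "?\<psi> ` carrier (function_field F p) = fracs"
  proof -
    have im: "\<theta> ` carrier ?Q = Phi ` mpolys {..<Suc N}"
      unfolding \<theta>(4) image_image using \<theta>(2) by (simp flip: toM_carrier add: image_image cong: image_cong)
    have nz: "\<theta> ` (carrier ?Q - {\<zero>\<^bsub>?Q\<^esub>}) = \<theta> ` carrier ?Q - {0}"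
      using D\<theta>(1,10) by (auto simp: image_iff)
    have "?\<psi> ` carrier (function_field F p) = {Fract a b | a b. a \<in> \<theta> ` carrier ?Q \<and> b \<in> \<theta> ` (carrier ?Q - {\<zero>\<^bsub>?Q\<^esub>})}"
      unfolding function_field_def frac_val_image[OF \<theta>(1)] by blast
    also have "\<dots> = fracs"
      unfolding nz im fracs_def Fract_eq_divide[symmetric] by blast
    finally show ?thesis .
  qed
  moreover have "function_field_const F p c \<in> carrier (function_field F p)"
    "?\<psi> (function_field_const F p c) = (embc (\<sigma> c))^2" if c: "c \<in> carrier F" for c
  proof -
    let ?c = "?I +>\<^bsub>PR\<^esub> F.indexed_const c"
    have eq: "function_field_const F p c = frac_of ?Q ?c \<one>\<^bsub>?Q\<^esub>"
      unfolding function_field_const_def Let_def dim ..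
    have ic: "F.indexed_const c \<in> carrier PR" "toM (F.indexed_const c) = mconst (\<sigma> c)"
      unfolding indexed_const_eq[OF c] carrier_mpoly_ring by (auto intro!: imageI mpolys_single)
    have mem: "?c \<in> carrier ?Q" "\<one>\<^bsub>?Q\<^esub> \<in> carrier ?Q - {\<zero>\<^bsub>?Q\<^esub>}"
      using \<theta>(3)[OF ic(1)] D\<theta>(2-4) by (blast, metis DiffI D\<theta>(3) singletonD zero_neq_one)
    show "function_field_const F p c \<in> carrier (function_field F p)"
      unfolding eq function_field_def frac_carrier[OF \<theta>(1)] using mem by blast
    show "?\<psi> (function_field_const F p c) = (embc (\<sigma> c))^2"
      unfolding eq frac_val_frac_of[OF \<theta>(1) mem] D\<theta>(4) \<theta>(2)[OF ic(1)] ic(2) Phi_simps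
      by (simp add: power2_eq_square mult_single)
  qed
  ultimately show ?thesis using that by blast
qed

end

section \<open>Rank over a subfield\<close>

definition spn :: "'k::comm_ring_1 set \<Rightarrow> ('i \<Rightarrow> 'k) \<Rightarrow> 'i set \<Rightarrow> 'k set" where
  "spn S \<beta> I = {\<Sum>i\<in>I. \<beta> i * w i | w. \<forall>i\<in>I. w i \<in> S}"

text \<open>A basis of the span, chosen among the indices rather than among the elements, so that
  repeated elements cause no trouble.\<close>

definition max_indep :: "'k::comm_ring_1 set \<Rightarrow> ('i \<Rightarrow> 'k) \<Rightarrow> 'i set \<Rightarrow> 'i set \<Rightarrow> bool" where
  "max_indep S \<beta> U B \<longleftrightarrow> B \<subseteq> U \<and> indep S \<beta> B \<and> (\<forall>j\<in>U. \<beta> j \<in> spn S \<beta> B)"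

text \<open>For finite \<open>U\<close> all choices give the same number, see
  \<open>rk_eq\<close>.\<close>

definition rk :: "'k::comm_ring_1 set \<Rightarrow> ('i \<Rightarrow> 'k) \<Rightarrow> 'i set \<Rightarrow> nat" where
  "rk S \<beta> U = card (SOME B. max_indep S \<beta> U B)"

locale subfield_set =
  fixes S :: "'k::field set"
  assumes closed [simp]: "0 \<in> S" "1 \<in> S"
    "x \<in> S \<Longrightarrow> y \<in> S \<Longrightarrow> x - y \<in> S" "x \<in> S \<Longrightarrow> y \<in> S \<Longrightarrow> x * y \<in> S" "x \<in> S \<Longrightarrow> inverse x \<in> S"
begin

lemma closed_uminus [simp]: "x \<in> S \<Longrightarrow> - x \<in> S"
  using closed(3)[of 0 x] by simp

lemma closed_add [simp]: "x \<in> S \<Longrightarrow> y \<in> S \<Longrightarrow> x + y \<in> S"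
  using closed(3)[of x "- y"] by simp

lemma closed_divide [simp]: "x \<in> S \<Longrightarrow> y \<in> S \<Longrightarrow> x / y \<in> S"
  by (simp add: divide_inverse)

lemma closed_sum: "(\<And>i. i \<in> A \<Longrightarrow> f i \<in> S) \<Longrightarrow> sum f A \<in> S"
  by (induction A rule: infinite_finite_induct) auto

lemma spnI: "(\<And>i. i \<in> I \<Longrightarrow> w i \<in> S) \<Longrightarrow> x = (\<Sum>i\<in>I. \<beta> i * w i) \<Longrightarrow> x \<in> spn S \<beta> I"
  unfolding spn_def by auto

lemma spnE:
  assumes "x \<in> spn S \<beta> I"
  obtains w where "\<And>i. i \<in> I \<Longrightarrow> w i \<in> S" "x = (\<Sum>i\<in>I. \<beta> i * w i)"
  using assms unfolding spn_def by auto

lemma spn_0 [simp]: "0 \<in> spn S \<beta> I"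
  by (rule spnI[of _ "\<lambda>_. 0"]) auto

lemma spn_base: "finite I \<Longrightarrow> i \<in> I \<Longrightarrow> \<beta> i \<in> spn S \<beta> I"
  by (rule spnI[of _ "\<lambda>j. if j = i then 1 else 0"]) (auto simp: if_distrib cong: if_cong)

lemma spn_diff: "x \<in> spn S \<beta> I \<Longrightarrow> y \<in> spn S \<beta> I \<Longrightarrow> x - y \<in> spn S \<beta> I"
proof (elim spnE)
  fix v w assume "\<And>i. i \<in> I \<Longrightarrow> v i \<in> S" "\<And>i. i \<in> I \<Longrightarrow> w i \<in> S"
    "x = (\<Sum>i\<in>I. \<beta> i * v i)" "y = (\<Sum>i\<in>I. \<beta> i * w i)"
  then show "x - y \<in> spn S \<beta> I"
    by (intro spnI[of _ "\<lambda>i. v i - w i"]) (auto simp: right_diff_distrib sum_subtractf)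
qed

lemma spn_mult: "x \<in> spn S \<beta> I \<Longrightarrow> c \<in> S \<Longrightarrow> x * c \<in> spn S \<beta> I"
proof (elim spnE)
  fix v assume "\<And>i. i \<in> I \<Longrightarrow> v i \<in> S" "x = (\<Sum>i\<in>I. \<beta> i * v i)" "c \<in> S"
  then show "x * c \<in> spn S \<beta> I"
    by (intro spnI[of _ "\<lambda>i. v i * c"]) (auto simp: sum_distrib_right mult.assoc)
qed

lemma spn_add: "x \<in> spn S \<beta> I \<Longrightarrow> y \<in> spn S \<beta> I \<Longrightarrow> x + y \<in> spn S \<beta> I"
  using spn_diff[of x \<beta> I "0 - y"] spn_diff[of 0 \<beta> I y] by simp

lemma spn_sum: "(\<And>j. j \<in> A \<Longrightarrow> f j \<in> spn S \<beta> I) \<Longrightarrow> sum f A \<in> spn S \<beta> I"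
  by (induction A rule: infinite_finite_induct) (auto intro: spn_add)

lemma spn_subset: "(\<And>j. j \<in> J \<Longrightarrow> \<gamma> j \<in> spn S \<beta> I) \<Longrightarrow> spn S \<gamma> J \<subseteq> spn S \<beta> I"
  by (auto elim!: spnE intro!: spn_sum spn_mult)

lemma spn_mono: "finite J \<Longrightarrow> I \<subseteq> J \<Longrightarrow> spn S \<beta> I \<subseteq> spn S \<beta> J"
  by (rule spn_subset) (auto intro: spn_base)

lemma indep_subset: "finite J \<Longrightarrow> indep S \<beta> J \<Longrightarrow> I \<subseteq> J \<Longrightarrow> indep S \<beta> I"
  unfolding indep_def
proof (intro allI impI)
  fix w assume J: "finite J" "I \<subseteq> J"
    and ind: "\<forall>w. (\<forall>i\<in>J. w i \<in> S) \<longrightarrow> (\<Sum>i\<in>J. \<beta> i * w i) = 0 \<longrightarrow> (\<forall>i\<in>J. w i = 0)"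
    and w: "\<forall>i\<in>I. w i \<in> S" "(\<Sum>i\<in>I. \<beta> i * w i) = 0"
  let ?w = "\<lambda>i. if i \<in> I then w i else 0"
  have "(\<Sum>i\<in>J. \<beta> i * ?w i) = (\<Sum>i\<in>I. \<beta> i * w i)"
    using J by (intro sum.mono_neutral_cong_right) auto
  then have "\<forall>i\<in>J. ?w i = 0" using w(1) w(2) by (intro ind[THEN spec[of _ ?w], THEN mp, THEN mp]) auto
  then show "\<forall>i\<in>I. w i = 0" using J(2) by (metis subsetD)
qed

lemma indep_insert:
  assumes "finite B" "indep S \<beta> B" "\<beta> j \<notin> spn S \<beta> B"
  shows "indep S \<beta> (insert j B)"
proof (cases "j \<in> B")
  case False
  show ?thesis unfolding indep_def
  proof (intro allI impI)
    fix w assume w: "\<forall>i\<in>insert j B. w i \<in> S" "(\<Sum>i\<in>insert j B. \<beta> i * w i) = 0"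
    then have eq: "\<beta> j * w j + (\<Sum>i\<in>B. \<beta> i * w i) = 0" using assms(1) False by simp
    have "w j = 0"
    proof (rule ccontr)
      assume nz: "w j \<noteq> 0"
      have "\<beta> j * w j = - (\<Sum>i\<in>B. \<beta> i * w i)" using eq by (simp add: eq_neg_iff_add_eq_0)
      then have "\<beta> j = - (\<Sum>i\<in>B. \<beta> i * w i) / w j" using nz by (metis nonzero_mult_div_cancel_right)
      also have "\<dots> = (\<Sum>i\<in>B. \<beta> i * (- (w i / w j)))"
        by (simp add: sum_divide_distrib sum_negf)
      finally have "\<beta> j \<in> spn S \<beta> B" using w by (intro spnI[of _ "\<lambda>i. - (w i / w j)"]) auto
      then show False using assms by blast
    qed
    then show "\<forall>i\<in>insert j B. w i = 0" using eq w(1) assms(2) unfolding indep_def by auto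
  qed
qed (use assms in \<open>simp add: insert_absorb\<close>)

lemma max_indep_extend:
  assumes "finite U" "I \<subseteq> U" "indep S \<beta> I"
  obtains B where "I \<subseteq> B" "max_indep S \<beta> U B"
proof -
  let ?P = "\<lambda>B. I \<subseteq> B \<and> B \<subseteq> U \<and> indep S \<beta> B"
  have "?P I" using assms by auto
  moreover have "\<forall>B. ?P B \<longrightarrow> card B < Suc (card U)"
    using assms(1) by (auto intro: le_imp_less_Suc card_mono)
  ultimately obtain B where B: "?P B" "\<And>B'. ?P B' \<Longrightarrow> card B' \<le> card B"
    using ex_has_greatest_nat[of ?P I card "Suc (card U)"] by blast
  have fin: "finite B" using B(1) assms(1) finite_subset by blast
  have "\<beta> j \<in> spn S \<beta> B" if j: "j \<in> U" for j
  proof (rule ccontr)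
    assume nj: "\<beta> j \<notin> spn S \<beta> B"
    then have "j \<notin> B" using spn_base[OF fin] by blast
    moreover have "?P (insert j B)" using B(1) j indep_insert[OF fin _ nj] by blast
    ultimately show False using B(2)[of "insert j B"] fin by simp
  qed
  then show ?thesis using that B(1) unfolding max_indep_def by blast
qed

text \<open>Induction on the spanning set. If some \<open>\<gamma> k\<close> involves
  \<open>\<beta> b\<close>, it serves as pivot: subtracting multiples of it removes
  \<open>\<beta> b\<close> from the other vectors, and one vector is lost for one generator.\<close>

lemma steinitz:
  assumes "finite B" "finite J" "indep S \<gamma> J" "\<And>j. j \<in> J \<Longrightarrow> \<gamma> j \<in> spn S \<beta> B"
  shows "card J \<le> card B"
  using assms
proof (induction B arbitrary: J \<gamma>)
  case empty
  have "J = {}"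
  proof (rule ccontr)
    assume "J \<noteq> {}"
    then obtain j where j: "j \<in> J" by blast
    have "\<forall>i\<in>J. \<gamma> i = 0" using empty(3) by (auto simp: spn_def)
    then have "(\<Sum>i\<in>J. \<gamma> i * 1) = 0" by simp
    then have "\<forall>i\<in>J. (1::'k) = 0"
      using empty(2)[unfolded indep_def, THEN spec[of _ "\<lambda>_. 1"]] by simp
    then show False using j by simp
  qed
  then show ?case by simp
next
  case (insert b B)
  have "\<exists>c r. c \<in> S \<and> r \<in> spn S \<beta> B \<and> \<gamma> j = \<beta> b * c + r" if "j \<in> J" for j
  proof -
    obtain w where "\<And>i. i \<in> insert b B \<Longrightarrow> w i \<in> S" "\<gamma> j = (\<Sum>i\<in>insert b B. \<beta> i * w i)"
      using insert.prems(3) \<open>j \<in> J\<close> by (metis spnE)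
    then show ?thesis using insert.hyps
      by (intro exI[of _ "w b"] exI[of _ "\<Sum>i\<in>B. \<beta> i * w i"]) (auto intro: spnI)
  qed
  then obtain c r where cr: "\<And>j. j \<in> J \<Longrightarrow> c j \<in> S" "\<And>j. j \<in> J \<Longrightarrow> r j \<in> spn S \<beta> B"
    "\<And>j. j \<in> J \<Longrightarrow> \<gamma> j = \<beta> b * c j + r j"
    by metis
  show ?case
  proof (cases "\<forall>j\<in>J. c j = 0")
    case True
    then have "card J \<le> card B" using cr insert.prems by (intro insert.IH) auto
    then show ?thesis using insert.hyps by simp
  next
    case False
    then obtain k where k: "k \<in> J" "c k \<noteq> 0" by blast
    \<comment> \<open>The multiple of the pivot is chosen so that the components along
      \<open>\<beta> b\<close> cancel.\<close>
    define \<delta> where "\<delta> j = \<gamma> j - \<gamma> k * (c j / c k)" for j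
    have "card (J - {k}) \<le> card B"
    proof (rule insert.IH)
      show "\<delta> j \<in> spn S \<beta> B" if j: "j \<in> J - {k}" for j
      proof -
        have "\<delta> j = r j - r k * (c j / c k)"
          unfolding \<delta>_def using cr(3)[of j] cr(3)[of k] j k by (simp add: field_simps)
        moreover have "r j - r k * (c j / c k) \<in> spn S \<beta> B"
          using cr j k by (intro spn_diff spn_mult closed_divide) auto
        ultimately show ?thesis by simp
      qed
      show "indep S \<delta> (J - {k})" unfolding indep_def
      proof (intro allI impI)
        fix w assume w: "\<forall>i\<in>J - {k}. w i \<in> S" "(\<Sum>i\<in>J - {k}. \<delta> i * w i) = 0"
        \<comment> \<open>A relation between the \<open>\<delta> i\<close> turns into one between
          the \<open>\<gamma> i\<close>; the entry at \<open>k\<close> collects the subtracted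
          multiples of the pivot.\<close>
        define v where "v i = (if i = k then - (\<Sum>j\<in>J - {k}. c j / c k * w j) else w i)" for i
        have "(\<Sum>i\<in>J. \<gamma> i * v i) = \<gamma> k * v k + (\<Sum>i\<in>J - {k}. \<gamma> i * v i)"
          using insert.prems(1) k(1) by (rule sum.remove)
        also have "(\<Sum>i\<in>J - {k}. \<gamma> i * v i) = (\<Sum>i\<in>J - {k}. \<gamma> i * w i)"
          by (rule sum.cong) (auto simp: v_def)
        also have "\<gamma> k * v k = - (\<Sum>i\<in>J - {k}. \<gamma> k * (c i / c k) * w i)"
          by (simp add: v_def sum_distrib_left mult.assoc)
        also have "- (\<Sum>i\<in>J - {k}. \<gamma> k * (c i / c k) * w i) + (\<Sum>i\<in>J - {k}. \<gamma> i * w i) = (\<Sum>i\<in>J - {k}. \<delta> i * w i)"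
          unfolding \<delta>_def by (simp add: left_diff_distrib sum_subtractf)
        finally have "(\<Sum>i\<in>J. \<gamma> i * v i) = 0" using w(2) by simp
        moreover have "\<forall>i\<in>J. v i \<in> S"
        proof
          fix i assume i: "i \<in> J"
          have "(\<Sum>j\<in>J - {k}. c j / c k * w j) \<in> S"
            using w(1) cr(1) k(1) by (intro closed_sum closed(4) closed_divide) auto
          then show "v i \<in> S" using w(1) i by (auto simp: v_def)
        qed
        ultimately have "\<forall>i\<in>J. v i = 0" using insert.prems(2) unfolding indep_def by blast
        then have "v i = 0" if "i \<in> J - {k}" for i using that by blast
        then show "\<forall>i\<in>J - {k}. w i = 0" unfolding v_def by (metis Diff_iff singleton_iff)
      qed
    qed (use insert.prems in auto)
    moreover have "card J = Suc (card (J - {k}))"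
      by (rule card_Suc_Diff1[OF insert.prems(1) k(1), symmetric])
    ultimately show ?thesis using insert.hyps by simp
  qed
qed

lemma max_indep_some:
  assumes "finite U"
  shows "max_indep S \<beta> U (SOME B. max_indep S \<beta> U B)"
proof -
  have "indep S \<beta> {}" by (simp add: indep_def)
  then obtain B where "max_indep S \<beta> U B" using max_indep_extend[OF assms, of "{}"] by blast
  then show ?thesis by (rule someI)
qed

lemma rk_ge:
  assumes "finite U" "finite J" "indep S \<gamma> J" "\<And>j. j \<in> J \<Longrightarrow> \<gamma> j \<in> spn S \<beta> U"
  shows "card J \<le> rk S \<beta> U"
proof -
  let ?B = "SOME B. max_indep S \<beta> U B"
  have B: "?B \<subseteq> U" "\<And>j. j \<in> U \<Longrightarrow> \<beta> j \<in> spn S \<beta> ?B"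
    using max_indep_some[OF assms(1), of \<beta>] unfolding max_indep_def by auto
  have "spn S \<beta> U \<subseteq> spn S \<beta> ?B" by (rule spn_subset) (rule B)
  then show ?thesis unfolding rk_def
    using assms(2-4) finite_subset[OF B(1) assms(1)] by (intro steinitz) auto
qed

lemma rk_le:
  assumes "finite U" "finite B" "\<And>j. j \<in> U \<Longrightarrow> \<beta> j \<in> spn S \<gamma> B"
  shows "rk S \<beta> U \<le> card B"
proof -
  let ?B = "SOME B. max_indep S \<beta> U B"
  have B: "?B \<subseteq> U" "indep S \<beta> ?B"
    using max_indep_some[OF assms(1), of \<beta>] unfolding max_indep_def by auto
  then show ?thesis unfolding rk_def
    using assms finite_subset[OF B(1) assms(1)] by (intro steinitz) auto
qed

lemma rk_eq:
  assumes "finite U" "max_indep S \<beta> U B"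
  shows "rk S \<beta> U = card B"
proof -
  have B: "finite B" "B \<subseteq> U" "indep S \<beta> B" "\<And>j. j \<in> U \<Longrightarrow> \<beta> j \<in> spn S \<beta> B"
    using assms finite_subset unfolding max_indep_def by auto
  show ?thesis
  proof (rule antisym)
    show "rk S \<beta> U \<le> card B" by (rule rk_le) (use B assms in auto)
    show "card B \<le> rk S \<beta> U"
      by (rule rk_ge) (use B assms spn_base[OF assms(1), of _ \<beta>] in auto)
  qed
qed

lemma rk_le_rk:
  assumes "finite U" "finite V" "\<And>j. j \<in> U \<Longrightarrow> \<beta> j \<in> spn S \<gamma> V"
  shows "rk S \<beta> U \<le> rk S \<gamma> V"
proof -
  let ?B = "SOME B. max_indep S \<gamma> V B"
  have B: "?B \<subseteq> V" "\<And>j. j \<in> V \<Longrightarrow> \<gamma> j \<in> spn S \<gamma> ?B"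
    using max_indep_some[OF assms(2), of \<gamma>] unfolding max_indep_def by auto
  have "spn S \<gamma> V \<subseteq> spn S \<gamma> ?B" by (rule spn_subset) (rule B)
  then show ?thesis unfolding rk_def[of S \<gamma>]
    using assms finite_subset[OF B(1) assms(2)] by (intro rk_le) auto
qed

lemma rk_mono: "finite V \<Longrightarrow> U \<subseteq> V \<Longrightarrow> rk S \<beta> U \<le> rk S \<beta> V"
  by (rule rk_le_rk[where \<gamma> = \<beta>]) (auto intro: finite_subset spn_base)

lemma rk_insert: "finite U \<Longrightarrow> rk S \<beta> (insert a U) \<le> rk S \<beta> U + 1"
proof -
  assume U: "finite U"
  let ?B = "SOME B. max_indep S \<beta> U B"
  have B: "?B \<subseteq> U" "\<And>j. j \<in> U \<Longrightarrow> \<beta> j \<in> spn S \<beta> ?B"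
    using max_indep_some[OF U, of \<beta>] unfolding max_indep_def by auto
  have fin: "finite ?B" using B(1) U finite_subset by blast
  have "rk S \<beta> (insert a U) \<le> card (insert a ?B)"
  proof (rule rk_le)
    fix j assume "j \<in> insert a U"
    then show "\<beta> j \<in> spn S \<beta> (insert a ?B)"
      using B(2) spn_mono[of "insert a ?B" ?B \<beta>] spn_base[of "insert a ?B" a \<beta>] fin by blast
  qed (use U fin in auto)
  also have "\<dots> \<le> card ?B + 1" using fin by (simp add: card_insert_if)
  finally show ?thesis unfolding rk_def[of S \<beta> U] .
qed

lemma rk_indep: "finite U \<Longrightarrow> indep S \<beta> U \<Longrightarrow> rk S \<beta> U = card U"
  by (rule rk_eq) (auto simp: max_indep_def spn_base)

lemma rk_le_card: "finite U \<Longrightarrow> rk S \<beta> U \<le> card U"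
  by (rule rk_le[where \<gamma> = \<beta>]) (auto simp: spn_base)

lemma indep_rk:
  assumes "finite U" "rk S \<beta> U = card U"
  shows "indep S \<beta> U"
proof -
  let ?B = "SOME B. max_indep S \<beta> U B"
  have B: "?B \<subseteq> U" "indep S \<beta> ?B"
    using max_indep_some[OF assms(1), of \<beta>] unfolding max_indep_def by auto
  have "?B = U" using assms B(1) unfolding rk_def by (intro card_subset_eq) auto
  then show ?thesis using B(2) by simp
qed

text \<open>Swapping one index at a time changes the rank by at most one.\<close>

lemma rk_intermediate:
  assumes "finite T0" "finite T1" "card T0 = card T1" "rk S \<beta> T0 \<le> r" "r \<le> rk S \<beta> T1"
  shows "\<exists>T\<subseteq>T0 \<union> T1. card T = card T1 \<and> rk S \<beta> T = r"
  using assms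
proof (induction "card (T1 - T0)" arbitrary: T0)
  case 0
  then have "T1 \<subseteq> T0" by simp
  then have "T1 = T0" using 0 by (intro card_subset_eq) auto
  then show ?case using 0 by (intro exI[of _ T0]) auto
next
  case (Suc n)
  show ?case
  proof (cases "rk S \<beta> T0 = r")
    case True
    then show ?thesis using Suc by (intro exI[of _ T0]) auto
  next
    case False
    obtain x where x: "x \<in> T1 - T0" using Suc(2) by (metis card_eq_0_iff equals0I nat.distinct(1))
    have "card (T0 - T1) = card (T1 - T0)"
      using Suc.prems by (simp add: card_Diff_subset_Int Int_commute)
    then obtain y where y: "y \<in> T0 - T1" using Suc(2) by (metis card_eq_0_iff equals0I nat.distinct(1))
    let ?T = "insert x (T0 - {y})"
    have "rk S \<beta> ?T \<le> rk S \<beta> (T0 - {y}) + 1" using Suc.prems by (intro rk_insert) auto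
    also have "rk S \<beta> (T0 - {y}) \<le> rk S \<beta> T0" using Suc.prems by (intro rk_mono) auto
    \<comment> \<open>The rank is still strictly below \<open>r\<close>, so a swap that raises it by
      at most one cannot jump past \<open>r\<close>.\<close>
    finally have r: "rk S \<beta> ?T \<le> r" using False Suc.prems by simp
    have "T1 - ?T = (T1 - T0) - {x}" using x y by auto
    then have "n = card (T1 - ?T)" using Suc(2) x Suc.prems by simp
    moreover have "card ?T = card T1"
    proof -
      have "card T0 > 0" using y Suc.prems(1) by (auto simp: card_gt_0_iff)
      moreover have "card ?T = Suc (card T0 - 1)" using x y Suc.prems(1) by simp
      ultimately show ?thesis using Suc.prems(3) by simp
    qed
    ultimately obtain T where "T \<subseteq> ?T \<union> T1" "card T = card T1" "rk S \<beta> T = r"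
      using Suc(1)[of ?T] r Suc.prems by auto
    then show ?thesis using x by (intro exI[of _ T]) auto
  qed
qed

end

section \<open>Isotropy index and rank\<close>

lemma coord_space_simps:
  assumes "field L"
  shows "carrier (coord_space L n) = {..<n} \<rightarrow>\<^sub>E carrier L"
    "\<zero>\<^bsub>coord_space L n\<^esub> = (\<lambda>i\<in>{..<n}. \<zero>\<^bsub>L\<^esub>)"
    "v \<oplus>\<^bsub>coord_space L n\<^esub> w = (\<lambda>i\<in>{..<n}. v i \<oplus>\<^bsub>L\<^esub> w i)"
    "c \<odot>\<^bsub>coord_space L n\<^esub> v = (\<lambda>i\<in>{..<n}. c \<otimes>\<^bsub>L\<^esub> v i)"
proof -
  interpret field L by fact
  show "carrier (coord_space L n) = {..<n} \<rightarrow>\<^sub>E carrier L"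
    "\<zero>\<^bsub>coord_space L n\<^esub> = (\<lambda>i\<in>{..<n}. \<zero>\<^bsub>L\<^esub>)"
    "v \<oplus>\<^bsub>coord_space L n\<^esub> w = (\<lambda>i\<in>{..<n}. v i \<oplus>\<^bsub>L\<^esub> w i)"
    "c \<odot>\<^bsub>coord_space L n\<^esub> v = (\<lambda>i\<in>{..<n}. c \<otimes>\<^bsub>L\<^esub> v i)"
    by (simp_all add: coord_space_def func_space_def)
qed

lemma vectorspace_coord_space:
  assumes "field L"
  shows "vectorspace L (coord_space L n)"
proof -
  interpret field L by fact
  interpret m: Module.module L "coord_space L n" unfolding coord_space_def by (rule func_space_is_module)
  show ?thesis ..
qed

locale embedded_field =
  fixes L :: "('l, 'm) ring_scheme" and \<psi> :: "'l \<Rightarrow> 'k::{field,ring_char2}"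
  assumes L_field: "field L" and \<psi>_embeds: "embeds L \<psi>"
begin

sublocale L: field L by (rule L_field)

lemmas \<psi> = embedsD[OF \<psi>_embeds]

abbreviation "im \<equiv> \<psi> ` carrier L"

sublocale im: subfield_set im
proof
    show "0 \<in> im" "1 \<in> im" using \<psi>(1-4) by (metis imageI)+
    fix x y assume "x \<in> im" "y \<in> im"
    then obtain a b where ab: "a \<in> carrier L" "b \<in> carrier L" "x = \<psi> a" "y = \<psi> b" by auto
    then show "x * y \<in> im" using \<psi>(6,8) by (metis imageI)
    show "x - y \<in> im" unfolding minus_char2 using ab \<psi>(5,7) by (metis imageI)
  next
    fix x assume "x \<in> im"
    then obtain a where a: "a \<in> carrier L" "x = \<psi> a" by auto
    show "inverse x \<in> im"
    proof (cases "a = \<zero>\<^bsub>L\<^esub>")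
      case True
      then show ?thesis using a \<psi>(1,3) by (metis imageI inverse_zero)
    next
      case False
      then have u: "a \<in> Units L" using a L.field_Units by auto
      then have "\<psi> a * \<psi> (inv\<^bsub>L\<^esub> a) = 1"
        using \<psi>(8)[of a "inv\<^bsub>L\<^esub> a"] \<psi>(4) a L.Units_r_inv[OF u] L.Units_inv_closed[OF u] by simp
      then have "inverse x = \<psi> (inv\<^bsub>L\<^esub> a)" using a(2) by (simp add: inverse_unique)
      then show ?thesis using L.Units_inv_closed[OF u] by simp
    qed
qed

definition nullspace :: "(nat \<Rightarrow> 'k) \<Rightarrow> nat \<Rightarrow> (nat \<Rightarrow> 'l) set" where
  "nullspace \<beta> n = {v \<in> carrier (coord_space L n). (\<Sum>i<n. \<beta> i * \<psi> (v i)) = 0}"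

lemma vectorspace_nullspace: "vectorspace L (coord_space L n\<lparr>carrier := nullspace \<beta> n\<rparr>)"
proof -
  interpret V: vectorspace L "coord_space L n" by (rule vectorspace_coord_space[OF L_field])
  note simps = coord_space_simps[OF L_field]
  have "submodule L (nullspace \<beta> n) (coord_space L n)"
  proof
    show "nullspace \<beta> n \<subseteq> carrier (coord_space L n)" by (auto simp: nullspace_def)
    show "\<zero>\<^bsub>coord_space L n\<^esub> \<in> nullspace \<beta> n"
      by (auto simp: nullspace_def simps \<psi>(3))
    fix v w assume v: "v \<in> nullspace \<beta> n"
    then have vc: "v i \<in> carrier L" if "i < n" for i using that by (auto simp: nullspace_def simps)
    { assume w: "w \<in> nullspace \<beta> n"
      then have wc: "w i \<in> carrier L" if "i < n" for i using that by (auto simp: nullspace_def simps)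
      have "(\<Sum>i<n. \<beta> i * \<psi> ((v \<oplus>\<^bsub>coord_space L n\<^esub> w) i)) = (\<Sum>i<n. \<beta> i * \<psi> (v i)) + (\<Sum>i<n. \<beta> i * \<psi> (w i))"
        unfolding sum.distrib[symmetric]
        by (rule sum.cong) (auto simp: simps \<psi>(7) vc wc distrib_left)
      then show "v \<oplus>\<^bsub>coord_space L n\<^esub> w \<in> nullspace \<beta> n"
        using v w by (auto simp: nullspace_def simps vc wc) }
    fix c assume c: "c \<in> carrier L"
    have "(\<Sum>i<n. \<beta> i * \<psi> ((c \<odot>\<^bsub>coord_space L n\<^esub> v) i)) = \<psi> c * (\<Sum>i<n. \<beta> i * \<psi> (v i))"
      unfolding sum_distrib_left by (rule sum.cong) (auto simp: simps \<psi>(8) vc c mult.left_commute)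
    then show "c \<odot>\<^bsub>coord_space L n\<^esub> v \<in> nullspace \<beta> n"
      using v c by (auto simp: nullspace_def simps vc)
  qed
  then have "VectorSpace.subspace L (nullspace \<beta> n) (coord_space L n)"
    using V.vectorspace_axioms by (simp add: VectorSpace.subspace_def)
  then show ?thesis by (rule V.subspace_is_vs)
qed

text \<open>Let \<open>B\<close> be a maximal independent set of indices. Each index
  \<open>j\<close> outside \<open>B\<close> gives a relation with entry 1 at \<open>j\<close> and 0
  at the other indices outside \<open>B\<close>. These relations form a basis, because independence
  of \<open>B\<close> makes a null vector depend on its entries outside \<open>B\<close>
  only.\<close>

lemma dim_nullspace:
  "vectorspace.dim L (coord_space L n\<lparr>carrier := nullspace \<beta> n\<rparr>) = n - rk im \<beta> {..<n}"
proof -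
  let ?N = "coord_space L n\<lparr>carrier := nullspace \<beta> n\<rparr>"
  interpret N: vectorspace L ?N by (rule vectorspace_nullspace)
  note simps = coord_space_simps[OF L_field]
  have car: "v i \<in> carrier L" if "v \<in> nullspace \<beta> n" "i < n" for v i
    using that by (auto simp: nullspace_def simps)
  obtain B where mB: "max_indep im \<beta> {..<n} B" using im.max_indep_some[of "{..<n}" \<beta>] by blast
  have B: "finite B" "B \<subseteq> {..<n}" "indep im \<beta> B" "\<And>j. j < n \<Longrightarrow> \<beta> j \<in> spn im \<beta> B"
    using mB finite_subset unfolding max_indep_def by auto
  define J where "J = {..<n} - B"
  have J: "finite J" "J \<subseteq> {..<n}" "J \<inter> B = {}" "B \<union> J = {..<n}" using B(2) by (auto simp: J_def)
  have split: "(\<Sum>i<n. f i) = (\<Sum>i\<in>B. f i) + (\<Sum>i\<in>J. f i)" for f :: "nat \<Rightarrow> 'k"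
    unfolding J(4)[symmetric] using B(1) J by (intro sum.union_disjoint) auto
  have "\<exists>c. (\<forall>i\<in>B. c i \<in> carrier L) \<and> \<beta> j = (\<Sum>i\<in>B. \<beta> i * \<psi> (c i))" if j: "j < n" for j
  proof -
    obtain w where w: "\<And>i. i \<in> B \<Longrightarrow> w i \<in> im" "\<beta> j = (\<Sum>i\<in>B. \<beta> i * w i)"
      using im.spnE[OF B(4)[OF j]] by blast
    have "\<forall>i\<in>B. \<exists>c. c \<in> carrier L \<and> w i = \<psi> c" using w(1) by blast
    then obtain c where "\<forall>i\<in>B. c i \<in> carrier L \<and> w i = \<psi> (c i)" by metis
    then show ?thesis using w(2) by (intro exI[of _ c]) auto
  qed
  then obtain c where c: "\<And>j i. j < n \<Longrightarrow> i \<in> B \<Longrightarrow> c j i \<in> carrier L"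
    "\<And>j. j < n \<Longrightarrow> \<beta> j = (\<Sum>i\<in>B. \<beta> i * \<psi> (c j i))"
    by metis
  define k where "k j = (\<lambda>i\<in>{..<n}. if i \<in> B then c j i else if i = j then \<one>\<^bsub>L\<^esub> else \<zero>\<^bsub>L\<^esub>)" for j
  have kJ: "k j i = (if i = j then \<one>\<^bsub>L\<^esub> else \<zero>\<^bsub>L\<^esub>)" if "i \<in> J" for i j
    using that J by (auto simp: k_def)
  have k: "k j \<in> nullspace \<beta> n" if j: "j \<in> J" for j
  proof -
    have jn: "j < n" using j J(2) by auto
    have "(\<Sum>i<n. \<beta> i * \<psi> (k j i)) = (\<Sum>i\<in>B. \<beta> i * \<psi> (c j i)) + (\<Sum>i\<in>J. if i = j then \<beta> j else 0)"
      unfolding split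
      by (intro arg_cong2[of _ _ _ _ "(+)"] sum.cong) (use B(2) kJ in \<open>auto simp: k_def \<psi>(3,4)\<close>)
    also have "\<dots> = 0" using c(2)[OF jn] j J(1) by simp
    finally show ?thesis using c(1)[OF jn] by (auto simp: nullspace_def simps k_def)
  qed
  have inj: "inj_on k J"
    by (rule inj_onI) (metis kJ L.one_not_zero)
  have eqI: "u = v" if u: "u \<in> nullspace \<beta> n" and v: "v \<in> nullspace \<beta> n" and uv: "\<And>i. i \<in> J \<Longrightarrow> u i = v i" for u v
  proof (rule PiE_ext)
    show "u \<in> {..<n} \<rightarrow>\<^sub>E carrier L" "v \<in> {..<n} \<rightarrow>\<^sub>E carrier L" using u v by (auto simp: nullspace_def simps)
    have "(\<Sum>i<n. \<beta> i * \<psi> (u i)) + (\<Sum>i<n. \<beta> i * \<psi> (v i)) = 0" using u v by (simp add: nullspace_def)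
    then have "(\<Sum>i\<in>B. \<beta> i * (\<psi> (u i) + \<psi> (v i))) + (\<Sum>i\<in>J. \<beta> i * (\<psi> (u i) + \<psi> (v i))) = 0"
      by (simp add: split distrib_left sum.distrib add.assoc add.left_commute)
    moreover have "(\<Sum>i\<in>J. \<beta> i * (\<psi> (u i) + \<psi> (v i))) = 0" using uv by (intro sum.neutral) simp
    ultimately have "(\<Sum>i\<in>B. \<beta> i * (\<psi> (u i) + \<psi> (v i))) = 0" by simp
    moreover have "\<forall>i\<in>B. \<psi> (u i) + \<psi> (v i) \<in> im"
    proof
      fix i assume "i \<in> B"
      then have "i < n" using B(2) by auto
      then show "\<psi> (u i) + \<psi> (v i) \<in> im"
        by (intro im.closed_add imageI car[OF u] car[OF v])
    qed
    ultimately have "\<forall>i\<in>B. \<psi> (u i) + \<psi> (v i) = 0"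
      by (intro B(3)[unfolded indep_def, THEN spec, THEN mp, THEN mp])
    then have "\<forall>i\<in>B. u i = v i"
      using car[OF u] car[OF v] B(2) \<psi>(9) unfolding add_eq_0_char2 by blast
    then show "u i = v i" if "i \<in> {..<n}" for i using uv that J(4) by blast
  qed
  have coord: "\<psi> (N.lincomb a A i) = (\<Sum>v\<in>A. \<psi> (a v) * \<psi> (v i))"
    if "finite A" "A \<subseteq> nullspace \<beta> n" "a \<in> A \<rightarrow> carrier L" "i < n" for a A i
    using that
  proof (induction A)
    case empty
    have "N.lincomb a {} = (\<lambda>i\<in>{..<n}. \<zero>\<^bsub>L\<^esub>)"
      unfolding N.lincomb_def N.finsum_empty by (simp add: simps)
    then show ?case using empty by (simp add: \<psi>(3))
  next
    case (insert v A)
    have cl: "N.lincomb a A \<in> nullspace \<beta> n"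
      using insert N.lincomb_closed[of A a] by auto
    have sm: "c \<odot>\<^bsub>coord_space L n\<^esub> x \<in> nullspace \<beta> n" if "c \<in> carrier L" "x \<in> nullspace \<beta> n" for c x
      using N.smult_closed[of c x] that by simp
    have "N.lincomb a (insert v A) = a v \<odot>\<^bsub>?N\<^esub> v \<oplus>\<^bsub>?N\<^esub> N.lincomb a A"
      unfolding N.lincomb_def using insert by (intro N.finsum_insert) (auto intro!: sm)
    then have "N.lincomb a (insert v A) i = a v \<otimes>\<^bsub>L\<^esub> v i \<oplus>\<^bsub>L\<^esub> N.lincomb a A i"
      using insert.prems by (simp add: simps)
    then show ?case using insert car[OF cl] car[of v] by (simp add: \<psi>)
  qed
  have coordJ: "\<psi> (N.lincomb a (k ` J) j) = \<psi> (a (k j))" if "a \<in> k ` J \<rightarrow> carrier L" "j \<in> J" for a j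
  proof -
    have "\<psi> (N.lincomb a (k ` J) j) = (\<Sum>i\<in>J. \<psi> (a (k i)) * \<psi> (k i j))"
      using that k J coord[of "k ` J" a j] by (auto simp: sum.reindex[OF inj])
    also have "\<dots> = (\<Sum>i\<in>J. if i = j then \<psi> (a (k j)) else 0)"
      by (rule sum.cong) (auto simp: kJ that \<psi>(3,4))
    finally show ?thesis using that J by simp
  qed
  have sub: "k ` J \<subseteq> carrier ?N" using k by auto
  have "N.basis (k ` J)" unfolding N.basis_def
  proof (intro conjI)
    show "N.lin_indpt (k ` J)"
    proof (rule N.finite_lin_indpt2)
      fix a assume a: "a \<in> k ` J \<rightarrow> carrier L" "N.lincomb a (k ` J) = \<zero>\<^bsub>?N\<^esub>"
      have "\<psi> (a (k j)) = 0" if "j \<in> J" for j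
        using coordJ[OF a(1) that] a(2) that J(2) by (auto simp: simps \<psi>(3))
      then show "\<forall>v\<in>k ` J. a v = \<zero>\<^bsub>L\<^esub>" using a(1) \<psi>(10) by blast
    qed (use J sub in auto)
    show "N.gen_set (k ` J)"
    proof
      show "N.span (k ` J) \<subseteq> carrier ?N" by (rule N.span_is_subset2[OF sub])
      show "carrier ?N \<subseteq> N.span (k ` J)"
      proof
        fix u assume "u \<in> carrier ?N"
        then have u: "u \<in> nullspace \<beta> n" by simp
        define a where "a v = u (inv_into J k v)" for v
        have ak: "a (k j) = u j" if "j \<in> J" for j using that inj by (simp add: a_def)
        have a: "a \<in> k ` J \<rightarrow> carrier L" using ak car[OF u] J(2) by auto
        have cl: "N.lincomb a (k ` J) \<in> nullspace \<beta> n"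
          using N.lincomb_closed[OF sub a] by simp
        have "u = N.lincomb a (k ` J)"
        proof (rule eqI[OF u cl])
          fix i assume i: "i \<in> J"
          then have "i < n" using J(2) by auto
          then show "u i = N.lincomb a (k ` J) i"
            using coordJ[OF a i] ak[OF i] car[OF u] car[OF cl] \<psi>(9) by metis
        qed
        then show "u \<in> N.span (k ` J)" unfolding N.span_def using a J(1) by blast
      qed
    qed
  qed (rule sub)
  then have "N.dim = card (k ` J)" using J(1) by (intro N.dim_basis) auto
  also have "\<dots> = card J" by (rule card_image[OF inj])
  also have "\<dots> = n - card B" unfolding J_def using B by (simp add: card_Diff_subset)
  finally show ?thesis using im.rk_eq[OF _ mB] by simp
qed

end

section \<open>Quasilinear forms and their coefficients\<close>

context field_model
begin

definition cf :: "'u qform \<Rightarrow> nat \<Rightarrow> 'a" where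
  "cf \<phi> i = \<sigma> (qmap \<phi> (unit_coord F (qdim \<phi>) i))"

lemma qspace_simps:
  "carrier (qspace F \<phi>) = {..<qdim \<phi>} \<rightarrow>\<^sub>E carrier F"
  "\<zero>\<^bsub>qspace F \<phi>\<^esub> = (\<lambda>i\<in>{..<qdim \<phi>}. \<zero>\<^bsub>F\<^esub>)"
  "v \<oplus>\<^bsub>qspace F \<phi>\<^esub> w = (\<lambda>i\<in>{..<qdim \<phi>}. v i \<oplus>\<^bsub>F\<^esub> w i)"
  "c \<odot>\<^bsub>qspace F \<phi>\<^esub> v = (\<lambda>i\<in>{..<qdim \<phi>}. c \<otimes>\<^bsub>F\<^esub> v i)"
  unfolding qspace_def using coord_space_simps[OF F_field] by auto

lemma sigma_pow: "x \<in> carrier F \<Longrightarrow> \<sigma> (x [^]\<^bsub>F\<^esub> (n::nat)) = \<sigma> x ^ n"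
  by (rule embeds_pow[OF \<sigma>_embeds])

lemma unit_coord_carrier: "unit_coord F n i \<in> {..<n} \<rightarrow>\<^sub>E carrier F"
  by (auto simp: unit_coord_def)

text \<open>A quasilinear form has no mixed terms, so its values on the unit vectors determine it:
  every form is diagonal.\<close>

lemma qform_value:
  assumes q: "quasilinear_form F \<phi>" and v: "v \<in> {..<qdim \<phi>} \<rightarrow>\<^sub>E carrier F"
  shows "qmap \<phi> v \<in> carrier F" "\<sigma> (qmap \<phi> v) = (\<Sum>i<qdim \<phi>. cf \<phi> i * \<sigma> (v i)^2)"
proof -
  let ?n = "qdim \<phi>"
  let ?V = "{..<?n} \<rightarrow>\<^sub>E carrier F"
  have cl: "qmap \<phi> w \<in> carrier F" if "w \<in> ?V" for w
    using q that unfolding quasilinear_form_def qspace_simps by auto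
  then show "qmap \<phi> v \<in> carrier F" using v by blast
  have lin: "\<sigma> (qmap \<phi> (\<lambda>i\<in>{..<?n}. a \<otimes>\<^bsub>F\<^esub> u i \<oplus>\<^bsub>F\<^esub> w i)) = \<sigma> a^2 * \<sigma> (qmap \<phi> u) + \<sigma> (qmap \<phi> w)"
    if "a \<in> carrier F" "u \<in> ?V" "w \<in> ?V" for a u w
  proof -
    have "(\<lambda>i\<in>{..<?n}. a \<otimes>\<^bsub>F\<^esub> u i \<oplus>\<^bsub>F\<^esub> w i) = a \<odot>\<^bsub>qspace F \<phi>\<^esub> u \<oplus>\<^bsub>qspace F \<phi>\<^esub> w"
      by (auto simp: qspace_simps)
    moreover have "qmap \<phi> (a \<odot>\<^bsub>qspace F \<phi>\<^esub> u \<oplus>\<^bsub>qspace F \<phi>\<^esub> w) = a [^]\<^bsub>F\<^esub> (2::nat) \<otimes>\<^bsub>F\<^esub> qmap \<phi> u \<oplus>\<^bsub>F\<^esub> qmap \<phi> w"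
      using q that unfolding quasilinear_form_def qspace_simps(1) by blast
    ultimately show ?thesis using that cl by (simp add: \<sigma>(5-8) sigma_pow)
  qed
  \<comment> \<open>The vector is built up one coordinate at a time, so that the defining identity
    can be applied with a multiple of a unit vector at each step.\<close>
  define pre where "pre k = (\<lambda>i\<in>{..<?n}. if i < k then v i else \<zero>\<^bsub>F\<^esub>)" for k
  have pre: "pre k \<in> ?V" for k
    using PiE_mem[OF v] by (simp add: pre_def restrict_PiE_iff)
  have "\<sigma> (qmap \<phi> (pre k)) = (\<Sum>i<k. cf \<phi> i * \<sigma> (v i)^2)" if "k \<le> ?n" for k
    using that
  proof (induction k)
    case 0
    \<comment> \<open>For the zero vector the defining identity reads \<open>x = x + x\<close>,
      whence the value is 0.\<close>
    have "(\<lambda>i\<in>{..<?n}. \<one>\<^bsub>F\<^esub> \<otimes>\<^bsub>F\<^esub> pre 0 i \<oplus>\<^bsub>F\<^esub> pre 0 i) = pre 0"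
      by (auto simp: pre_def)
    then have "\<sigma> (qmap \<phi> (pre 0)) = \<sigma> (qmap \<phi> (pre 0)) + \<sigma> (qmap \<phi> (pre 0))"
      using lin[OF \<sigma>(2) pre pre, of 0 0] by (simp add: \<sigma>(1-8))
    then show ?case by simp
  next
    case (Suc k)
    then have k: "k < ?n" by simp
    then have vk: "v k \<in> carrier F" using v by auto
    have "(\<lambda>i\<in>{..<?n}. v k \<otimes>\<^bsub>F\<^esub> unit_coord F ?n k i \<oplus>\<^bsub>F\<^esub> pre k i) = pre (Suc k)"
      unfolding pre_def
    proof (rule restrict_ext)
      fix i assume i: "i \<in> {..<?n}"
      then have "v i \<in> carrier F" using PiE_mem[OF v] by blast
      with i vk show "v k \<otimes>\<^bsub>F\<^esub> unit_coord F ?n k i \<oplus>\<^bsub>F\<^esub> (\<lambda>i\<in>{..<?n}. if i < k then v i else \<zero>\<^bsub>F\<^esub>) i =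
          (if i < Suc k then v i else \<zero>\<^bsub>F\<^esub>)"
        by (cases "i = k") (simp_all add: unit_coord_def less_Suc_eq)
    qed
    then have "\<sigma> (qmap \<phi> (pre (Suc k))) = \<sigma> (v k)^2 * cf \<phi> k + \<sigma> (qmap \<phi> (pre k))"
      using lin[OF vk unit_coord_carrier pre] unfolding cf_def by metis
    then show ?case using Suc by (simp add: mult.commute)
  qed
  moreover have "pre ?n = v"
    unfolding pre_def by (rule ext) (use PiE_arb[OF v] in \<open>simp add: restrict_def\<close>)
  ultimately show "\<sigma> (qmap \<phi> v) = (\<Sum>i<?n. cf \<phi> i * \<sigma> (v i)^2)" by (metis le_refl)
qed

lemma quasilinear_formI:
  assumes "\<And>v. v \<in> {..<qdim \<phi>} \<rightarrow>\<^sub>E carrier F \<Longrightarrow> qmap \<phi> v \<in> carrier F"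
    "\<And>v. v \<in> {..<qdim \<phi>} \<rightarrow>\<^sub>E carrier F \<Longrightarrow> \<sigma> (qmap \<phi> v) = (\<Sum>i<qdim \<phi>. c i * \<sigma> (v i)^2)"
  shows "quasilinear_form F \<phi>" "i < qdim \<phi> \<Longrightarrow> cf \<phi> i = c i"
proof -
  show "quasilinear_form F \<phi>" unfolding quasilinear_form_def qspace_simps
  proof (intro conjI ballI funcsetI assms(1))
    fix a v w assume a: "a \<in> carrier F" and vw: "v \<in> {..<qdim \<phi>} \<rightarrow>\<^sub>E carrier F" "w \<in> {..<qdim \<phi>} \<rightarrow>\<^sub>E carrier F"
    let ?u = "\<lambda>i\<in>{..<qdim \<phi>}. (\<lambda>i\<in>{..<qdim \<phi>}. a \<otimes>\<^bsub>F\<^esub> v i) i \<oplus>\<^bsub>F\<^esub> w i"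
    have u: "?u \<in> {..<qdim \<phi>} \<rightarrow>\<^sub>E carrier F" 
      using a PiE_mem[OF vw(1)] PiE_mem[OF vw(2)] by (simp add: restrict_PiE_iff)
    have "\<sigma> (qmap \<phi> ?u) = (\<Sum>i<qdim \<phi>. \<sigma> a^2 * (c i * \<sigma> (v i)^2) + c i * \<sigma> (w i)^2)"
      unfolding assms(2)[OF u]
    proof (rule sum.cong)
      fix i assume i: "i \<in> {..<qdim \<phi>}"
      then have "v i \<in> carrier F" "w i \<in> carrier F" using PiE_mem[OF vw(1)] PiE_mem[OF vw(2)] by blast+
      then show "c i * \<sigma> (?u i)^2 = \<sigma> a^2 * (c i * \<sigma> (v i)^2) + c i * \<sigma> (w i)^2"
        using i a by (simp add: \<sigma>(5-8) power2_add_char2 power_mult_distrib distrib_left mult.left_commute)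
    qed simp
    also have "\<dots> = \<sigma> a^2 * \<sigma> (qmap \<phi> v) + \<sigma> (qmap \<phi> w)"
      unfolding sum.distrib sum_distrib_left[symmetric] assms(2)[OF vw(1)] assms(2)[OF vw(2)] ..
    also have "\<dots> = \<sigma> (a [^]\<^bsub>F\<^esub> (2::nat) \<otimes>\<^bsub>F\<^esub> qmap \<phi> v \<oplus>\<^bsub>F\<^esub> qmap \<phi> w)"
      using a assms(1)[OF vw(1)] assms(1)[OF vw(2)]
      by (simp only: \<sigma>(5-8) sigma_pow F.nat_pow_closed)
    finally show "qmap \<phi> ?u = a [^]\<^bsub>F\<^esub> (2::nat) \<otimes>\<^bsub>F\<^esub> qmap \<phi> v \<oplus>\<^bsub>F\<^esub> qmap \<phi> w"
      by (rule \<sigma>(9)[THEN iffD1, rotated 2])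
        (intro assms(1)[OF u] \<sigma>(5) \<sigma>(6) F.nat_pow_closed a assms(1)[OF vw(1)] assms(1)[OF vw(2)])+
  qed
  assume i: "i < qdim \<phi>"
  have "cf \<phi> i = (\<Sum>j<qdim \<phi>. if j = i then c i else 0)"
    unfolding cf_def assms(2)[OF unit_coord_carrier]
    by (rule sum.cong) (auto simp: unit_coord_def \<sigma>(3,4))
  then show "cf \<phi> i = c i" using i by simp
qed

text \<open>Seen through \<open>x \<mapsto> \<sigma> x^2\<close> a quasilinear form is linear in its
  argument, so its zero set is a null space over the field of squares and
  \<open>dim_nullspace\<close> computes the isotropy index.\<close>

sublocale sq: embedded_field F "\<lambda>x. \<sigma> x^2"
proof
  show "embeds F (\<lambda>x. (\<sigma> x)\<^sup>2)"
    unfolding embeds_def inj_on_def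
    by (auto simp: \<sigma> power2_add_char2 power_mult_distrib power2_eq_iff_char2)
qed

lemma sq_im: "sq.im = squares"
  using \<sigma>_surj by (auto simp: image_iff) (metis UNIV_I image_iff)

sublocale sqs: subfield_set "squares :: 'a set"
  using sq.im.subfield_set_axioms unfolding sq_im .

lemma isotropy_index_rk:
  assumes "quasilinear_form F \<phi>"
  shows "isotropy_index F \<phi> = qdim \<phi> - rk squares (cf \<phi>) {..<qdim \<phi>}"
proof -
  have "qmap \<phi> v = \<zero>\<^bsub>F\<^esub> \<longleftrightarrow> (\<Sum>i<qdim \<phi>. cf \<phi> i * \<sigma> (v i)^2) = 0" if "v \<in> carrier (qspace F \<phi>)" for v
    using qform_value[OF assms, of v] \<sigma>(10)[of "qmap \<phi> v"] that unfolding qspace_simps(1) by simp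
  then have "{v \<in> carrier (qspace F \<phi>). qmap \<phi> v = \<zero>\<^bsub>F\<^esub>} = sq.nullspace (cf \<phi>) (qdim \<phi>)"
    unfolding sq.nullspace_def qspace_def[symmetric]
    by (intro Collect_cong) auto
  then show ?thesis
    unfolding isotropy_index_def qspace_def using sq.dim_nullspace unfolding sq_im by simp
qed

lemma anisotropic_iff:
  "anisotropic F \<phi> \<longleftrightarrow> quasilinear_form F \<phi> \<and> indep squares (cf \<phi>) {..<qdim \<phi>}"
proof (cases "quasilinear_form F \<phi>")
  case True
  have "qdim \<phi> - rk squares (cf \<phi>) {..<qdim \<phi>} = 0 \<longleftrightarrow> indep squares (cf \<phi>) {..<qdim \<phi>}"
    using sqs.rk_indep[of "{..<qdim \<phi>}" "cf \<phi>"] sqs.indep_rk[of "{..<qdim \<phi>}" "cf \<phi>"]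
      sqs.rk_le_card[of "{..<qdim \<phi>}" "cf \<phi>"] by auto
  then show ?thesis unfolding anisotropic_def isotropy_index_rk[OF True] using True by simp
qed (simp add: anisotropic_def)

definition qfrac :: "'u qform \<Rightarrow> 'a mp fract set" where
  "qfrac p = quadric.fracs (cf p) (qdim p - 1)"

lemma quadric_cf:
  assumes "anisotropic F p" "2 \<le> qdim p"
  shows "quadric (cf p) (qdim p - 1)"
proof
  let ?N = "qdim p - 1"
  have ind: "indep squares (cf p) {..<qdim p}" using assms by (simp add: anisotropic_iff)
  show "0 < ?N" using assms by simp
  have mem: "?N < qdim p" "0 < qdim p" "?N \<noteq> 0" using assms by auto
  show nz: "cf p ?N \<noteq> 0"
  proof
    assume "cf p ?N = 0"
    then have "(\<Sum>i<qdim p. cf p i * (if i = ?N then 1 else 0)) = 0"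
      by (intro sum.neutral) auto
    moreover have "\<forall>i\<in>{..<qdim p}. (if i = ?N then 1 else 0) \<in> (squares :: 'a set)"
      by (auto intro: sqs.closed)
    ultimately have "\<forall>i\<in>{..<qdim p}. (if i = ?N then 1 else (0::'a)) = 0"
      by (intro ind[unfolded indep_def, THEN spec, THEN mp, THEN mp])
    then have "(if ?N = ?N then 1 else (0::'a)) = 0" using mem(1) by blast
    then show False by simp
  qed
  show "cf p 0 / cf p ?N \<notin> squares"
  proof
    assume sq: "cf p 0 / cf p ?N \<in> squares"
    \<comment> \<open>The relation \<open>b_0 * 1 + b_N * (b_0 / b_N) = 0\<close>, which a square
      ratio would make an isotropic vector.\<close>
    define w where "w i = (if i = 0 then 1 else if i = ?N then cf p 0 / cf p ?N else 0)" for i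
    have w: "\<forall>i\<in>{..<qdim p}. w i \<in> squares" using sq sqs.closed unfolding w_def by auto
    have "(\<Sum>i<qdim p. cf p i * w i) = (\<Sum>i\<in>{0, ?N}. cf p i * w i)"
      using mem by (intro sum.mono_neutral_right) (auto simp: w_def)
    also have "\<dots> = cf p 0 + cf p 0" using mem nz by (simp add: w_def)
    finally have "(\<Sum>i<qdim p. cf p i * w i) = 0" by simp
    then have "\<forall>i\<in>{..<qdim p}. w i = 0"
      using w by (intro ind[unfolded indep_def, THEN spec, THEN mp, THEN mp])
    then have "w 0 = 0" using mem by auto
    then show False by (simp add: w_def)
  qed
qed

text \<open>The embedding sends a value of the extended form to the square of the linear form with
  coefficients \<open>embc (cf q i)\<close>, since squaring is additive. The zero set is therefore a
  null space over the copy of the function field.\<close>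

lemma function_field_rank:
  assumes p: "anisotropic F p" "2 \<le> qdim p"
  shows "subfield_set (qfrac p)"
    "\<And>q. quasilinear_form F q \<Longrightarrow>
       isotropy_index_over F p q = qdim q - rk (qfrac p) (\<lambda>i. embc (cf q i)) {..<qdim q}"
    "\<And>c. (embc c)^2 \<in> qfrac p"
proof -
  let ?N = "qdim p - 1" let ?L = "function_field F p" let ?h = "function_field_const F p"
  have dim: "qdim p = Suc ?N" using p by simp
  have qp: "quasilinear_form F p" using p by (simp add: anisotropic_def)
  have "quadric_model F \<sigma> p (cf p) ?N"
  proof (intro quadric_model.intro quadric_model_axioms.intro field_model_axioms dim quadric_cf p)
    show "qmap p (unit_coord F (Suc ?N) i) \<in> carrier F" for i
      using qform_value(1)[OF qp unit_coord_carrier] unfolding dim[symmetric] by blast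
    show "\<sigma> (qmap p (unit_coord F (Suc ?N) i)) = cf p i" for i
      unfolding cf_def dim[symmetric] ..
  qed
  then obtain \<psi> where \<psi>: "field ?L" "embeds ?L \<psi>" "\<psi> ` carrier ?L = qfrac p"
    "\<And>c. c \<in> carrier F \<Longrightarrow> ?h c \<in> carrier ?L"
    "\<And>c. c \<in> carrier F \<Longrightarrow> \<psi> (?h c) = (embc (\<sigma> c))^2"
    unfolding qfrac_def using quadric_model.function_field_model by metis
  interpret L: embedded_field ?L \<psi> by (rule embedded_field.intro[OF \<psi>(1,2)])
  show "subfield_set (qfrac p)" using L.im.subfield_set_axioms unfolding \<psi>(3) .
  show "(embc c)^2 \<in> qfrac p" for c
    using \<psi>(4,5)[of "\<tau> c"] unfolding \<psi>(3)[symmetric] by (simp, metis imageI)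
  fix q assume q: "quasilinear_form F q"
  let ?n = "qdim q" let ?e = "extend_form F ?L ?h q" let ?\<beta> = "\<lambda>i. embc (cf q i)"
  have cq: "qmap q (unit_coord F ?n i) \<in> carrier F" for i
    using qform_value(1)[OF q unit_coord_carrier] .
  have val: "qmap ?e x = \<zero>\<^bsub>?L\<^esub> \<longleftrightarrow> (\<Sum>i<?n. ?\<beta> i * \<psi> (x i)) = 0"
    if x: "x \<in> carrier (coord_space ?L ?n)" for x
  proof -
    have xc: "x i \<in> carrier ?L" if "i < ?n" for i
      using x that unfolding coord_space_simps[OF \<psi>(1)] by auto
    have tc: "?h (qmap q (unit_coord F ?n i)) \<otimes>\<^bsub>?L\<^esub> x i [^]\<^bsub>?L\<^esub> (2::nat) \<in> carrier ?L" if "i < ?n" for i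
      using xc[OF that] \<psi>(4)[OF cq] by simp
    have clx: "qmap ?e x \<in> carrier ?L"
      unfolding extend_form_def qform.simps using tc by (intro L.L.finsum_closed) auto
    have "\<psi> (qmap ?e x) = (\<Sum>i<?n. (?\<beta> i * \<psi> (x i))^2)"
      unfolding extend_form_def qform.simps using tc
      by (subst embeds_finsum[OF \<psi>(2)])
         (auto simp: xc \<psi>(4)[OF cq] \<psi>(5)[OF cq] L.\<psi>(8) embeds_pow[OF \<psi>(2)] power_mult_distrib cf_def)
    then have "\<psi> (qmap ?e x) = (\<Sum>i<?n. ?\<beta> i * \<psi> (x i))^2"
      by (simp only: power2_sum_char2)
    then have "\<psi> (qmap ?e x) = 0 \<longleftrightarrow> (\<Sum>i<?n. ?\<beta> i * \<psi> (x i)) = 0"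
      by (simp only: zero_eq_power2)
    then show ?thesis using L.\<psi>(10)[OF clx] by (simp only:)
  qed
  have "{v \<in> carrier (qspace ?L ?e). qmap ?e v = \<zero>\<^bsub>?L\<^esub>} = L.nullspace ?\<beta> ?n"
    unfolding L.nullspace_def qspace_def using val by (auto simp: extend_form_def)
  moreover have "qspace ?L ?e = coord_space ?L ?n" by (simp add: qspace_def extend_form_def)
  ultimately show "isotropy_index_over F p q = ?n - rk (qfrac p) ?\<beta> {..<?n}"
    unfolding isotropy_index_over_def isotropy_index_def using L.dim_nullspace[of ?\<beta> ?n] \<psi>(3) by simp
qed

lemma function_field_indep:
  assumes p: "anisotropic F p" "2 \<le> qdim p" and E: "sq_subfield E"
    and i0: "i0 < qdim p - 1" "cf p i0 / cf p (qdim p - 1) \<notin> E"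
    and t: "finite T" "\<And>i. i \<in> T \<Longrightarrow> t i \<in> E" "indep squares t T"
  shows "indep (qfrac p) (\<lambda>i. embc (t i)) T"
  unfolding qfrac_def by (rule quadric.fracs_indep[OF quadric_cf[OF p] E i0 t])

lemma function_field_generic_zero:
  assumes p: "anisotropic F p" "2 \<le> qdim p"
  obtains x where "\<And>i. i < qdim p \<Longrightarrow> x i \<in> qfrac p" "\<And>i. i < qdim p \<Longrightarrow> x i \<noteq> 0"
    "(\<Sum>i<qdim p. embc (cf p i) * x i) = 0"
proof -
  have "Suc (qdim p - 1) = qdim p" using p by simp
  then show ?thesis
    using that quadric.generic_zero[OF quadric_cf[OF p]] unfolding qfrac_def by auto
qed

lemma diag_form_simps:
  assumes "set as \<subseteq> carrier F"
  shows "qdim (diag_form F as) = length as" "quasilinear_form F (diag_form F as)"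
    "i < length as \<Longrightarrow> cf (diag_form F as) i = \<sigma> (as ! i)"
proof -
  let ?\<phi> = "diag_form F as"
  show dim: "qdim ?\<phi> = length as" by (simp add: diag_form_def)
  have as: "as ! i \<in> carrier F" if "i < length as" for i using assms that by auto
  have "qmap ?\<phi> v \<in> carrier F" "\<sigma> (qmap ?\<phi> v) = (\<Sum>i<qdim ?\<phi>. \<sigma> (as ! i) * \<sigma> (v i)^2)"
    if v: "v \<in> {..<qdim ?\<phi>} \<rightarrow>\<^sub>E carrier F" for v
  proof -
    have tc: "v i \<in> carrier F" "as ! i \<otimes>\<^bsub>F\<^esub> v i [^]\<^bsub>F\<^esub> (2::nat) \<in> carrier F" if "i < length as" for i
      using v that as unfolding dim by auto
    show "qmap ?\<phi> v \<in> carrier F"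
      unfolding diag_form_def qform.simps using tc by (intro F.finsum_closed) auto
    show "\<sigma> (qmap ?\<phi> v) = (\<Sum>i<qdim ?\<phi>. \<sigma> (as ! i) * \<sigma> (v i)^2)"
      unfolding diag_form_def qform.simps using tc as
      by (subst embeds_finsum[OF \<sigma>_embeds]) (auto simp: \<sigma>(8) sigma_pow)
  qed
  from quasilinear_formI[of ?\<phi> "\<lambda>i. \<sigma> (as ! i)", OF this]
  show "quasilinear_form F ?\<phi>" "i < length as \<Longrightarrow> cf ?\<phi> i = \<sigma> (as ! i)" unfolding dim by auto
qed

end

unbundle bit_operations_syntax

section \<open>Monomials indexed by binary expansions\<close>

definition bits :: "nat \<Rightarrow> nat set" where
  "bits a = {i. Bit_Operations.bit a i}"

definition mono :: "(nat \<Rightarrow> 'k::comm_ring_1) \<Rightarrow> nat \<Rightarrow> 'k" where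
  "mono g a = (\<Prod>i\<in>bits a. g i)"

lemma bits_lt: "a < 2 ^ m \<longleftrightarrow> bits a \<subseteq> {..<m}"
proof
  assume "a < 2 ^ m"
  then have "a = take_bit m a" by (simp add: take_bit_nat_eq_self)
  then show "bits a \<subseteq> {..<m}" unfolding bits_def
    by (metis (mono_tags, lifting) bit_take_bit_iff lessThan_iff mem_Collect_eq subsetI)
next
  assume "bits a \<subseteq> {..<m}"
  then have "take_bit m a = a" unfolding bits_def by (intro bit_eqI) (auto simp: bit_take_bit_iff)
  then show "a < 2 ^ m" by (metis take_bit_nat_less_exp)
qed

lemma finite_bits [simp]: "finite (bits a)"
proof -
  have "a < 2 ^ a" by simp
  then show ?thesis using bits_lt finite_subset by blast
qed

lemma bits_inj: "bits a = bits b \<longleftrightarrow> a = b"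
  unfolding bits_def by (auto intro: bit_eqI)

lemma bits_xor: "bits (a XOR b) = (bits a - bits b) \<union> (bits b - bits a)"
  by (auto simp: bits_def bit_xor_iff)

lemma bits_and: "bits (a AND b) = bits a \<inter> bits b"
  by (auto simp: bits_def bit_and_iff)

lemma bits_power2 [simp]: "bits (2 ^ i) = {i}"
  by (auto simp: bits_def bit_exp_iff)

lemma bits_0 [simp]: "bits 0 = {}"
  by (simp add: bits_def)

lemma xor_lt: "a < 2 ^ m \<Longrightarrow> b < 2 ^ m \<Longrightarrow> a XOR b < (2::nat) ^ m"
  unfolding bits_lt bits_xor by blast

lemma xor_add: "a < 2 ^ m \<Longrightarrow> 2 ^ m XOR a = 2 ^ m + (a::nat)"
proof -
  assume "a < 2 ^ m"
  then have "2 ^ m AND a = 0" unfolding bits_lt bits_inj[symmetric] bits_and by auto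
  then show ?thesis by (simp add: disjunctive_add_eq_xor)
qed

lemma mono_0 [simp]: "mono g 0 = 1"
  by (simp add: mono_def)

lemma mono_power2 [simp]: "mono g (2 ^ i) = g i"
  by (simp add: mono_def)

lemma mono_mult: "mono g a * mono g b = mono g (a XOR b) * (mono g (a AND b))^2"
proof -
  let ?A = "bits a - bits b" and ?B = "bits b - bits a" and ?C = "bits a \<inter> bits b"
  have "mono g a = prod g ?A * prod g ?C" unfolding mono_def
    by (subst prod.union_disjoint[symmetric]) (auto intro: arg_cong[of _ _ "prod g"])
  moreover have "mono g b = prod g ?B * prod g ?C" unfolding mono_def
    by (subst prod.union_disjoint[symmetric]) (auto intro: arg_cong[of _ _ "prod g"])
  moreover have "mono g (a XOR b) = prod g ?A * prod g ?B" unfolding mono_def bits_xor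
    by (subst prod.union_disjoint[symmetric]) auto
  ultimately show ?thesis unfolding mono_def[of g "a AND b"] bits_and
    by (simp add: power2_eq_square ac_simps)
qed

lemma mono_cong: "(\<And>i. i \<in> bits a \<Longrightarrow> g i = h i) \<Longrightarrow> mono g a = mono h a"
  unfolding mono_def by (rule prod.cong) auto

lemma mono_add_power2: "a < 2 ^ m \<Longrightarrow> mono g (2 ^ m + a) = g m * mono g a"
proof -
  assume a: "a < 2 ^ m"
  then have "bits (2 ^ m + a) = insert m (bits a)" "m \<notin> bits a"
    using bits_lt[of a m] unfolding xor_add[OF a, symmetric] bits_xor by auto
  then show ?thesis by (simp add: mono_def)
qed

lemma lessThan_power2_Suc: "{..<2 ^ Suc m} = {..<2 ^ m} \<union> (\<lambda>a. 2 ^ m + a) ` {..<2 ^ m :: nat}"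
proof -
  have "x \<in> (\<lambda>a. 2 ^ m + a) ` {..<2 ^ m}" if "x < 2 * 2 ^ m" "\<not> x < 2 ^ m" for x :: nat
    using that by (intro image_eqI[of _ _ "x - 2 ^ m"]) auto
  then show ?thesis by auto
qed

locale subfield_char2 = subfield_set S for S :: "'k::{field,ring_char2} set"
begin

lemma one_spn_mono: "1 \<in> spn S (mono g) {..<2 ^ m}"
  using spn_base[of "{..<2 ^ m}" 0 "mono g"] by simp

lemma subset_spn_mono: "c \<in> S \<Longrightarrow> c \<in> spn S (mono g) {..<2 ^ m}"
  using spn_mult[OF one_spn_mono, of c g m] by simp

lemma mono_in: "(\<And>i. i \<in> bits a \<Longrightarrow> (g i)^2 \<in> S) \<Longrightarrow> (mono g a)^2 \<in> S"
proof -
  assume g: "\<And>i. i \<in> bits a \<Longrightarrow> (g i)^2 \<in> S"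
  have "(\<Prod>i\<in>A. (g i)^2) \<in> S" if "A \<subseteq> bits a" for A
    using finite_subset[OF that finite_bits] that by (induction A) (auto intro!: closed(4) g)
  then show ?thesis unfolding mono_def by (simp add: prod_power_distrib)
qed

text \<open>A product of two monomials is the monomial of the XOR, which is again below
  \<open>2 ^ m\<close>, times a square that \<open>S\<close> contains.\<close>

lemma spn_mono_mult:
  assumes g: "\<And>i. i < m \<Longrightarrow> (g i)^2 \<in> S"
    and x: "x \<in> spn S (mono g) {..<2 ^ m}" and y: "y \<in> spn S (mono g) {..<2 ^ m}"
  shows "x * y \<in> spn S (mono g) {..<2 ^ m}"
proof -
  obtain v where v: "\<And>i. i \<in> {..<2 ^ m} \<Longrightarrow> v i \<in> S" "x = (\<Sum>i<2 ^ m. mono g i * v i)"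
    using spnE[OF x] by blast
  obtain w where w: "\<And>i. i \<in> {..<2 ^ m} \<Longrightarrow> w i \<in> S" "y = (\<Sum>i<2 ^ m. mono g i * w i)"
    using spnE[OF y] by blast
  have "mono g i * v i * (mono g j * w j) \<in> spn S (mono g) {..<2 ^ m}"
    if "i < 2 ^ m" "j < 2 ^ m" for i j
  proof -
    have "mono g (i XOR j) * ((mono g (i AND j))^2 * v i * w j) \<in> spn S (mono g) {..<2 ^ m}"
    proof (rule spn_mult)
      show "mono g (i XOR j) \<in> spn S (mono g) {..<2 ^ m}"
        using xor_lt[OF that] by (intro spn_base) auto
      have "(mono g (i AND j))^2 \<in> S"
        using that g by (intro mono_in) (auto simp: bits_lt bits_and)
      then show "(mono g (i AND j))^2 * v i * w j \<in> S" using v(1) w(1) that by simp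
    qed
    then show ?thesis using mono_mult[of g i j] by (simp add: ac_simps)
  qed
  then show ?thesis unfolding v(2) w(2) sum_product by (intro spn_sum) auto
qed

text \<open>A relation splits as \<open>x + g m * y = 0\<close> with \<open>x\<close> and
  \<open>y\<close> in the span of the earlier monomials. As \<open>y^2\<close> lies in
  \<open>S\<close>, \<open>y \<noteq> 0\<close> would put \<open>g m = x * y / y^2\<close> into that
  span.\<close>

lemma indep_mono_Suc:
  assumes g: "\<And>i. i < Suc m \<Longrightarrow> (g i)^2 \<in> S"
    and ind: "indep S (mono g) {..<2 ^ m}" and gm: "g m \<notin> spn S (mono g) {..<2 ^ m}"
  shows "indep S (mono g) {..<2 ^ Suc m}"
  unfolding indep_def
proof (intro allI impI)
  let ?E = "spn S (mono g) {..<2 ^ m}"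
  fix w assume w: "\<forall>i\<in>{..<2 ^ Suc m}. w i \<in> S" "(\<Sum>i<2 ^ Suc m. mono g i * w i) = 0"
  define x where "x = (\<Sum>i<2 ^ m. mono g i * w i)"
  define y where "y = (\<Sum>i<2 ^ m. mono g i * w (2 ^ m + i))"
  have wS: "w i \<in> S" "w (2 ^ m + i) \<in> S" if "i < 2 ^ m" for i
    using w(1) that by auto
  have x: "x \<in> ?E" and y: "y \<in> ?E" 
    unfolding x_def y_def
    by (rule spnI[of _ w], simp_all add: wS, rule spnI[of _ "\<lambda>i. w (2 ^ m + i)"], simp_all add: wS)
  have "(\<Sum>i<2 ^ Suc m. mono g i * w i) = x + (\<Sum>i\<in>(\<lambda>a. 2 ^ m + a) ` {..<2 ^ m}. mono g i * w i)"
    unfolding lessThan_power2_Suc x_def by (rule sum.union_disjoint) auto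
  also have "(\<Sum>i\<in>(\<lambda>a. 2 ^ m + a) ` {..<2 ^ m}. mono g i * w i) = g m * y"
    unfolding y_def sum_distrib_left 
    by (subst sum.reindex, simp, rule sum.cong) (simp_all add: mono_add_power2 mult.assoc)
  finally have eq: "x + g m * y = 0" using w(2) by simp
  have "y = 0"
  proof (rule ccontr)
    assume ny: "y \<noteq> 0"
    have "y^2 = (\<Sum>i<2 ^ m. (mono g i)^2 * (w (2 ^ m + i))^2)"
      unfolding y_def power2_sum_char2 power_mult_distrib ..
    also have "\<dots> \<in> S"
      using g wS by (intro closed_sum closed(4) mono_in) (auto simp: bits_lt power2_eq_square)
    finally have "x * y * inverse (y^2) \<in> ?E"
      using x y g by (intro spn_mult spn_mono_mult closed(5)) auto
    moreover have "x = g m * y" using eq by (simp add: add_eq_0_char2)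
    ultimately have "g m \<in> ?E" using ny by (simp add: power2_eq_square field_simps)
    then show False using gm by blast
  qed
  then have "x = 0" using eq by simp
  have "\<forall>i\<in>{..<2 ^ m}. w i = 0"
    using \<open>x = 0\<close> wS unfolding x_def by (intro ind[unfolded indep_def, THEN spec, THEN mp, THEN mp]) auto
  moreover have "\<forall>i\<in>{..<2 ^ m}. w (2 ^ m + i) = 0"
    using \<open>y = 0\<close> wS unfolding y_def by (intro ind[unfolded indep_def, THEN spec[of _ "\<lambda>i. w (2 ^ m + i)"], THEN mp, THEN mp]) auto
  ultimately show "\<forall>i\<in>{..<2 ^ Suc m}. w i = 0" unfolding lessThan_power2_Suc by auto
qed

text \<open>Adjoining the \<open>g i\<close> one at a time at most doubles the rank. A dependence
  means that some \<open>g i\<close> already lies in the span of the monomials before it; at that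
  step the rank does not grow, and the factor 2 lost there is never regained.\<close>

lemma rk_mono_dependent:
  assumes g: "\<And>i. i < m \<Longrightarrow> (g i)^2 \<in> S" and dep: "\<not> indep S (mono g) {..<2 ^ m}"
  shows "2 * rk S (mono g) {..<2 ^ m} \<le> 2 ^ m"
  using assms
proof (induction m)
  case 0
  have "indep S (mono g) {..<2 ^ 0}" by (simp add: indep_def)
  then show ?case using 0 by blast
next
  case (Suc m)
  show ?case
  proof (cases "indep S (mono g) {..<2 ^ m}")
    case True
    then have gm: "g m \<in> spn S (mono g) {..<2 ^ m}" using indep_mono_Suc[of m g] Suc.prems by blast
    have "rk S (mono g) {..<2 ^ Suc m} \<le> card {..<2 ^ m :: nat}"
    proof (rule rk_le[where \<gamma> = "mono g"])
      fix j :: nat assume "j \<in> {..<2 ^ Suc m}"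
      then consider "j < 2 ^ m" | a where "a < 2 ^ m" "j = 2 ^ m + a"
        unfolding lessThan_power2_Suc by auto
      then show "mono g j \<in> spn S (mono g) {..<2 ^ m}"
      proof cases
        case 2
        show ?thesis unfolding 2 mono_add_power2[OF 2(1)]
          using 2(1) Suc.prems(1) by (intro spn_mono_mult gm spn_base) auto
      qed (simp add: spn_base)
    qed auto
    then show ?thesis by simp
  next
    case False
    then have IH: "2 * rk S (mono g) {..<2 ^ m} \<le> 2 ^ m" using Suc by simp
    obtain B where mB: "max_indep S (mono g) {..<2 ^ m} B"
      using max_indep_some[of "{..<2 ^ m}" "mono g"] by blast
    then have B: "B \<subseteq> {..<2 ^ m}" "\<And>j. j < 2 ^ m \<Longrightarrow> mono g j \<in> spn S (mono g) B"
      unfolding max_indep_def by auto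
    have fin: "finite B" using B(1) finite_subset by blast
    let ?B = "B \<union> (\<lambda>a. 2 ^ m + a) ` B"
    have "rk S (mono g) {..<2 ^ Suc m} \<le> card ?B"
    proof (rule rk_le[where \<gamma> = "mono g"])
      fix j :: nat assume "j \<in> {..<2 ^ Suc m}"
      then consider "j < 2 ^ m" | a where "a < 2 ^ m" "j = 2 ^ m + a"
        unfolding lessThan_power2_Suc by auto
      then show "mono g j \<in> spn S (mono g) ?B"
      proof cases
        case 1
        then show ?thesis using B(2) spn_mono[of ?B B "mono g"] fin by blast
      next
        case 2
        obtain w where w: "\<And>i. i \<in> B \<Longrightarrow> w i \<in> S" "mono g a = (\<Sum>i\<in>B. mono g i * w i)"
          using spnE[OF B(2)[OF 2(1)]] by blast
        have "mono g j = (\<Sum>i\<in>B. mono g (2 ^ m + i) * w i)"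
          unfolding 2(2) mono_add_power2[OF 2(1)] w(2) sum_distrib_left
          using B(1) by (intro sum.cong) (auto simp: mono_add_power2 mult.assoc)
        also have "\<dots> \<in> spn S (mono g) ?B"
          using w(1) fin by (intro spn_sum spn_mult spn_base) auto
        finally show ?thesis .
      qed
    qed (use fin in auto)
    also have "card ?B \<le> card B + card B"
      using fin by (intro order.trans[OF card_Un_le] add_left_mono card_image_le)
    also have "card B = rk S (mono g) {..<2 ^ m}" using rk_eq[OF _ mB] by simp
    finally show ?thesis using IH by simp
  qed
qed

end

section \<open>A field with infinite 2-basis\<close>

type_synonym base = "bit mp fract"

definition base_var :: "nat \<Rightarrow> base" where
  "base_var i = Fract (mvar i) 1"

lemma keys_power2:
  fixes f :: "'a::{idom,ring_char2} mp"
  assumes "m \<in> keys (f^2)"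
  shows "\<exists>l. m = l + l"
proof -
  have "\<forall>m\<in>keys (f^2). \<exists>l. m = l + l"
  proof (induction f rule: mp_induct)
    case (single m c)
    then show ?case by (auto simp: power2_eq_square mult_single)
  next
    case (add f g)
    then show ?case using Poly_Mapping.keys_add[of "f^2" "g^2"] unfolding power2_add_char2 by blast
  qed
  then show ?thesis using assms by blast
qed

text \<open>Squares have even exponents, so the parities of the exponents in a monomial of the
  \<open>a\<close>-th term spell out the binary digits of \<open>a\<close>. Different terms
  therefore share no monomial and cannot cancel.\<close>

lemma indep_squarefree_monomials:
  fixes f :: "nat \<Rightarrow> 'a::{idom,ring_char2} mp"
  assumes "finite A" "(\<Sum>a\<in>A. single (mset_set (bits a)) 1 * (f a)^2) = 0" "a \<in> A"
  shows "f a = 0"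
proof (rule ccontr)
  assume nz: "f a \<noteq> 0"
  let ?s = "\<lambda>a. single (mset_set (bits a)) (1::'a)"
  have "?s a \<noteq> 0" by (metis lookup_single_eq lookup_zero zero_neq_one)
  then have "?s a * (f a)^2 \<noteq> 0" using nz by simp
  then obtain m where m: "m \<in> keys (?s a * (f a)^2)" by (metis ex_in_conv keys_eq_empty)
  have key: "odd (count m i) \<longleftrightarrow> i \<in> bits b" if mk: "m \<in> keys (?s b * (f b)^2)" for b i
  proof -
    obtain k where k: "k \<in> keys ((f b)^2)" "m = mset_set (bits b) + k"
      using mk Poly_Mapping.keys_mult[of "?s b" "(f b)^2"] by auto
    obtain l where "k = l + l" using keys_power2[OF k(1)] by blast
    then show ?thesis using k(2) by (simp add: count_mset_set')
  qed
  have "lookup (?s b * (f b)^2) m = 0" if b: "b \<in> A - {a}" for b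
  proof (rule ccontr)
    assume "lookup (?s b * (f b)^2) m \<noteq> 0"
    then have "m \<in> keys (?s b * (f b)^2)" by (simp add: in_keys_iff)
    then have "bits a = bits b" using key m by blast
    then show False using b bits_inj by blast
  qed
  then have "lookup (\<Sum>b\<in>A. ?s b * (f b)^2) m = lookup (?s a * (f a)^2) m"
    using assms(1,3) by (simp add: lookup_sum lookup_add sum.remove)
  then show False using assms(2) m by (simp add: in_keys_iff)
qed

lemma common_denominator:
  fixes w :: "'i \<Rightarrow> 'a::idom fract"
  assumes "finite A"
  shows "\<exists>D f. D \<noteq> 0 \<and> (\<forall>a\<in>A. w a = Fract (f a) D)"
  using assms
proof (induction A)
  case empty
  show ?case by (intro exI[of _ 1]) auto
next
  case (insert a A)
  then obtain D f where D: "D \<noteq> 0" "\<forall>a\<in>A. w a = Fract (f a) D" by blast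
  obtain n d where nd: "d \<noteq> 0" "w a = Fract n d" by (cases "w a") auto
  have "\<forall>x\<in>insert a A. w x = Fract ((if x = a then n * D else f x * d)) (D * d)"
    using D nd insert(2) by (auto simp: eq_fract)
  then show ?case using D(1) nd(1)
    by (intro exI[of _ "D * d"] exI[of _ "\<lambda>x. if x = a then n * D else f x * d"]) auto
qed

lemma mono_base_var: "mono base_var a = Fract (single (mset_set (bits a)) 1) 1"
proof -
  have "(\<Prod>i\<in>A. base_var i) = Fract (single (mset_set A) 1) 1" if "finite A" for A
    using that by (induction A) (simp_all add: base_var_def One_fract_def mult_single)
  then show ?thesis unfolding mono_def by simp
qed

lemma indep_mono_base:
  assumes "finite A"
  shows "indep squares (mono base_var) A"
  unfolding indep_def
proof (intro allI impI ballI)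
  fix w a assume w: "\<forall>i\<in>A. w i \<in> (squares :: base set)" "(\<Sum>i\<in>A. mono base_var i * w i) = 0"
    and a: "a \<in> A"
  have "\<forall>i\<in>A. \<exists>v. w i = v^2" using w(1) by auto
  then obtain v where v: "\<And>i. i \<in> A \<Longrightarrow> w i = (v i)^2" by metis
  obtain D f where D: "D \<noteq> 0" "\<And>a. a \<in> A \<Longrightarrow> v a = Fract (f a) D"
    using common_denominator[OF assms, of v] by blast
  let ?s = "\<lambda>i. single (mset_set (bits i)) (1::bit)"
  have "Fract (?s i * (f i)^2) 1 = Fract (D^2) 1 * (mono base_var i * w i)" if "i \<in> A" for i
    unfolding mono_base_var v[OF that] D(2)[OF that] using D(1)
    by (simp add: power2_eq_square eq_fract ac_simps)
  then have "(\<Sum>i\<in>A. Fract (?s i * (f i)^2) 1) = Fract (D^2) 1 * (\<Sum>i\<in>A. mono base_var i * w i)"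
    unfolding sum_distrib_left by (rule sum.cong[OF refl])
  also have "\<dots> = 0" using w(2) by simp
  also have "(\<Sum>i\<in>A. Fract (?s i * (f i)^2) 1) = Fract (\<Sum>i\<in>A. ?s i * (f i)^2) 1"
    by (rule emb_sum[symmetric])
  finally have "(\<Sum>i\<in>A. ?s i * (f i)^2) = 0" by (simp add: emb_simps)
  then have "f a = 0" using indep_squarefree_monomials[OF assms _ a] by blast
  then show "w a = 0" using v[OF a] D(2)[OF a] by (simp add: fract_collapse)
qed

text \<open>The carrier type \<open>'u\<close> may be any infinite type, so the base field has to be
  countable to fit into it. A polynomial over the field with two elements is determined by its
  finite set of monomials.\<close>

lemma countable_base: "countable (UNIV :: base set)"
proof -
  have "inj (keys :: bit mp \<Rightarrow> _)"
  proof (rule injI)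
    fix f g :: "bit mp" assume "keys f = keys g"
    then have "lookup f m = 0 \<longleftrightarrow> lookup g m = 0" for m by (metis in_keys_iff)
    then show "f = g" by (intro poly_mapping_eqI) (metis bit_not_zero_iff)
  qed
  moreover have "range (keys :: bit mp \<Rightarrow> _) \<subseteq> {A. finite A}" by auto
  moreover have "countable {A :: nat multiset set. finite A}"
  proof -
    have "UNIV = mset ` (UNIV :: nat list set)" by (metis surj_def ex_mset)
    then have "countable (UNIV :: nat multiset set)" by (metis countable_image uncountable_def countableI_type)
    then show ?thesis using countable_Collect_finite_subset[of "UNIV :: nat multiset set"] by simp
  qed
  ultimately have "countable (UNIV :: bit mp set)"
    by (metis countable_image_inj_on countable_subset)
  then have "countable ((\<lambda>(a, b). Fract a b) ` (UNIV :: (bit mp \<times> bit mp) set))"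
    by (metis countable_SIGMA countable_image UNIV_Times_UNIV)
  moreover have "(\<lambda>(a, b). Fract a b) ` (UNIV :: (bit mp \<times> bit mp) set) = UNIV"
  proof (intro equalityI subsetI UNIV_I)
    fix x :: base
    obtain a b where "x = Fract a b" by (cases x) auto
    then show "x \<in> (\<lambda>(a, b). Fract a b) ` UNIV" by (intro image_eqI[of _ _ "(a, b)"]) auto
  qed
  ultimately show ?thesis by simp
qed

text \<open>Transport of structure along an injection of the countable base field into
  \<open>'u\<close>.\<close>

lemma base_field_model:
  obtains F :: "'u::infinite ring" and \<sigma> :: "'u \<Rightarrow> base" where "field_model F \<sigma>"
proof -
  obtain h :: "base \<Rightarrow> nat" where h: "inj h" using countable_base by (auto simp: countable_def)
  obtain k :: "nat \<Rightarrow> 'u" where k: "inj k" using infinite_UNIV infinite_countable_subset by blast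
  define e where "e = k \<circ> h"
  have e: "inj e" unfolding e_def using h k by (rule inj_compose[rotated])
  define F :: "'u ring" where
    "F = \<lparr>carrier = range e, monoid.mult = \<lambda>x y. e (inv_into UNIV e x * inv_into UNIV e y), one = e 1, zero = e 0,
          add = \<lambda>x y. e (inv_into UNIV e x + inv_into UNIV e y)\<rparr>"
  have emb: "embeds F (inv_into UNIV e)"
    unfolding embeds_def F_def using e by (auto simp: inj_on_def)
  have "field F"
  proof (rule embeds_field[OF emb])
    fix x assume "x \<in> carrier F" "x \<noteq> \<zero>\<^bsub>F\<^esub>"
    then obtain a where "x = e a" "a \<noteq> 0" by (auto simp: F_def)
    then show "\<exists>y\<in>carrier F. inv_into UNIV e x * inv_into UNIV e y = 1"
      using e by (intro bexI[of _ "e (inverse a)"]) (auto simp: F_def)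
  qed
  moreover have "inv_into UNIV e ` carrier F = UNIV"
    using e by (auto simp: F_def image_image)
  ultimately have "field_model F (inv_into UNIV e)" using emb by (simp add: field_model_def)
  then show ?thesis using that by blast
qed

section \<open>Value sets\<close>

lemma sum_lessThan_add: "(\<Sum>i<a + b. h i) = (\<Sum>i<a. h i) + (\<Sum>i<b. h (a + i))"
  for h :: "nat \<Rightarrow> 'a::comm_monoid_add"
  by (induction b) (simp_all add: add.assoc)

context field_model
begin

lemma qform_values:
  assumes "quasilinear_form F \<phi>"
  shows "\<sigma> ` qmap \<phi> ` carrier (qspace F \<phi>) = spn squares (cf \<phi>) {..<qdim \<phi>}"
proof (intro equalityI subsetI)
  fix x assume "x \<in> \<sigma> ` qmap \<phi> ` carrier (qspace F \<phi>)"
  then obtain v where v: "v \<in> {..<qdim \<phi>} \<rightarrow>\<^sub>E carrier F" "x = \<sigma> (qmap \<phi> v)"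
    unfolding qspace_simps(1) by blast
  then show "x \<in> spn squares (cf \<phi>) {..<qdim \<phi>}"
    using qform_value(2)[OF assms v(1)] by (intro sqs.spnI[of _ "\<lambda>i. \<sigma> (v i)^2"]) auto
next
  fix x assume "x \<in> spn squares (cf \<phi>) {..<qdim \<phi>}"
  then obtain w where w: "\<And>i. i \<in> {..<qdim \<phi>} \<Longrightarrow> w i \<in> squares" "x = (\<Sum>i<qdim \<phi>. cf \<phi> i * w i)"
    using sqs.spnE by blast
  have "\<forall>i\<in>{..<qdim \<phi>}. \<exists>u. w i = u^2" using w(1) by blast
  then obtain u where u: "\<And>i. i < qdim \<phi> \<Longrightarrow> w i = (u i)^2" by (metis lessThan_iff)
  let ?v = "\<lambda>i\<in>{..<qdim \<phi>}. \<tau> (u i)"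
  have v: "?v \<in> {..<qdim \<phi>} \<rightarrow>\<^sub>E carrier F" by (simp add: restrict_PiE_iff)
  have "x = \<sigma> (qmap \<phi> ?v)"
    unfolding qform_value(2)[OF assms v] w(2) using u by (intro sum.cong) auto
  then show "x \<in> \<sigma> ` qmap \<phi> ` carrier (qspace F \<phi>)"
    unfolding qspace_simps(1) using v by blast
qed

lemma quasilinear_smult_add:
  assumes "quasilinear_form F \<phi>" "a \<in> carrier F" "v \<in> carrier (qspace F \<phi>)" "w \<in> carrier (qspace F \<phi>)"
  shows "qmap \<phi> (a \<odot>\<^bsub>qspace F \<phi>\<^esub> v \<oplus>\<^bsub>qspace F \<phi>\<^esub> w) = a [^]\<^bsub>F\<^esub> (2::nat) \<otimes>\<^bsub>F\<^esub> qmap \<phi> v \<oplus>\<^bsub>F\<^esub> qmap \<phi> w"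
  using assms unfolding quasilinear_form_def by blast

lemma qmap_closed:
  "quasilinear_form F \<phi> \<Longrightarrow> v \<in> carrier (qspace F \<phi>) \<Longrightarrow> qmap \<phi> v \<in> carrier F"
  using qform_value(1) unfolding qspace_simps(1) by blast

lemma vectorspace_qspace: "vectorspace F (qspace F \<phi>)"
  unfolding qspace_def by (rule vectorspace_coord_space[OF F_field])

lemma quasilinear_add:
  assumes "quasilinear_form F \<phi>" "v \<in> carrier (qspace F \<phi>)" "w \<in> carrier (qspace F \<phi>)"
  shows "qmap \<phi> (v \<oplus>\<^bsub>qspace F \<phi>\<^esub> w) = qmap \<phi> v \<oplus>\<^bsub>F\<^esub> qmap \<phi> w"
proof -
  interpret V: vectorspace F "qspace F \<phi>" by (rule vectorspace_qspace)
  show ?thesis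
    using quasilinear_smult_add[OF assms(1) \<sigma>(2) assms(2,3)] assms(2) qmap_closed[OF assms(1,2)] V.smult_one by simp
qed

lemma quasilinear_smult:
  assumes "quasilinear_form F \<phi>" "a \<in> carrier F" "v \<in> carrier (qspace F \<phi>)"
  shows "qmap \<phi> (a \<odot>\<^bsub>qspace F \<phi>\<^esub> v) = a [^]\<^bsub>F\<^esub> (2::nat) \<otimes>\<^bsub>F\<^esub> qmap \<phi> v"
proof -
  interpret V: vectorspace F "qspace F \<phi>" by (rule vectorspace_qspace)
  have zc: "\<zero>\<^bsub>qspace F \<phi>\<^esub> \<in> {..<qdim \<phi>} \<rightarrow>\<^sub>E carrier F" using V.M.zero_closed unfolding qspace_simps(1) .
  have "\<sigma> (qmap \<phi> \<zero>\<^bsub>qspace F \<phi>\<^esub>) = 0"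
    unfolding qform_value(2)[OF assms(1) zc] by (intro sum.neutral) (simp add: qspace_simps(2) \<sigma>(3))
  then have z: "qmap \<phi> \<zero>\<^bsub>qspace F \<phi>\<^esub> = \<zero>\<^bsub>F\<^esub>" using \<sigma>(10) qform_value(1)[OF assms(1) zc] by blast
  show ?thesis
    using quasilinear_smult_add[OF assms V.M.zero_closed] assms qmap_closed[OF assms(1,3)] V.smult_closed
    by (simp add: z)
qed

text \<open>A quasilinear form is additive, so two vectors with equal values differ by an isotropic
  vector.\<close>

lemma qmap_inj_iff:
  assumes "quasilinear_form F \<phi>"
  shows "anisotropic F \<phi> \<longleftrightarrow> inj_on (qmap \<phi>) (carrier (qspace F \<phi>))"
proof
  assume "anisotropic F \<phi>"
  then have ind: "indep squares (cf \<phi>) {..<qdim \<phi>}" by (simp add: anisotropic_iff)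
  show "inj_on (qmap \<phi>) (carrier (qspace F \<phi>))" unfolding qspace_simps(1)
  proof (rule inj_onI)
    fix v w assume vw: "v \<in> {..<qdim \<phi>} \<rightarrow>\<^sub>E carrier F" "w \<in> {..<qdim \<phi>} \<rightarrow>\<^sub>E carrier F" "qmap \<phi> v = qmap \<phi> w"
    have "(\<Sum>i<qdim \<phi>. cf \<phi> i * (\<sigma> (v i) + \<sigma> (w i))^2) = \<sigma> (qmap \<phi> v) + \<sigma> (qmap \<phi> w)"
      unfolding qform_value(2)[OF assms vw(1)] qform_value(2)[OF assms vw(2)]
      by (simp add: power2_add_char2 distrib_left sum.distrib)
    also have "\<dots> = 0" using vw(3) by simp
    finally have "\<forall>i\<in>{..<qdim \<phi>}. (\<sigma> (v i) + \<sigma> (w i))^2 = 0"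
      by (intro ind[unfolded indep_def, THEN spec, THEN mp, THEN mp]) auto
    then have eq: "\<sigma> (v i) = \<sigma> (w i)" if "i \<in> {..<qdim \<phi>}" for i
      using that by (simp add: add_eq_0_char2)
    show "v = w"
    proof (rule PiE_ext[OF vw(1,2)])
      fix i assume i: "i \<in> {..<qdim \<phi>}"
      show "v i = w i"
        by (rule \<sigma>(9)[THEN iffD1, OF PiE_mem[OF vw(1) i] PiE_mem[OF vw(2) i] eq[OF i]])
    qed
  qed
next
  assume inj: "inj_on (qmap \<phi>) (carrier (qspace F \<phi>))"
  have "indep squares (cf \<phi>) {..<qdim \<phi>}"
    unfolding indep_def
  proof (intro allI impI ballI)
    fix w i assume w: "\<forall>i\<in>{..<qdim \<phi>}. w i \<in> squares" "(\<Sum>i<qdim \<phi>. cf \<phi> i * w i) = 0" and i: "i \<in> {..<qdim \<phi>}"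
    have "\<forall>i\<in>{..<qdim \<phi>}. \<exists>u. w i = u^2" using w(1) by blast
    then obtain u where u: "\<And>i. i < qdim \<phi> \<Longrightarrow> w i = (u i)^2" by (metis lessThan_iff)
    let ?v = "\<lambda>i\<in>{..<qdim \<phi>}. \<tau> (u i)" let ?z = "\<lambda>i\<in>{..<qdim \<phi>}. \<tau> 0"
    have v: "?v \<in> {..<qdim \<phi>} \<rightarrow>\<^sub>E carrier F" "?z \<in> {..<qdim \<phi>} \<rightarrow>\<^sub>E carrier F"
      by (simp_all add: restrict_PiE_iff)
    have "\<sigma> (qmap \<phi> ?v) = (\<Sum>i<qdim \<phi>. cf \<phi> i * w i)"
      unfolding qform_value(2)[OF assms v(1)] using u by (intro sum.cong) auto
    also have "\<dots> = \<sigma> (qmap \<phi> ?z)"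
      unfolding qform_value(2)[OF assms v(2)] w(2) by simp
    finally have "qmap \<phi> ?v = qmap \<phi> ?z"
      using \<sigma>(9) qform_value(1)[OF assms v(1)] qform_value(1)[OF assms v(2)] by blast
    then have "?v = ?z" using inj v unfolding qspace_simps(1) inj_on_def by blast
    then have "\<tau> (u i) = \<tau> 0" using i by (metis restrict_apply')
    then have "u i = 0" by (metis \<tau>(2))
    then show "w i = 0" using u i by simp
  qed
  then show "anisotropic F \<phi>" using assms by (simp add: anisotropic_iff)
qed

text \<open>An anisotropic form embeds its space semilinearly into the field, so the set of values is a complete invariant.\<close>

lemma isomorphic_formsI:
  assumes a: "anisotropic F \<phi>" "anisotropic F \<psi>"
    and eq: "spn squares (cf \<phi>) {..<qdim \<phi>} = spn squares (cf \<psi>) {..<qdim \<psi>}"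
  shows "isomorphic_forms F \<phi> \<psi>"
proof -
  let ?V = "carrier (qspace F \<phi>)" let ?W = "carrier (qspace F \<psi>)"
  have q: "quasilinear_form F \<phi>" "quasilinear_form F \<psi>" using a by (simp_all add: anisotropic_def)
  have inj: "inj_on (qmap \<phi>) ?V" "inj_on (qmap \<psi>) ?W" using a q qmap_inj_iff by auto
  have cl: "qmap \<phi> v \<in> carrier F" if "v \<in> ?V" for v
    using qform_value(1)[OF q(1)] that unfolding qspace_simps(1) by blast
  have cl': "qmap \<psi> v \<in> carrier F" if "v \<in> ?W" for v
    using qform_value(1)[OF q(2)] that unfolding qspace_simps(1) by blast
  have vals: "qmap \<phi> ` ?V = qmap \<psi> ` ?W"
  proof (rule inj_on_image_eq_iff[THEN iffD1])
    show "inj_on \<sigma> (carrier F)" using \<sigma>_embeds by (simp add: embeds_def)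
    show "\<sigma> ` qmap \<phi> ` ?V = \<sigma> ` qmap \<psi> ` ?W" unfolding qform_values[OF q(1)] qform_values[OF q(2)] eq ..
  qed (use cl cl' in auto)
  define T where "T v = inv_into ?W (qmap \<psi>) (qmap \<phi> v)" for v
  have T: "T v \<in> ?W" "qmap \<psi> (T v) = qmap \<phi> v" if "v \<in> ?V" for v
  proof -
    have "qmap \<phi> v \<in> qmap \<psi> ` ?W" using that vals by blast
    then show "T v \<in> ?W" "qmap \<psi> (T v) = qmap \<phi> v"
      unfolding T_def by (rule inv_into_into, rule f_inv_into_f)
  qed
  interpret V: vectorspace F "qspace F \<phi>"
    by (rule vectorspace_qspace)
  interpret W: vectorspace F "qspace F \<psi>"
    by (rule vectorspace_qspace)
  have "T \<in> LinearCombinations.module_hom F (qspace F \<phi>) (qspace F \<psi>)"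
    unfolding LinearCombinations.module_hom_def mem_Collect_eq
  proof (intro conjI allI impI funcsetI T(1))
    fix v w assume vw: "v \<in> ?V \<and> w \<in> ?V"
    show "T (v \<oplus>\<^bsub>qspace F \<phi>\<^esub> w) = T v \<oplus>\<^bsub>qspace F \<psi>\<^esub> T w"
    proof (rule inj_onD[OF inj(2)])
      show "qmap \<psi> (T (v \<oplus>\<^bsub>qspace F \<phi>\<^esub> w)) = qmap \<psi> (T v \<oplus>\<^bsub>qspace F \<psi>\<^esub> T w)"
        using vw T V.M.add.m_closed quasilinear_add[OF q(1)] quasilinear_add[OF q(2)] by simp
    qed (use vw T V.M.add.m_closed W.M.add.m_closed in auto)
  next
    fix c v assume cv: "c \<in> carrier F \<and> v \<in> ?V"
    show "T (c \<odot>\<^bsub>qspace F \<phi>\<^esub> v) = c \<odot>\<^bsub>qspace F \<psi>\<^esub> T v"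
    proof (rule inj_onD[OF inj(2)])
      show "qmap \<psi> (T (c \<odot>\<^bsub>qspace F \<phi>\<^esub> v)) = qmap \<psi> (c \<odot>\<^bsub>qspace F \<psi>\<^esub> T v)"
        using cv T V.smult_closed quasilinear_smult[OF q(1)] quasilinear_smult[OF q(2)] by simp
    qed (use cv T V.smult_closed W.smult_closed in auto)
  qed
  then have "mod_hom F (qspace F \<phi>) (qspace F \<psi>) T"
    by (intro mod_hom.intro mod_hom_axioms.intro V.module_axioms W.module_axioms)
  then have "linear_map F (qspace F \<phi>) (qspace F \<psi>) T"
    by (intro linear_map.intro V.vectorspace_axioms W.vectorspace_axioms)
  moreover have "bij_betw T ?V ?W"
  proof (rule bij_betw_imageI)
    show "inj_on T ?V" by (rule inj_onI) (metis T(2) inj(1) inj_onD)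
    show "T ` ?V = ?W"
    proof (intro equalityI subsetI)
      fix w assume w: "w \<in> ?W"
      then have "qmap \<psi> w \<in> qmap \<phi> ` ?V" using vals by blast
      then obtain v where v: "v \<in> ?V" "qmap \<psi> w = qmap \<phi> v" by blast
      then have "w = T v" using inj_onD[OF inj(2), of w "T v"] T[OF v(1)] w by simp
      then show "w \<in> T ` ?V" using v by blast
    qed (use T in blast)
  qed
  ultimately show ?thesis unfolding isomorphic_forms_def using T(2) by blast
qed

lemma isomorphic_forms_values:
  assumes "isomorphic_forms F \<phi> \<psi>" "quasilinear_form F \<phi>" "quasilinear_form F \<psi>"
  shows "spn squares (cf \<phi>) {..<qdim \<phi>} = spn squares (cf \<psi>) {..<qdim \<psi>}"
    "anisotropic F \<phi> \<Longrightarrow> anisotropic F \<psi>"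
proof -
  let ?V = "carrier (qspace F \<phi>)" let ?W = "carrier (qspace F \<psi>)"
  obtain T where T: "bij_betw T ?V ?W" "\<And>v. v \<in> ?V \<Longrightarrow> qmap \<psi> (T v) = qmap \<phi> v"
    using assms(1) unfolding isomorphic_forms_def by blast
  have "qmap \<psi> ` ?W = qmap \<phi> ` ?V"
    unfolding bij_betw_imp_surj_on[OF T(1), symmetric] image_image using T(2) by (rule image_cong[OF refl])
  then show "spn squares (cf \<phi>) {..<qdim \<phi>} = spn squares (cf \<psi>) {..<qdim \<psi>}"
    using qform_values assms(2,3) by metis
  assume "anisotropic F \<phi>"
  then have inj: "inj_on (qmap \<phi>) ?V" using qmap_inj_iff assms(2) by blast
  have "inj_on (qmap \<psi>) ?W"
    unfolding bij_betw_imp_surj_on[OF T(1), symmetric]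
    using inj T(2) by (auto intro!: inj_onI dest: inj_onD)
  then show "anisotropic F \<psi>" using qmap_inj_iff assms(3) by blast
qed

lemma cf_orth_sum:
  assumes q: "quasilinear_form F \<phi>" "quasilinear_form F \<psi>"
  shows "quasilinear_form F (orth_sum F \<phi> \<psi>)"
    "i < qdim \<phi> + qdim \<psi> \<Longrightarrow> cf (orth_sum F \<phi> \<psi>) i = (if i < qdim \<phi> then cf \<phi> i else cf \<psi> (i - qdim \<phi>))"
proof -
  let ?\<chi> = "orth_sum F \<phi> \<psi>"
  let ?c = "\<lambda>i. if i < qdim \<phi> then cf \<phi> i else cf \<psi> (i - qdim \<phi>)"
  have dim: "qdim ?\<chi> = qdim \<phi> + qdim \<psi>" by (simp add: orth_sum_def)
  have "qmap ?\<chi> v \<in> carrier F" "\<sigma> (qmap ?\<chi> v) = (\<Sum>i<qdim ?\<chi>. ?c i * \<sigma> (v i)^2)"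
    if v: "v \<in> {..<qdim ?\<chi>} \<rightarrow>\<^sub>E carrier F" for v
  proof -
    let ?u = "\<lambda>i\<in>{..<qdim \<phi>}. v i" let ?w = "\<lambda>i\<in>{..<qdim \<psi>}. v (qdim \<phi> + i)"
    have u: "?u \<in> {..<qdim \<phi>} \<rightarrow>\<^sub>E carrier F" and w: "?w \<in> {..<qdim \<psi>} \<rightarrow>\<^sub>E carrier F"
      using PiE_mem[OF v] unfolding dim by (simp_all add: restrict_PiE_iff)
    note uv = qform_value[OF q(1) u] and wv = qform_value[OF q(2) w]
    have m: "qmap ?\<chi> v = qmap \<phi> ?u \<oplus>\<^bsub>F\<^esub> qmap \<psi> ?w" by (simp add: orth_sum_def)
    show "qmap ?\<chi> v \<in> carrier F" unfolding m using uv(1) wv(1) by (rule \<sigma>(5))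
    have "\<sigma> (qmap ?\<chi> v) = (\<Sum>i<qdim \<phi>. cf \<phi> i * \<sigma> (?u i)^2) + (\<Sum>i<qdim \<psi>. cf \<psi> i * \<sigma> (?w i)^2)"
      unfolding m \<sigma>(7)[OF uv(1) wv(1)] uv(2) wv(2) ..
    also have "(\<Sum>i<qdim \<phi>. cf \<phi> i * \<sigma> (?u i)^2) = (\<Sum>i<qdim \<phi>. ?c i * \<sigma> (v i)^2)"
      by (rule sum.cong) auto
    also have "(\<Sum>i<qdim \<psi>. cf \<psi> i * \<sigma> (?w i)^2) = (\<Sum>i<qdim \<psi>. ?c (qdim \<phi> + i) * \<sigma> (v (qdim \<phi> + i))^2)"
      by (rule sum.cong) auto
    also have "(\<Sum>i<qdim \<phi>. ?c i * \<sigma> (v i)^2) + \<dots> = (\<Sum>i<qdim ?\<chi>. ?c i * \<sigma> (v i)^2)"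
      unfolding dim by (rule sum_lessThan_add[symmetric])
    finally show "\<sigma> (qmap ?\<chi> v) = (\<Sum>i<qdim ?\<chi>. ?c i * \<sigma> (v i)^2)" .
  qed
  from quasilinear_formI[of ?\<chi> ?c, OF this]
  show "quasilinear_form F ?\<chi>" "i < qdim \<phi> + qdim \<psi> \<Longrightarrow> cf ?\<chi> i = ?c i" unfolding dim by auto
qed

lemma cf_scale_form:
  assumes q: "quasilinear_form F \<phi>" and c: "c \<in> carrier F"
  shows "quasilinear_form F (scale_form F c \<phi>)" "i < qdim \<phi> \<Longrightarrow> cf (scale_form F c \<phi>) i = \<sigma> c * cf \<phi> i"
proof -
  let ?\<chi> = "scale_form F c \<phi>"
  have dim: "qdim ?\<chi> = qdim \<phi>" by (simp add: scale_form_def)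
  have m: "qmap ?\<chi> v = c \<otimes>\<^bsub>F\<^esub> qmap \<phi> v" for v by (simp add: scale_form_def)
  have "qmap ?\<chi> v \<in> carrier F" "\<sigma> (qmap ?\<chi> v) = (\<Sum>i<qdim ?\<chi>. \<sigma> c * cf \<phi> i * \<sigma> (v i)^2)"
    if v: "v \<in> {..<qdim ?\<chi>} \<rightarrow>\<^sub>E carrier F" for v
  proof -
    note v' = qform_value[OF q v[unfolded dim]]
    show "qmap ?\<chi> v \<in> carrier F" unfolding m using c v'(1) by (rule \<sigma>(6))
    show "\<sigma> (qmap ?\<chi> v) = (\<Sum>i<qdim ?\<chi>. \<sigma> c * cf \<phi> i * \<sigma> (v i)^2)"
      unfolding m dim \<sigma>(8)[OF c v'(1)] v'(2) by (simp add: sum_distrib_left mult.assoc)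
  qed
  from quasilinear_formI[of ?\<chi> "\<lambda>i. \<sigma> c * cf \<phi> i", OF this]
  show "quasilinear_form F ?\<chi>" "i < qdim \<phi> \<Longrightarrow> cf ?\<chi> i = \<sigma> c * cf \<phi> i" unfolding dim by auto
qed

section \<open>Diagonal forms of families\<close>

definition fam_form :: "('i \<Rightarrow> 'a) \<Rightarrow> 'i list \<Rightarrow> 'u qform" where
  "fam_form f xs = diag_form F (map (\<lambda>x. \<tau> (f x)) xs)"

lemma fam_form_simps:
  "qdim (fam_form f xs) = length xs" "quasilinear_form F (fam_form f xs)"
  "i < length xs \<Longrightarrow> cf (fam_form f xs) i = f (xs ! i)"
proof -
  have "set (map (\<lambda>x. \<tau> (f x)) xs) \<subseteq> carrier F" by auto
  from diag_form_simps[OF this]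
  show "qdim (fam_form f xs) = length xs" "quasilinear_form F (fam_form f xs)"
    "i < length xs \<Longrightarrow> cf (fam_form f xs) i = f (xs ! i)"
    unfolding fam_form_def by auto
qed

end

section \<open>Spans and ranks of families given by lists\<close>

context subfield_set
begin

lemma spn_list:
  assumes "\<And>i. i < length xs \<Longrightarrow> \<beta> i = f (xs ! i)"
  shows "spn S \<beta> {..<length xs} = spn S f (set xs)"
proof (rule antisym)
  show "spn S \<beta> {..<length xs} \<subseteq> spn S f (set xs)"
    by (rule spn_subset) (auto simp: assms intro: spn_base)
  show "spn S f (set xs) \<subseteq> spn S \<beta> {..<length xs}"
  proof (rule spn_subset)
    fix x assume "x \<in> set xs"
    then obtain i where "i < length xs" "x = xs ! i" by (metis in_set_conv_nth)
    then show "f x \<in> spn S \<beta> {..<length xs}" using spn_base[of "{..<length xs}" i \<beta>] assms by simp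
  qed
qed

lemma rk_cong_spn:
  assumes "finite U" "finite V" "spn S \<beta> U = spn S \<gamma> V"
  shows "rk S \<beta> U = rk S \<gamma> V"
  using assms by (intro antisym rk_le_rk) (auto intro: spn_base)

lemma rk_list:
  assumes "\<And>i. i < length xs \<Longrightarrow> \<beta> i = f (xs ! i)"
  shows "rk S \<beta> {..<length xs} = rk S f (set xs)"
  by (rule rk_cong_spn) (use spn_list[of xs \<beta> f] assms in auto)

end

context field_model
begin

lemma fam_form_spn: "spn squares (cf (fam_form f xs)) {..<qdim (fam_form f xs)} = spn squares f (set xs)"
  unfolding fam_form_simps(1) by (rule sqs.spn_list) (rule fam_form_simps(3))

lemma fam_form_anisotropic:
  assumes "distinct xs" "indep squares f (set xs)"
  shows "anisotropic F (fam_form f xs)"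
proof -
  have "rk squares (cf (fam_form f xs)) {..<length xs} = rk squares f (set xs)"
    by (rule sqs.rk_list) (rule fam_form_simps(3))
  also have "\<dots> = card {..<length xs}"
    using assms by (simp add: sqs.rk_indep distinct_card)
  finally have "indep squares (cf (fam_form f xs)) {..<length xs}"
    by (intro sqs.indep_rk) auto
  then show ?thesis by (simp add: anisotropic_iff fam_form_simps)
qed

lemma fam_form_isotropy:
  assumes p: "anisotropic F p" "2 \<le> qdim p"
  shows "isotropy_index_over F p (fam_form f xs) = length xs - rk (qfrac p) (\<lambda>x. embc (f x)) (set xs)"
proof -
  interpret K: subfield_set "qfrac p" by (rule function_field_rank(1)[OF p])
  have "rk (qfrac p) (\<lambda>i. embc (cf (fam_form f xs) i)) {..<length xs} = rk (qfrac p) (\<lambda>x. embc (f x)) (set xs)"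
    by (rule K.rk_list) (simp add: fam_form_simps)
  then show ?thesis
    by (subst function_field_rank(2)[OF p fam_form_simps(2)]) (simp only: fam_form_simps(1))
qed

end

context subfield_set
begin

lemma spn_cong: "(\<And>i. i \<in> I \<Longrightarrow> \<beta> i = \<gamma> i) \<Longrightarrow> spn S \<beta> I = spn S \<gamma> I"
  unfolding spn_def by (simp cong: sum.cong)

lemma indep_not_spn:
  assumes "finite B" "j \<notin> B" "indep S \<beta> (insert j B)"
  shows "\<beta> j \<notin> spn S \<beta> B"
proof
  assume "\<beta> j \<in> spn S \<beta> B"
  then have "rk S \<beta> (insert j B) \<le> card B"
    by (intro rk_le[where \<gamma> = \<beta>]) (use assms(1) in \<open>auto intro: spn_base\<close>)
  then show False using rk_indep[OF _ assms(3)] assms(1,2) by simp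
qed

end

lemma embc_sum: "embc (sum f A) = (\<Sum>a\<in>A. embc (f a))"
  by (induction A rule: infinite_finite_induct) (simp_all add: embc_simps emb_simps)

lemma embc_mono: "embc (mono g a) = mono (\<lambda>i. embc (g i)) a"
proof -
  have "embc (\<Prod>i\<in>A. g i) = (\<Prod>i\<in>A. embc (g i))" for A
    by (induction A rule: infinite_finite_induct) (simp_all add: embc_simps emb_simps)
  then show ?thesis unfolding mono_def .
qed

lemma embc_power2: "embc (x^2) = (embc x)^2"
  by (simp only: power2_eq_square embc_simps)

section \<open>Passing from the base field to a function field\<close>

context field_model
begin

sublocale sqc: subfield_char2 "squares :: 'a set" ..

text \<open>This is the field generated over the squares by \<open>g 0, ..., g (m - 1)\<close>: all
  \<open>(g i)^2\<close> are squares, so the square-free products span it.\<close>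

lemma sq_subfield_spn_mono: "sq_subfield (spn squares (mono g) {..<2 ^ m} :: 'a set)"
  unfolding sq_subfield_def
proof (intro conjI allI ballI)
  show "x^2 \<in> spn squares (mono g) {..<2 ^ m}" for x :: 'a by (rule sqc.subset_spn_mono) simp
  fix x y :: 'a assume "x \<in> spn squares (mono g) {..<2 ^ m}" "y \<in> spn squares (mono g) {..<2 ^ m}"
  then show "x + y \<in> spn squares (mono g) {..<2 ^ m}" "x * y \<in> spn squares (mono g) {..<2 ^ m}"
    by (rule sqs.spn_add, intro sqc.spn_mono_mult) auto
qed

lemma subfield_qfrac: "anisotropic F p \<Longrightarrow> 2 \<le> qdim p \<Longrightarrow> subfield_char2 (qfrac p)"
  unfolding subfield_char2_def by (rule function_field_rank(1))

lemma embc_spn: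
  assumes p: "anisotropic F p" "2 \<le> qdim p" and x: "x \<in> spn squares f I"
  shows "embc x \<in> spn (qfrac p) (\<lambda>i. embc (f i)) I"
proof -
  interpret K: subfield_char2 "qfrac p" by (rule subfield_qfrac[OF p])
  obtain w where w: "\<And>i. i \<in> I \<Longrightarrow> w i \<in> squares" "x = (\<Sum>i\<in>I. f i * w i)" using sqs.spnE[OF x] by blast
  show ?thesis
  proof (rule K.spnI)
    show "embc x = (\<Sum>i\<in>I. embc (f i) * embc (w i))" unfolding w(2) embc_sum embc_simps ..
    show "embc (w i) \<in> qfrac p" if "i \<in> I" for i
      using w(1)[OF that] function_field_rank(3)[OF p] by (auto simp: embc_power2)
  qed
qed

lemma Izhboldin_dim_rk:
  assumes p: "anisotropic F p" "2 \<le> qdim p"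
  shows "Izhboldin_dim F p = rk (qfrac p) (\<lambda>i. embc (cf p i)) {..<qdim p}"
proof -
  interpret K: subfield_char2 "qfrac p" by (rule subfield_qfrac[OF p])
  have "quasilinear_form F p" using p(1) by (simp add: anisotropic_def)
  then show ?thesis
    unfolding Izhboldin_dim_def first_isotropy_index_def
    using function_field_rank(2)[OF p] K.rk_le_card[of "{..<qdim p}" "\<lambda>i. embc (cf p i)"] by simp
qed

text \<open>Each factor \<open>[1, a]\<close> appends a copy of the list multiplied by
  \<open>a\<close>, so \<open>a\<close> belongs to a new top bit. The first entry of
  \<open>as\<close> is adjoined last, which explains \<open>rev\<close>.\<close>

lemma Pfister_coeffs:
  assumes "set as \<subseteq> carrier F"
  shows "length (foldr (\<lambda>a. tensor_coeffs F [\<one>\<^bsub>F\<^esub>, a]) as [\<one>\<^bsub>F\<^esub>]) = 2 ^ length as \<and>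
    set (foldr (\<lambda>a. tensor_coeffs F [\<one>\<^bsub>F\<^esub>, a]) as [\<one>\<^bsub>F\<^esub>]) \<subseteq> carrier F \<and>
    (\<forall>k<2 ^ length as. \<sigma> (foldr (\<lambda>a. tensor_coeffs F [\<one>\<^bsub>F\<^esub>, a]) as [\<one>\<^bsub>F\<^esub>] ! k) =
       mono (\<lambda>j. \<sigma> (rev as ! j)) k)"
  using assms
proof (induction as)
  case Nil
  then show ?case by (simp add: \<sigma>(4))
next
  case (Cons a as)
  let ?L = "foldr (\<lambda>a. tensor_coeffs F [\<one>\<^bsub>F\<^esub>, a]) as [\<one>\<^bsub>F\<^esub>]"
  let ?g = "\<lambda>j. \<sigma> (rev (a # as) ! j)"
  have IH: "length ?L = 2 ^ length as" "set ?L \<subseteq> carrier F"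
    "\<And>k. k < 2 ^ length as \<Longrightarrow> \<sigma> (?L ! k) = mono (\<lambda>j. \<sigma> (rev as ! j)) k"
    using Cons by auto
  have a: "a \<in> carrier F" using Cons by simp
  have L: "foldr (\<lambda>a. tensor_coeffs F [\<one>\<^bsub>F\<^esub>, a]) (a # as) [\<one>\<^bsub>F\<^esub>] = map (\<lambda>b. \<one>\<^bsub>F\<^esub> \<otimes>\<^bsub>F\<^esub> b) ?L @ map (\<lambda>b. a \<otimes>\<^bsub>F\<^esub> b) ?L"
    by (simp add: tensor_coeffs_def)
  have g: "mono ?g k = mono (\<lambda>j. \<sigma> (rev as ! j)) k" if "k < 2 ^ length as" for k
    using that unfolding bits_lt by (intro mono_cong) (auto simp: nth_append)
  have ga: "?g (length as) = \<sigma> a" by (simp add: nth_append)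
  have mem: "?L ! k \<in> carrier F" if "k < 2 ^ length as" for k
    using that IH(1,2) by (metis nth_mem subsetD)
  have "\<sigma> ((map (\<lambda>b. \<one>\<^bsub>F\<^esub> \<otimes>\<^bsub>F\<^esub> b) ?L @ map (\<lambda>b. a \<otimes>\<^bsub>F\<^esub> b) ?L) ! k) = mono ?g k" if "k < 2 ^ length (a # as)" for k
  proof (cases "k < 2 ^ length as")
    case True
    then have "(map (\<lambda>b. \<one>\<^bsub>F\<^esub> \<otimes>\<^bsub>F\<^esub> b) ?L @ map (\<lambda>b. a \<otimes>\<^bsub>F\<^esub> b) ?L) ! k = ?L ! k"
      using IH(1) mem[OF True] by (simp add: nth_append)
    then show ?thesis using IH(3)[OF True] g[OF True] by (simp only:)
  next
    case False
    let ?k = "k - 2 ^ length as"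
    have k: "?k < 2 ^ length as" "k = 2 ^ length as + ?k" using False that by auto
    have "mono ?g k = \<sigma> a * mono ?g ?k" using mono_add_power2[OF k(1), of ?g] k(2) ga by simp
    also have "\<dots> = \<sigma> (a \<otimes>\<^bsub>F\<^esub> ?L ! ?k)" unfolding g[OF k(1)] using IH(3)[OF k(1)] \<sigma>(8)[OF a mem[OF k(1)]] by simp
    finally show ?thesis using False k(1) IH(1) by (simp add: nth_append)
  qed
  then show ?case unfolding L using IH(1,2) a by (auto simp: subset_iff)
qed

end

section \<open>The forms realizing a given isotropy index\<close>

text \<open>
  The form \<open>pf\<close> has the coefficients \<open>\<mu> a\<close>, \<open>a \<in> P0\<close>, and one further variable \<open>\<mu> (2 ^ M)\<close>,
  so that its function field is purely transcendental over the field without this variable.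
\<close>

locale monomial_form = field_model F \<sigma>
  for F :: "('u, 'm) ring_scheme" and \<sigma> :: "'u \<Rightarrow> 'a::{field,ring_char2}" +
  fixes t :: "nat \<Rightarrow> 'a" and P0 :: "nat set" and M :: nat
  assumes t_indep: "\<And>A. finite A \<Longrightarrow> indep squares (mono t) A"
    and P0: "P0 \<subseteq> {..<2 ^ M}" "P0 \<noteq> {}"
begin

abbreviation "\<mu> \<equiv> mono t"
abbreviation "e\<mu> \<equiv> \<lambda>a. embc (\<mu> a)"

definition "plist = sorted_list_of_set P0 @ [2 ^ M]"
definition "pf = fam_form \<mu> plist"

lemma finite_P0 [simp]: "finite P0"
  using P0(1) finite_subset by blast

lemma plist: "set plist = insert (2 ^ M) P0" "distinct plist" "length plist = Suc (card P0)"
  using P0(1) by (auto simp: plist_def)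

lemma list_coeffs:
  assumes "quasilinear_form F \<phi>" "qdim \<phi> = length xs" "distinct xs" "\<And>i. i < length xs \<Longrightarrow> cf \<phi> i = \<mu> (xs ! i)"
  shows "anisotropic F \<phi>" "spn squares (cf \<phi>) {..<qdim \<phi>} = spn squares \<mu> (set xs)"
proof -
  have "rk squares (cf \<phi>) {..<length xs} = rk squares \<mu> (set xs)"
    by (rule sqs.rk_list) (rule assms(4))
  also have "\<dots> = card {..<length xs}"
    using assms(3) t_indep by (simp add: sqs.rk_indep distinct_card)
  finally have "indep squares (cf \<phi>) {..<length xs}"
    by (intro sqs.indep_rk) auto
  then show "anisotropic F \<phi>" using assms(1,2) by (simp add: anisotropic_iff)
  show "spn squares (cf \<phi>) {..<qdim \<phi>} = spn squares \<mu> (set xs)"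
    unfolding assms(2) by (rule sqs.spn_list) (rule assms(4))
qed

lemma mu_nonzero: "\<mu> a \<noteq> 0"
proof
  assume "\<mu> a = 0"
  then have "\<mu> a \<in> spn squares \<mu> {}" by simp
  then show False using sqs.indep_not_spn[of "{}" a \<mu>] t_indep[of "{a}"] by simp
qed

lemma pf: "anisotropic F pf" "qdim pf = Suc (card P0)" "2 \<le> qdim pf"
proof -
  show "anisotropic F pf" unfolding pf_def
    by (rule fam_form_anisotropic[OF plist(2)]) (rule t_indep, simp)
  show dim: "qdim pf = Suc (card P0)" unfolding pf_def fam_form_simps(1) plist(3) ..
  have "card P0 > 0" using P0(2) by (simp add: card_gt_0_iff)
  then show "2 \<le> qdim pf" unfolding dim by simp
qed

lemma cf_pf: "i < card P0 \<Longrightarrow> cf pf i = \<mu> (sorted_list_of_set P0 ! i)" "cf pf (card P0) = \<mu> (2 ^ M)"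
  unfolding pf_def using plist(3) by (simp_all add: fam_form_simps(3)) (simp_all add: plist_def nth_append)

sublocale K: subfield_char2 "qfrac pf"
  by (rule subfield_qfrac[OF pf(1,3)])

text \<open>Let \<open>E\<close> be generated over the squares by
  \<open>t 0, ..., t (M - 1)\<close>. It contains \<open>\<mu> a\<close> for \<open>a\<close> in
  \<open>P0\<close> but not \<open>\<mu> (2 ^ M) = t M\<close>, hence not the ratio of the first to
  the last coefficient of \<open>pf\<close>.\<close>

lemma pf_indep: "indep (qfrac pf) e\<mu> {..<2 ^ M}"
proof (rule function_field_indep[OF pf(1,3), of "spn squares \<mu> {..<2 ^ M}" 0])
  let ?E = "spn squares \<mu> {..<2 ^ M}"
  show E: "sq_subfield ?E" by (rule sq_subfield_spn_mono)
  show "0 < qdim pf - 1" using pf(3) by simp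
  have c: "card P0 > 0" using P0(2) by (simp add: card_gt_0_iff)
  let ?a = "sorted_list_of_set P0 ! 0"
  have "?a \<in> P0" using c nth_mem[of 0 "sorted_list_of_set P0"] by simp
  then have a: "\<mu> ?a \<in> ?E" using P0(1) by (intro sqs.spn_base) auto
  have C: "\<mu> (2 ^ M) \<notin> ?E"
    using t_indep[of "insert (2 ^ M) {..<2 ^ M}"] by (intro sqs.indep_not_spn) auto
  show "cf pf 0 / cf pf (qdim pf - 1) \<notin> ?E"
  proof
    assume "cf pf 0 / cf pf (qdim pf - 1) \<in> ?E"
    then have "\<mu> ?a / \<mu> (2 ^ M) \<in> ?E" using cf_pf c by (simp add: pf(2))
    from sq_subfield_divide[OF E a this] have "\<mu> (2 ^ M) \<in> ?E" using mu_nonzero[of ?a] by simp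
    then show False using C by blast
  qed
  show "\<mu> i \<in> ?E" if "i \<in> {..<2 ^ M}" for i using that by (intro sqs.spn_base) auto
qed (auto intro: t_indep)

text \<open>The generic zero is a relation between the coefficients of \<open>pf\<close> whose last
  multiplier is nonzero, so it can be solved for the last coefficient.\<close>

lemma pf_span: "e\<mu> (2 ^ M) \<in> spn (qfrac pf) e\<mu> P0"
proof -
  obtain x where x: "\<And>i. i < qdim pf \<Longrightarrow> x i \<in> qfrac pf" "\<And>i. i < qdim pf \<Longrightarrow> x i \<noteq> 0"
    "(\<Sum>i<qdim pf. embc (cf pf i) * x i) = 0"
    using function_field_generic_zero[OF pf(1,3)] by blast
  let ?d = "card P0" let ?y = "\<Sum>i<?d. embc (cf pf i) * x i"
  have "?y + e\<mu> (2 ^ M) * x ?d = 0" using x(3) by (simp add: pf(2) cf_pf(2))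
  then have "e\<mu> (2 ^ M) * x ?d = ?y" by (simp add: add_eq_0_char2)
  then have "e\<mu> (2 ^ M) = ?y * inverse (x ?d)" using x(2)[of ?d] by (simp add: pf(2) field_simps)
  also have "\<dots> \<in> spn (qfrac pf) e\<mu> P0"
  proof (intro K.spn_mult K.spn_sum K.closed(5))
    show "x ?d \<in> qfrac pf" using x(1)[of ?d] by (simp add: pf(2))
    fix i assume i: "i \<in> {..<?d}"
    then have "sorted_list_of_set P0 ! i \<in> P0" using nth_mem[of i "sorted_list_of_set P0"] by simp
    then show "embc (cf pf i) \<in> spn (qfrac pf) e\<mu> P0" 
      using i K.spn_base[of P0 "sorted_list_of_set P0 ! i" e\<mu>] by (simp add: cf_pf(1))
    show "x i \<in> qfrac pf" using i x(1) by (simp add: pf(2))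
  qed
  finally show ?thesis .
qed

text \<open>Multiplying the relation for \<open>\<mu> (2 ^ M)\<close> by \<open>\<mu> e\<close>
  moves its support from \<open>P0\<close> to the XORs of \<open>e\<close> with \<open>P0\<close>;
  the squares that arise lie in the function field's copy.\<close>

lemma pf_translate:
  assumes "e < 2 ^ M" "finite X'" "\<And>b. b \<in> P0 \<Longrightarrow> e XOR b \<in> X'"
  shows "e\<mu> (2 ^ M + e) \<in> spn (qfrac pf) e\<mu> X'"
proof -
  obtain w where w: "\<And>i. i \<in> P0 \<Longrightarrow> w i \<in> qfrac pf" "e\<mu> (2 ^ M) = (\<Sum>i\<in>P0. e\<mu> i * w i)"
    using K.spnE[OF pf_span] by blast
  have "e\<mu> (2 ^ M + e) = e\<mu> (2 ^ M) * e\<mu> e"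
    by (simp only: mono_add_power2[OF assms(1)] embc_simps mono_power2)
  also have "\<dots> = (\<Sum>b\<in>P0. e\<mu> (e XOR b) * ((e\<mu> (e AND b))^2 * w b))"
    unfolding w(2) sum_distrib_right
  proof (rule sum.cong)
    fix b assume "b \<in> P0"
    have "e\<mu> e * e\<mu> b = e\<mu> (e XOR b) * (e\<mu> (e AND b))^2"
      using arg_cong[OF mono_mult[of t e b], of embc] by (simp only: embc_simps embc_power2)
    then show "e\<mu> b * w b * e\<mu> e = e\<mu> (e XOR b) * ((e\<mu> (e AND b))^2 * w b)"
      by (metis (no_types, opaque_lifting) mult.assoc mult.commute)
  qed simp
  also have "\<dots> \<in> spn (qfrac pf) e\<mu> X'"
    using assms(2,3) w(1) function_field_rank(3)[OF pf(1,3)]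
    by (intro K.spn_sum K.spn_mult K.spn_base K.closed(4)) auto
  finally show ?thesis .
qed

lemma Izhboldin_pf: "Izhboldin_dim F pf = card P0"
proof -
  have "Izhboldin_dim F pf = rk (qfrac pf) (\<lambda>i. embc (cf pf i)) {..<length plist}"
    unfolding Izhboldin_dim_rk[OF pf(1,3)] pf(2) plist(3) ..
  also have "\<dots> = rk (qfrac pf) e\<mu> (set plist)"
    by (rule K.rk_list) (simp add: pf_def fam_form_simps)
  also have "\<dots> = card P0"
    unfolding plist(1)
  proof (rule antisym)
    show "rk (qfrac pf) e\<mu> (insert (2 ^ M) P0) \<le> card P0"
      by (rule K.rk_le[where \<gamma> = e\<mu>]) (auto intro: pf_span K.spn_base)
    have "indep (qfrac pf) e\<mu> P0" using K.indep_subset[OF _ pf_indep] P0(1) by blast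
    then have "card P0 = rk (qfrac pf) e\<mu> P0" by (simp add: K.rk_indep)
    also have "\<dots> \<le> rk (qfrac pf) e\<mu> (insert (2 ^ M) P0)" by (rule K.rk_mono) auto
    finally show "card P0 \<le> rk (qfrac pf) e\<mu> (insert (2 ^ M) P0)" .
  qed
  finally show ?thesis .
qed

text \<open>With \<open>k + 2 * i\<close> coefficients, index \<open>i\<close> means rank
  \<open>k + i\<close>. Two sets of that size bracket this rank: one made of \<open>X'\<close>, the
  shifted \<open>A\<close> and padding, where the shifted part adds nothing to the span, and the
  interval \<open>{..<k + 2 * i}\<close>. An intermediate set attains the rank exactly.\<close>

theorem isotropy_realized:
  assumes A: "A \<subseteq> {..<2 ^ M}" "card A = i" and X': "X' \<subseteq> {..<2 ^ M}" "card X' \<le> i + k"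
    and AX: "\<And>e b. e \<in> A \<Longrightarrow> b \<in> P0 \<Longrightarrow> e XOR b \<in> X'" and M: "k + i \<le> 2 ^ M"
  shows "\<exists>q. anisotropic F q \<and> qdim q = k + 2 * i \<and> isotropy_index_over F pf q = i"
proof -
  let ?n = "k + 2 * i"
  have fin: "finite A" "finite X'" using A(1) X'(1) finite_subset by blast+
  let ?T = "X' \<union> (\<lambda>e. 2 ^ M + e) ` A"
  have "card ?T = card X' + card ((\<lambda>e. 2 ^ M + e) ` A)"
    using X'(1) fin by (intro card_Un_disjoint) auto
  then have cT: "card ?T = card X' + i" using A(2) by (simp add: card_image)
  \<comment> \<open>Padding up to size \<open>k + 2 * i\<close>. Whatever it is, the rank stays at
    most \<open>card X' + card Y = k + i\<close>.\<close>
  obtain Y where Y: "finite Y" "card Y = ?n - card ?T" "Y \<subseteq> - ?T"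
    using infinite_arbitrarily_large[of "- ?T" "?n - card ?T"] fin by (auto simp: Compl_eq_Diff_UNIV)
  let ?T0 = "?T \<union> Y"
  have c0: "card ?T0 = ?n"
    using Y fin cT X'(2) by (subst card_Un_disjoint) auto
  have "rk (qfrac pf) e\<mu> ?T0 \<le> card (X' \<union> Y)"
  proof (rule K.rk_le[where \<gamma> = e\<mu>])
    fix j assume "j \<in> ?T0"
    then consider "j \<in> X' \<union> Y" | e where "e \<in> A" "j = 2 ^ M + e" by blast
    then show "e\<mu> j \<in> spn (qfrac pf) e\<mu> (X' \<union> Y)"
    proof cases
      case 2
      show ?thesis unfolding 2(2)
        by (rule pf_translate) (use 2(1) A(1) AX fin Y in auto)
    qed (use fin Y in \<open>auto intro: K.spn_base\<close>)
  qed (use fin Y in auto)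
  also have "\<dots> \<le> card X' + card Y" by (rule card_Un_le)
  also have "\<dots> \<le> k + i" using Y(2) cT X'(2) by simp
  finally have r0: "rk (qfrac pf) e\<mu> ?T0 \<le> k + i" .
  \<comment> \<open>Here \<open>M\<close> has to be large: monomials with index below
    \<open>2 ^ M\<close> stay independent over the function field.\<close>
  have "indep (qfrac pf) e\<mu> {..<k + i}" using K.indep_subset[OF _ pf_indep, of "{..<k + i}"] M by auto
  then have "k + i = rk (qfrac pf) e\<mu> {..<k + i}" by (simp add: K.rk_indep)
  also have "\<dots> \<le> rk (qfrac pf) e\<mu> {..<?n}" by (rule K.rk_mono) auto
  finally have r1: "k + i \<le> rk (qfrac pf) e\<mu> {..<?n}" .
  obtain T where T: "T \<subseteq> ?T0 \<union> {..<?n}" "card T = ?n" "rk (qfrac pf) e\<mu> T = k + i"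
    using K.rk_intermediate[OF _ _ _ r0 r1] fin Y c0 by auto
  have finT: "finite T" using T(1) fin Y finite_subset by (metis finite_Un finite_imageI finite_lessThan)
  let ?xs = "sorted_list_of_set T"
  have "anisotropic F (fam_form \<mu> ?xs)" by (rule fam_form_anisotropic) (use finT t_indep in auto)
  moreover have "qdim (fam_form \<mu> ?xs) = ?n" using T(2) by (simp add: fam_form_simps)
  moreover have "isotropy_index_over F pf (fam_form \<mu> ?xs) = i"
    unfolding fam_form_isotropy[OF pf(1,3)] using T finT by simp
  ultimately show ?thesis by blast
qed

end

section \<open>Quasi-Pfister neighbours\<close>

lemma indep_cong: "(\<And>i. i \<in> I \<Longrightarrow> \<beta> i = \<gamma> i) \<Longrightarrow> indep S \<beta> I \<longleftrightarrow> indep S \<gamma> I"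
  unfolding indep_def by (simp cong: sum.cong)

context field_model
begin

definition Pfister :: "'u list \<Rightarrow> 'u qform" where
  "Pfister as = diag_form F (foldr (\<lambda>a. tensor_coeffs F [\<one>\<^bsub>F\<^esub>, a]) as [\<one>\<^bsub>F\<^esub>])"

lemma Pfister:
  assumes "set as \<subseteq> carrier F"
  shows "qdim (Pfister as) = 2 ^ length as" "quasilinear_form F (Pfister as)"
    "i < 2 ^ length as \<Longrightarrow> cf (Pfister as) i = mono (\<lambda>j. \<sigma> (rev as ! j)) i"
  using Pfister_coeffs[OF assms] diag_form_simps unfolding Pfister_def by auto

lemma quasi_Pfister_Pfister:
  assumes "set as \<subseteq> carrier F" "anisotropic F (Pfister as)"
  shows "quasi_Pfister F (Pfister as)"
  unfolding quasi_Pfister_def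
  using assms Pfister(2)[OF assms(1)] isomorphic_formsI[OF assms(2,2)] unfolding Pfister_def by blast

text \<open>The generic zero is a dependence between the monomials in the slots of the Pfister form,
  and a dependence at least halves their rank.\<close>

lemma Izhboldin_dim_Pfister_le:
  assumes as: "set as \<subseteq> carrier F" and an: "anisotropic F (Pfister as)" and dim: "2 \<le> qdim (Pfister as)"
  shows "2 * Izhboldin_dim F (Pfister as) \<le> 2 ^ length as"
proof -
  let ?\<pi> = "Pfister as" let ?g = "\<lambda>j. embc (\<sigma> (rev as ! j))" let ?n = "2 ^ length as :: nat"
  interpret K: subfield_char2 "qfrac ?\<pi>" by (rule subfield_qfrac[OF an dim])
  note P = Pfister[OF as]
  have cf: "embc (cf ?\<pi> i) = mono ?g i" if "i < ?n" for i
    using P(3)[OF that] by (simp only: embc_mono)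
  obtain x where x: "\<And>i. i < qdim ?\<pi> \<Longrightarrow> x i \<in> qfrac ?\<pi>" "\<And>i. i < qdim ?\<pi> \<Longrightarrow> x i \<noteq> 0"
    "(\<Sum>i<qdim ?\<pi>. embc (cf ?\<pi> i) * x i) = 0"
    using function_field_generic_zero[OF an dim] by blast
  have "(\<Sum>i<?n. mono ?g i * x i) = 0"
    using x(3) unfolding P(1) by (simp add: cf)
  then have dep: "\<not> indep (qfrac ?\<pi>) (mono ?g) {..<?n}"
    using x(1) x(2)[of 0] unfolding P(1) indep_def
    by (auto intro!: exI[of _ x] bexI[of _ 0])
  have "2 * rk (qfrac ?\<pi>) (mono ?g) {..<?n} \<le> ?n"
    using dep function_field_rank(3)[OF an dim] by (intro K.rk_mono_dependent) auto
  moreover have "rk (qfrac ?\<pi>) (\<lambda>i. embc (cf ?\<pi> i)) {..<?n} = rk (qfrac ?\<pi>) (mono ?g) {..<?n}"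
    by (intro K.rk_cong_spn K.spn_cong) (auto simp: cf)
  ultimately show ?thesis unfolding Izhboldin_dim_rk[OF an dim] P(1) by simp
qed

text \<open>Half of the monomials stay independent over the function field.\<close>

lemma Izhboldin_dim_ge:
  assumes an: "anisotropic F \<pi>" and dim: "2 \<le> qdim \<pi>"
    and g: "indep squares (mono g) {..<2 ^ Suc m}"
    and val: "spn squares (cf \<pi>) {..<qdim \<pi>} = spn squares (mono g) {..<2 ^ Suc m}"
  shows "2 ^ m \<le> Izhboldin_dim F \<pi>"
proof -
  let ?E = "spn squares (mono g) {..<2 ^ m}" and ?E' = "spn squares (mono g) {..<2 ^ Suc m}"
  let ?c = "cf \<pi> (qdim \<pi> - 1)"
  interpret K: subfield_char2 "qfrac \<pi>" by (rule subfield_qfrac[OF an dim])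
  have E: "sq_subfield ?E" by (rule sq_subfield_spn_mono)
  have c: "?c \<noteq> 0" using quadric.bN[OF quadric_cf[OF an dim]] .
  have gE: "g m \<in> ?E'" "g m \<notin> ?E"
  proof -
    have "insert (2 ^ m) {..<2 ^ m :: nat} \<subseteq> {..<2 ^ Suc m}" by auto
    then have "indep squares (mono g) (insert (2 ^ m) {..<2 ^ m})"
      using sqs.indep_subset[OF _ g] by blast
    then have "mono g (2 ^ m) \<notin> ?E" by (intro sqs.indep_not_spn) auto
    then show "g m \<notin> ?E" by simp
    have "mono g (2 ^ m) \<in> ?E'" by (rule sqs.spn_base) auto
    then show "g m \<in> ?E'" by simp
  qed
  \<comment> \<open>If all ratios were in \<open>?E\<close>, so would be \<open>x / ?c\<close> for
    every value \<open>x\<close> of the form; the values 1 and \<open>g m\<close> would then give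
    \<open>g m \<in> ?E\<close>.\<close>
  have "\<exists>i0<qdim \<pi> - 1. cf \<pi> i0 / ?c \<notin> ?E"
  proof (rule ccontr)
    assume no: "\<not> (\<exists>i0<qdim \<pi> - 1. cf \<pi> i0 / ?c \<notin> ?E)"
    have cE: "cf \<pi> i / ?c \<in> ?E" if "i < qdim \<pi>" for i
    proof (cases "i = qdim \<pi> - 1")
      case True
      then show ?thesis using c sq_subfieldD(5)[OF E] by simp
    qed (use no that in auto)
    have xE: "x / ?c \<in> ?E" if "x \<in> ?E'" for x
    proof -
      obtain w where w: "\<And>i. i \<in> {..<qdim \<pi>} \<Longrightarrow> w i \<in> squares" "x = (\<Sum>i<qdim \<pi>. cf \<pi> i * w i)"
        using sqs.spnE[OF \<open>x \<in> ?E'\<close>[folded val]] by blast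
      have "x / ?c = (\<Sum>i<qdim \<pi>. cf \<pi> i / ?c * w i)" unfolding w(2) by (simp add: sum_divide_distrib)
      also have "\<dots> \<in> ?E" using w(1) cE by (intro sqs.spn_sum sqs.spn_mult) auto
      finally show ?thesis .
    qed
    have "1 / ?c \<in> ?E" by (rule xE) (rule sqc.one_spn_mono)
    from sq_subfield_divide[OF E xE[OF gE(1)] this] have "g m \<in> ?E" using c by simp
    then show False using gE(2) by blast
  qed
  then obtain i0 where i0: "i0 < qdim \<pi> - 1" "cf \<pi> i0 / ?c \<notin> ?E" by blast
  have "indep squares (mono g) {..<2 ^ m}" using sqs.indep_subset[OF _ g] by auto
  then have "indep (qfrac \<pi>) (\<lambda>i. embc (mono g i)) {..<2 ^ m}"
    by (intro function_field_indep[OF an dim E i0]) (auto intro: sqs.spn_base)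
  moreover have "embc (mono g i) \<in> spn (qfrac \<pi>) (\<lambda>i. embc (cf \<pi> i)) {..<qdim \<pi>}" if "i \<in> {..<2 ^ m}" for i
  proof (rule embc_spn[OF an dim])
    have "i \<in> {..<2 ^ Suc m}" using that by simp
    then show "mono g i \<in> spn squares (cf \<pi>) {..<qdim \<pi>}"
      unfolding val by (intro sqs.spn_base) auto
  qed
  ultimately have "card {..<2 ^ m :: nat} \<le> rk (qfrac \<pi>) (\<lambda>i. embc (cf \<pi> i)) {..<qdim \<pi>}"
    by (intro K.rk_ge[where \<gamma> = "\<lambda>i. embc (mono g i)"]) auto
  then show ?thesis unfolding Izhboldin_dim_rk[OF an dim] by simp
qed

end

context monomial_form
begin

text \<open>The Pfister form with slots \<open>t 0, ..., t (s - 1), t M\<close> has the coefficients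
  \<open>\<mu> k\<close> and \<open>\<mu> (2 ^ M + k)\<close> for \<open>k < 2 ^ s\<close>. It
  contains \<open>pf\<close>, whose dimension \<open>2 ^ s + 1\<close> is just above half.\<close>

lemma quasi_Pfister_neighbour_pf:
  assumes P0_eq: "P0 = {..<2 ^ s}"
  shows "quasi_Pfister_neighbour F pf"
proof -
  \<comment> \<open>Read backwards, the list assigns \<open>t j\<close> to bit \<open>j < s\<close>
    and \<open>t M\<close> to bit \<open>s\<close>.\<close>
  define as where "as = map (\<lambda>i. \<tau> (t i)) (M # rev [0..<s])"
  have as: "set as \<subseteq> carrier F" "length as = Suc s" by (auto simp: as_def)
  let ?\<pi> = "Pfister as" let ?g = "\<lambda>j. \<sigma> (rev as ! j)"
  note P = Pfister[OF as(1), unfolded as(2)]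
  have sM: "2 ^ s \<le> (2::nat) ^ M" using P0 unfolding P0_eq by (auto simp: lessThan_subset_iff)
  have g: "?g j = (if j < s then t j else t M)" if "j < Suc s" for j
    using that by (auto simp: as_def rev_map nth_append)
  \<comment> \<open>The monomial at position \<open>k\<close> of the Pfister form: bit
    \<open>s\<close> of \<open>k\<close> is moved to bit \<open>M\<close>.\<close>
  define h where "h k = (if k < 2 ^ s then k else 2 ^ M + (k - 2 ^ s))" for k :: nat
  have low: "mono ?g k = \<mu> k" if "k < 2 ^ s" for k
  proof (rule mono_cong)
    fix i assume "i \<in> bits k"
    then have "i < s" using that unfolding bits_lt by auto
    then show "?g i = t i" using g[of i] by simp
  qed
  have cf: "cf ?\<pi> k = \<mu> (h k)" if k: "k < 2 ^ Suc s" for k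
  proof (cases "k < 2 ^ s")
    case True
    then show ?thesis using P(3)[OF k] low by (simp add: h_def)
  next
    case False
    let ?k = "k - 2 ^ s"
    have k': "?k < 2 ^ s" "k = 2 ^ s + ?k" using k False by auto
    have "cf ?\<pi> k = ?g s * mono ?g ?k" using P(3)[OF k] mono_add_power2[OF k'(1), of ?g] k'(2) by simp
    also have "\<dots> = \<mu> (2 ^ M + ?k)"
      using g[of s] low[OF k'(1)] mono_add_power2[of ?k M t] k'(1) sM by simp
    finally show ?thesis using False by (simp add: h_def)
  qed
  let ?zs = "map h [0..<2 ^ Suc s]"
  have inj_h: "inj_on h {0..<2 ^ Suc s}"
  proof -
    obtain D where "(2::nat) ^ M = 2 ^ s + D" using sM le_Suc_ex by blast
    then show ?thesis by (auto simp: inj_on_def h_def split: if_splits)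
  qed
  have zs: "distinct ?zs" using inj_h by (simp add: distinct_map)
  have img: "h ` {0..<2 ^ Suc s} = {..<2 ^ s} \<union> (\<lambda>k. 2 ^ M + k) ` {..<2 ^ s :: nat}"
  proof (intro equalityI subsetI)
    fix y :: nat assume "y \<in> {..<2 ^ s} \<union> (\<lambda>k. 2 ^ M + k) ` {..<2 ^ s}"
    then consider "y < 2 ^ s" | k where "k < 2 ^ s" "y = 2 ^ M + k" by auto
    then show "y \<in> h ` {0..<2 ^ Suc s}"
    proof cases
      case 1
      then show ?thesis by (intro image_eqI[of _ _ y]) (auto simp: h_def)
    next
      case 2
      then show ?thesis by (intro image_eqI[of _ _ "2 ^ s + k"]) (auto simp: h_def)
    qed
  next
    fix y assume "y \<in> h ` {0..<2 ^ Suc s}"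
    then obtain k where k: "k < 2 ^ Suc s" "y = h k" by auto
    show "y \<in> {..<2 ^ s} \<union> (\<lambda>k. 2 ^ M + k) ` {..<2 ^ s}"
    proof (cases "k < 2 ^ s")
      case False
      then have "y = 2 ^ M + (k - 2 ^ s)" "k - 2 ^ s < 2 ^ s" using k by (auto simp: h_def)
      then show ?thesis by blast
    qed (use k in \<open>simp add: h_def\<close>)
  qed
  have \<pi>: "anisotropic F ?\<pi>" "spn squares (cf ?\<pi>) {..<qdim ?\<pi>} = spn squares \<mu> (set ?zs)"
    by (rule list_coeffs[OF P(2) _ zs]; use P(1) cf in simp)+
  have dim2: "2 \<le> qdim ?\<pi>" unfolding P(1) by simp
  \<comment> \<open>The complement of \<open>pf\<close>. It starts at 1 because \<open>2 ^ M\<close>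
    itself is already the last coefficient of \<open>pf\<close>.\<close>
  let ?ys = "map (\<lambda>k. 2 ^ M + k) [1..<2 ^ s]"
  let ?o = "orth_sum F pf (fam_form \<mu> ?ys)"
  have qpf: "quasilinear_form F pf" using pf(1) by (simp add: anisotropic_def)
  have dims: "qdim pf = length plist" "qdim (fam_form \<mu> ?ys) = length ?ys"
    by (simp_all add: pf_def fam_form_simps)
  have dim_o: "qdim ?o = length (plist @ ?ys)" using dims by (simp add: orth_sum_def)
  have dist: "distinct (plist @ ?ys)"
    using plist(1,2) P0(1) by (auto simp: distinct_map inj_on_def)
  have cfo: "cf ?o i = \<mu> ((plist @ ?ys) ! i)" if i: "i < length (plist @ ?ys)" for i
  proof -
    have "cf ?o i = (if i < qdim pf then cf pf i else cf (fam_form \<mu> ?ys) (i - qdim pf))"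
      by (rule cf_orth_sum(2)[OF qpf fam_form_simps(2)]) (use i dims in \<open>simp only: length_append\<close>)
    also have "\<dots> = (if i < length plist then \<mu> (plist ! i) else \<mu> (?ys ! (i - length plist)))"
    proof (cases "i < length plist")
      case True
      then show ?thesis unfolding dims(1) by (simp add: pf_def fam_form_simps(3))
    next
      case False
      then have "i - length plist < length ?ys" using i unfolding length_append by linarith
      then show ?thesis using False unfolding dims(1) by (simp only: if_False fam_form_simps(3))
    qed
    finally show ?thesis unfolding nth_append by (simp only: if_distrib)
  qed
  note o = list_coeffs[OF cf_orth_sum(1)[OF qpf fam_form_simps(2)] dim_o dist cfo]
  have "set ?zs = set (plist @ ?ys)"
  proof -
    have "(\<lambda>k. 2 ^ M + k) ` {..<2 ^ s} = insert (2 ^ M) ((\<lambda>k. 2 ^ M + k) ` {1..<2 ^ s :: nat})"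
    proof -
      have "{..<2 ^ s} = insert 0 {1..<2 ^ s :: nat}" by auto
      then show ?thesis by simp
    qed
    then show ?thesis using plist(1) P0_eq img by (simp del: upt_Suc)
  qed
  then have "spn squares \<mu> (set ?zs) = spn squares \<mu> (set (plist @ ?ys))" by (rule arg_cong)
  then have "isomorphic_forms F ?\<pi> ?o"
    by (intro isomorphic_formsI \<pi>(1) o(1) trans[OF \<pi>(2)] trans[OF _ o(2)[symmetric]])
  then have sub: "subform F pf ?\<pi>" unfolding subform_def using qpf fam_form_simps(2) by blast
  have sim: "similar_forms F pf pf" unfolding similar_forms_def
  proof (intro bexI[of _ "\<one>\<^bsub>F\<^esub>"])
    note s = cf_scale_form[OF qpf \<sigma>(2), unfolded \<sigma>(4)]
    have sd: "qdim (scale_form F \<one>\<^bsub>F\<^esub> pf) = qdim pf" by (simp add: scale_form_def)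
    have eq: "cf (scale_form F \<one>\<^bsub>F\<^esub> pf) i = cf pf i" if "i < qdim pf" for i using s(2)[OF that] by simp
    show "isomorphic_forms F pf (scale_form F \<one>\<^bsub>F\<^esub> pf)"
    proof (rule isomorphic_formsI[OF pf(1)])
      show "anisotropic F (scale_form F \<one>\<^bsub>F\<^esub> pf)"
        using pf(1) s(1) indep_cong[of "{..<qdim pf}" "cf (scale_form F \<one>\<^bsub>F\<^esub> pf)" "cf pf"] eq
        unfolding anisotropic_iff sd by simp
      show "spn squares (cf pf) {..<qdim pf} = spn squares (cf (scale_form F \<one>\<^bsub>F\<^esub> pf)) {..<qdim (scale_form F \<one>\<^bsub>F\<^esub> pf)}"
        unfolding sd by (rule sqs.spn_cong) (simp add: eq)
    qed
  qed (use F.one_closed F.one_not_zero in simp)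
  have "Izhboldin_dim F ?\<pi> < qdim pf"
  proof -
    have "card P0 = 2 ^ s" using P0_eq by simp
    then show ?thesis
      using Izhboldin_dim_Pfister_le[OF as(1) \<pi>(1) dim2] by (simp add: as(2) pf(2))
  qed
  then show ?thesis unfolding quasi_Pfister_neighbour_def
    using pf(1,3) quasi_Pfister_Pfister[OF as(1) \<pi>(1)] \<pi>(1) dim2 sub sim by blast
qed

text \<open>
  A quasi-Pfister form of which \<open>pf\<close> is a neighbour would contain all products of the coefficients
  of \<open>pf\<close> up to squares, so that its dimension would be at least \<open>2 ^ (s + 2)\<close>.
\<close>

lemma not_quasi_Pfister_neighbour_pf:
  assumes card: "card P0 = 2 ^ s" and zero: "0 \<in> P0" and pow: "\<And>i. i \<le> s \<Longrightarrow> 2 ^ i \<in> P0"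
  shows "\<not> quasi_Pfister_neighbour F pf"
proof
  assume "quasi_Pfister_neighbour F pf"
  then obtain \<pi> \<psi> where \<pi>: "quasi_Pfister F \<pi>" "anisotropic F \<pi>" "2 \<le> qdim \<pi>"
    and sub: "subform F \<psi> \<pi>" and sim: "similar_forms F pf \<psi>" and izh: "Izhboldin_dim F \<pi> < qdim pf"
    unfolding quasi_Pfister_neighbour_def by blast
  have q\<pi>: "quasilinear_form F \<pi>" using \<pi>(2) by (simp add: anisotropic_def)
  obtain as where as: "set as \<subseteq> carrier F" and iso: "isomorphic_forms F \<pi> (Pfister as)"
    using \<pi>(1) unfolding quasi_Pfister_def Pfister_def by blast
  let ?m = "length as" let ?g = "\<lambda>j. \<sigma> (rev as ! j)"
  let ?E = "spn squares (mono ?g) {..<2 ^ ?m}"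
  note P = Pfister[OF as]
  have spnP: "spn squares (cf (Pfister as)) {..<qdim (Pfister as)} = ?E"
    unfolding P(1) by (rule sqs.spn_cong) (simp add: P(3))
  have spn\<pi>: "spn squares (cf \<pi>) {..<qdim \<pi>} = ?E"
    using isomorphic_forms_values(1)[OF iso q\<pi> P(2)] spnP by simp
  have "anisotropic F (Pfister as)" using isomorphic_forms_values(2)[OF iso q\<pi> P(2) \<pi>(2)] .
  then have g_indep: "indep squares (mono ?g) {..<2 ^ ?m}"
    unfolding anisotropic_iff P(1) using indep_cong[of "{..<2 ^ ?m}" "cf (Pfister as)" "mono ?g"] P(3) by simp
  have E: "sq_subfield ?E" by (rule sq_subfield_spn_mono)
  obtain \<chi> where \<chi>: "quasilinear_form F \<psi>" "quasilinear_form F \<chi>" "isomorphic_forms F \<pi> (orth_sum F \<psi> \<chi>)"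
    using sub unfolding subform_def by blast
  note os = cf_orth_sum[OF \<chi>(1,2)]
  have dim_o: "qdim (orth_sum F \<psi> \<chi>) = qdim \<psi> + qdim \<chi>" by (simp add: orth_sum_def)
  have \<psi>E: "cf \<psi> i \<in> ?E" if "i < qdim \<psi>" for i
  proof -
    have "cf (orth_sum F \<psi> \<chi>) i \<in> spn squares (cf (orth_sum F \<psi> \<chi>)) {..<qdim (orth_sum F \<psi> \<chi>)}"
      using that by (intro sqs.spn_base) (auto simp: dim_o)
    then show ?thesis
      using isomorphic_forms_values(1)[OF \<chi>(3) q\<pi> os(1)] spn\<pi> os(2)[of i] that by simp
  qed
  obtain c where c: "c \<in> carrier F" "c \<noteq> \<zero>\<^bsub>F\<^esub>" "isomorphic_forms F pf (scale_form F c \<psi>)"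
    using sim unfolding similar_forms_def by blast
  note sc = cf_scale_form[OF \<chi>(1) c(1)]
  have qpf: "quasilinear_form F pf" using pf(1) by (simp add: anisotropic_def)
  have sd: "qdim (scale_form F c \<psi>) = qdim \<psi>" by (simp add: scale_form_def)
  have pf_vals: "spn squares (cf pf) {..<qdim pf} = spn squares \<mu> (set plist)"
    unfolding pf_def by (rule fam_form_spn)
  have c0: "\<sigma> c \<noteq> 0" using \<sigma>(10)[OF c(1)] c(2) by blast
  have scaled: "x / \<sigma> c \<in> ?E" if "x \<in> spn squares \<mu> (set plist)" for x
  proof -
    have x: "x \<in> spn squares (cf (scale_form F c \<psi>)) {..<qdim \<psi>}"
      using isomorphic_forms_values(1)[OF c(3) qpf sc(1)] that unfolding pf_vals sd by blast
    obtain w where w: "\<And>i. i \<in> {..<qdim \<psi>} \<Longrightarrow> w i \<in> squares"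
      "x = (\<Sum>i<qdim \<psi>. cf (scale_form F c \<psi>) i * w i)" using sqs.spnE[OF x] by blast
    have "x / \<sigma> c = (\<Sum>i<qdim \<psi>. cf \<psi> i * w i)"
      unfolding w(2) sum_divide_distrib using c0 by (intro sum.cong) (simp_all add: sc(2))
    also have "\<dots> \<in> ?E" using w(1) \<psi>E by (intro sqs.spn_sum sqs.spn_mult) auto
    finally show ?thesis .
  qed
  have mem: "\<mu> a / \<sigma> c \<in> ?E" if "a \<in> set plist" for a
    using that by (intro scaled sqs.spn_base) auto
  \<comment> \<open>\<open>0 \<in> P0\<close> makes 1 a coefficient of \<open>pf\<close>, and
    dividing by its multiple removes the unknown similarity factor.\<close>
  have "1 / \<sigma> c \<in> ?E" using mem[of 0] zero by (simp add: plist(1))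
  then have \<mu>E: "\<mu> a \<in> ?E" if "a \<in> set plist" for a
    using sq_subfield_divide[OF E mem[OF that]] c0 by fastforce
  have tE: "t i \<in> ?E" if "i \<le> s \<or> i = M" for i
    using that \<mu>E[of "2 ^ i"] pow by (auto simp: plist(1))
  have monoE: "\<mu> k \<in> ?E" if "bits k \<subseteq> insert M {..<Suc s}" for k
  proof -
    have "(\<Prod>i\<in>B. t i) \<in> ?E" if "B \<subseteq> insert M {..<Suc s}" for B
      using finite_subset[OF that] that
    proof (induction B rule: infinite_finite_induct)
      case (insert b B)
      then show ?case using tE[of b] by (auto intro!: sq_subfieldD(3)[OF E])
    qed (auto intro: sq_subfieldD(5)[OF E])
    then show ?thesis using that unfolding mono_def by blast
  qed
  \<comment> \<open>As \<open>2 ^ s\<close> lies below \<open>2 ^ M\<close>, the generator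
    \<open>t M\<close> differs from \<open>t 0, ..., t s\<close>. Together these are
    \<open>s + 2\<close> independent generators inside \<open>?E\<close>.\<close>
  have "2 ^ s \<in> P0" using pow by simp
  then have "(2::nat) ^ s < 2 ^ M" using P0(1) by auto
  then have sM: "Suc s \<le> M" by (simp add: Suc_le_eq)
  then have sM2: "(2::nat) ^ Suc s \<le> 2 ^ M" by (rule power_increasing) simp
  let ?J = "{..<2 ^ Suc s} \<union> (\<lambda>k. 2 ^ M + k) ` {..<2 ^ Suc s :: nat}"
  have "card ?J = card {..<2 ^ Suc s :: nat} + card ((\<lambda>k. 2 ^ M + k) ` {..<2 ^ Suc s :: nat})"
    using sM2 by (intro card_Un_disjoint) auto
  then have cardJ: "card ?J = 2 ^ Suc (Suc s)" by (simp add: card_image)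
  have "card ?J \<le> card {..<2 ^ ?m :: nat}"
  proof (rule sqs.steinitz[where \<gamma> = \<mu> and \<beta> = "mono ?g"])
    fix k assume "k \<in> ?J"
    then consider "k < 2 ^ Suc s" | l where "l < 2 ^ Suc s" "k = 2 ^ M + l" by auto
    then have "bits k \<subseteq> insert M {..<Suc s}"
    proof cases
      case 1
      then show ?thesis using bits_lt[of k "Suc s"] by blast
    next
      case 2
      then have "bits k \<subseteq> insert M (bits l)"
        using xor_add[of l M] sM2 bits_xor[of "2 ^ M" l] by auto
      then show ?thesis using 2 bits_lt[of l "Suc s"] by blast
    qed
    then show "\<mu> k \<in> ?E" by (rule monoE)
  qed (use t_indep in auto)
  then have "(2::nat) ^ Suc (Suc s) \<le> 2 ^ ?m" unfolding cardJ by simp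
  then have "Suc (Suc s) \<le> ?m" by (rule power_le_imp_le_exp[rotated]) simp
  then obtain m where m: "?m = Suc m" "Suc s \<le> m" by (cases ?m) auto
  \<comment> \<open>The contradiction is \<open>2 ^ (s + 1) \<le> 2 ^ m \<le> Izhboldin_dim F \<pi>
    < 2 ^ s + 1\<close>.\<close>
  have "2 ^ m \<le> Izhboldin_dim F \<pi>"
    using Izhboldin_dim_ge[OF \<pi>(2,3), of ?g m] g_indep spn\<pi> unfolding m(1) by blast
  moreover have "(2::nat) ^ Suc s \<le> 2 ^ m" using m(2) by (rule power_increasing) simp
  moreover have "(1::nat) \<le> 2 ^ s" by simp
  ultimately show False using izh card unfolding pf(2) power_Suc by linarith
qed

end

section \<open>Realizing integers\<close>

text \<open>The two criteria on neighbours are attached as implications because the existential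
  hides \<open>p\<close>; this leaves finite combinatorics of \<open>P0\<close>, \<open>A\<close>
  and \<open>C\<close> as all that has to be supplied.\<close>

lemma realizing_triple_exists:
  fixes P0 A C :: "nat set"
  assumes P0: "finite P0" "card P0 = d" and d: "2 ^ s \<le> d" "d < 2 ^ (s + 1)"
    and A: "finite A" "card A = i" and C: "finite C" "card C \<le> i + k"
    and AC: "\<And>e b. e \<in> A \<Longrightarrow> b \<in> P0 \<Longrightarrow> e XOR b \<in> C"
  shows "\<exists>(F :: 'u::infinite ring) p q. realizing_triple F p q s k d (int k + 2 * int i) \<and>
    (P0 = {..<2 ^ s} \<longrightarrow> quasi_Pfister_neighbour F p) \<and>
    (d = 2 ^ s \<and> 0 \<in> P0 \<and> (\<forall>j\<le>s. 2 ^ j \<in> P0) \<longrightarrow> \<not> quasi_Pfister_neighbour F p)"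
proof -
  \<comment> \<open>\<open>2 ^ M\<close> must exceed all indices in use, and \<open>k + i\<close>
    for the independent comparison family.\<close>
  obtain M where M: "insert (k + i) (P0 \<union> A \<union> C) \<subseteq> {..<2 ^ M}"
  proof -
    have "finite (insert (k + i) (P0 \<union> A \<union> C))" using P0 A C by simp
    then obtain b where "\<forall>x\<in>insert (k + i) (P0 \<union> A \<union> C). x \<le> b"
      unfolding finite_nat_set_iff_bounded_le by blast
    then have "insert (k + i) (P0 \<union> A \<union> C) \<subseteq> {..<2 ^ b}"
      using le_less_trans[OF _ less_exp[of b]] by auto
    then show ?thesis using that by blast
  qed
  obtain F :: "'u ring" and \<sigma> :: "'u \<Rightarrow> base" where model: "field_model F \<sigma>"
    using base_field_model .
  interpret m: field_model F \<sigma> by (rule model)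
  have "P0 \<noteq> {}" using P0 d(1) by auto
  then interpret m: monomial_form F \<sigma> base_var P0 M
    using M by unfold_locales (auto intro: indep_mono_base)
  obtain q where q: "anisotropic F q" "qdim q = k + 2 * i" "isotropy_index_over F m.pf q = i"
    using m.isotropy_realized[of A i C k] A C AC M by auto
  have "\<sigma> (\<one>\<^bsub>F\<^esub> \<oplus>\<^bsub>F\<^esub> \<one>\<^bsub>F\<^esub>) = \<sigma> \<zero>\<^bsub>F\<^esub>" by (simp add: m.\<sigma>(2,3,4,7))
  then have "\<one>\<^bsub>F\<^esub> \<oplus>\<^bsub>F\<^esub> \<one>\<^bsub>F\<^esub> = \<zero>\<^bsub>F\<^esub>" using m.\<sigma>(9) m.\<sigma>(1,2,5) by blast
  then have "realizing_triple F m.pf q s k d (int k + 2 * int i)"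
    unfolding realizing_triple_def using m.F_field m.pf m.Izhboldin_pf P0(2) d q by simp
  moreover have "P0 = {..<2 ^ s} \<longrightarrow> quasi_Pfister_neighbour F m.pf"
    using m.quasi_Pfister_neighbour_pf by blast
  moreover have "d = 2 ^ s \<and> 0 \<in> P0 \<and> (\<forall>j\<le>s. 2 ^ j \<in> P0) \<longrightarrow> \<not> quasi_Pfister_neighbour F m.pf"
    using m.not_quasi_Pfister_neighbour_pf P0(2) by blast
  ultimately show ?thesis by blast
qed

lemma candidatesI: "1 \<le> i \<Longrightarrow> int k + 2 * int i \<in> candidates k"
  unfolding candidates_def by blast

section \<open>XOR on blocks of length a power of two\<close>

lemma xor_div: "(a XOR b) div 2 ^ r = (a div 2 ^ r) XOR (b div 2 ^ r)" for a b :: nat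
  by (simp flip: drop_bit_eq_div)

text \<open>XOR is addition without carries; the induction strips the lowest bit.\<close>

lemma xor_le_add: "a XOR b \<le> a + b" for a b :: nat
proof (induction a arbitrary: b rule: less_induct)
  case (less a)
  show ?case
  proof (cases "a = 0")
    case False
    then have "(a div 2) XOR (b div 2) \<le> a div 2 + b div 2" by (intro less) simp
    moreover have "a XOR b = of_bool (odd a \<noteq> odd b) + 2 * ((a div 2) XOR (b div 2))"
      by (rule xor_rec)
    ultimately show ?thesis by (cases "odd a"; cases "odd b") (auto elim!: oddE evenE)
  qed simp
qed

text \<open>XOR acts on the numbers of blocks of length \<open>2 ^ r\<close>. These are at most
  \<open>x - 1\<close> for \<open>a\<close> and \<open>y\<close> for \<open>b\<close>, so at most
  \<open>x + y - 1\<close> for the XOR: the number of blocks available to \<open>b\<close> is one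
  more than what is added.\<close>

lemma xor_block_lt:
  assumes "a < x * 2 ^ r" "b < (y + 1) * 2 ^ r"
  shows "a XOR b < (x + y) * (2::nat) ^ r"
proof -
  have "a div 2 ^ r < x" "b div 2 ^ r < y + 1"
    using assms by (simp_all add: less_mult_imp_div_less)
  then have "(a XOR b) div 2 ^ r < x + y"
    using xor_le_add[of "a div 2 ^ r" "b div 2 ^ r"] unfolding xor_div by linarith
  then show ?thesis by (simp add: div_less_iff_less_mult)
qed

text \<open>All three sets are initial intervals: \<open>P0 = {..<d}\<close> lies in
  \<open>y + 1\<close> blocks of length \<open>2 ^ r\<close> and \<open>A = {..<i}\<close> in
  \<open>x\<close> blocks, so \<open>x + y\<close> blocks hold all XORs. For
  \<open>d = 2 ^ s\<close> this \<open>P0\<close> is the one of a neighbour.\<close>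

lemma realizable_interval:
  assumes d: "2 ^ s \<le> d" "d < 2 ^ (s + 1)" and "d \<le> (y + 1) * 2 ^ r"
    and i: "1 \<le> i" "i \<le> x * 2 ^ r" "(x + y) * 2 ^ r \<le> i + k"
  shows "realizable TYPE('u::infinite) s k d (int k + 2 * int i)"
    "d = 2 ^ s \<Longrightarrow> realizable_neighbour TYPE('u) s k d (int k + 2 * int i)"
proof -
  have "e XOR b \<in> {..<(x + y) * 2 ^ r}" if "e \<in> {..<i}" "b \<in> {..<d}" for e b
    using that i assms(3) by (auto intro!: xor_block_lt)
  then have "\<exists>(F :: 'u ring) p q. realizing_triple F p q s k d (int k + 2 * int i) \<and>
    ({..<d} = {..<2 ^ s} \<longrightarrow> quasi_Pfister_neighbour F p) \<and>
    (d = 2 ^ s \<and> 0 \<in> {..<d} \<and> (\<forall>j\<le>s. 2 ^ j \<in> {..<d}) \<longrightarrow> \<not> quasi_Pfister_neighbour F p)"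
    using d i(3) by (intro realizing_triple_exists[of _ d s "{..<i}" i "{..<(x + y) * 2 ^ r}"]) auto
  then show "realizable TYPE('u::infinite) s k d (int k + 2 * int i)"
    "d = 2 ^ s \<Longrightarrow> realizable_neighbour TYPE('u) s k d (int k + 2 * int i)"
    unfolding realizable_def realizable_neighbour_def using candidatesI[OF i(1)] by blast+
qed

lemma realizable_non_neighbourI:
  fixes P0 A C :: "nat set"
  assumes P0: "finite P0" "card P0 = 2 ^ s" "0 \<in> P0" "\<And>j. j \<le> s \<Longrightarrow> 2 ^ j \<in> P0"
    and A: "finite A" "card A = i" "1 \<le> i" and C: "finite C" "card C \<le> i + k"
    and AC: "\<And>e b. e \<in> A \<Longrightarrow> b \<in> P0 \<Longrightarrow> e XOR b \<in> C"
  shows "realizable_non_neighbour TYPE('u::infinite) s k (2 ^ s) (int k + 2 * int i)"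
proof -
  have "\<exists>(F :: 'u ring) p q. realizing_triple F p q s k (2 ^ s) (int k + 2 * int i) \<and>
    (P0 = {..<2 ^ s} \<longrightarrow> quasi_Pfister_neighbour F p) \<and>
    ((2::nat) ^ s = 2 ^ s \<and> 0 \<in> P0 \<and> (\<forall>j\<le>s. 2 ^ j \<in> P0) \<longrightarrow> \<not> quasi_Pfister_neighbour F p)"
    by (rule realizing_triple_exists[OF P0(1,2) _ _ A(1,2) C AC]) auto
  then show ?thesis
    unfolding realizable_non_neighbour_def using candidatesI[OF A(3)] P0(3,4) by blast
qed

text \<open>To defeat the neighbour property, the last element of \<open>{..<2 ^ s}\<close> is
  replaced by \<open>2 ^ s\<close>. For \<open>s \<ge> 2\<close> that element is no power of two, so
  none is lost, and the bound on XORs by sums costs just the room that \<open>k \<ge> 2 ^ s\<close>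
  provides.\<close>

lemma realizable_non_neighbour_large:
  assumes s: "2 \<le> s" and k: "2 ^ s \<le> k" and i: "1 \<le> i"
  shows "realizable_non_neighbour TYPE('u::infinite) s k (2 ^ s) (int k + 2 * int i)"
proof -
  let ?P = "insert (2 ^ s) {..<2 ^ s - 1 :: nat}"
  obtain s' where s': "s = Suc (Suc s')" using s by (metis Suc_le_D numeral_2_eq_2 Suc_le_mono)
  have pow: "(2::nat) ^ j < 2 ^ s - 1" if "j < s" for j
  proof -
    have "(2::nat) ^ j \<le> 2 ^ Suc s'" using that s' by (intro power_increasing) auto
    moreover have "(1::nat) \<le> 2 ^ s'" by simp
    ultimately show ?thesis unfolding s' power_Suc by linarith
  qed
  show ?thesis
  proof (rule realizable_non_neighbourI[of ?P _ "{..<i}" i "{..<2 ^ s + i}"])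
    show "card ?P = 2 ^ s" by simp
    show "0 \<in> ?P" using pow[of 0] s' by simp
    show "2 ^ j \<in> ?P" if "j \<le> s" for j using pow[of j] that by (cases "j = s") auto
    show "e XOR b \<in> {..<2 ^ s + i}" if "e \<in> {..<i}" "b \<in> ?P" for e b
      using xor_le_add[of e b] that by auto
  qed (use k i in auto)
qed

text \<open>\<open>{..<2 ^ s}\<close> consists of the blocks 0 to 3 of length \<open>q\<close>.
  Exchanging block 3 for block 4 gains \<open>2 ^ s\<close>, keeps the smaller powers of two, and
  leaves the set invariant under XOR with numbers below \<open>q\<close>. Longer blocks would not
  do: two blocks of length \<open>2 ^ (s - 1)\<close> cannot hold 0, \<open>2 ^ (s - 1)\<close> and
  \<open>2 ^ s\<close>.\<close>

lemma block_set:
  assumes q: "q = 2 ^ (s - 2)" and s: "2 \<le> s"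
  defines "P \<equiv> {b::nat. b div q \<in> {0, 1, 2, 4}}"
  shows "P = {..<3 * q} \<union> {4 * q..<5 * q}" "card P = 2 ^ s" "0 \<in> P" "\<And>j. j \<le> s \<Longrightarrow> 2 ^ j \<in> P"
proof -
  obtain s' where s': "s = Suc (Suc s')" using s by (metis Suc_le_D numeral_2_eq_2 Suc_le_mono)
  have q': "q = 2 ^ s'" and q0: "q > 0" and s4: "2 ^ s = 4 * q" by (simp_all add: q s')
  have dq: "b div q = c \<longleftrightarrow> c * q \<le> b \<and> b < (c + 1) * q" for b c
    using q0 by (metis Suc_eq_plus1 div_less_iff_less_mult less_Suc_eq_le less_eq_div_iff_mult_less_eq order_antisym_conv order_refl)
  show eq: "P = {..<3 * q} \<union> {4 * q..<5 * q}"
    unfolding P_def insert_iff empty_iff dq by auto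
  have "card P = card {..<3 * q} + card {4 * q..<5 * q}"
    unfolding eq by (rule card_Un_disjoint) auto
  then show "card P = 2 ^ s" by (simp add: s4)
  show "0 \<in> P" by (simp add: P_def)
  fix j assume "j \<le> s"
  then consider "j \<le> Suc s'" | "j = s" unfolding s' by linarith
  then show "2 ^ j \<in> P"
  proof cases
    case 1
    then have "(2::nat) ^ j \<le> 2 * q" using power_increasing[of j "Suc s'" "2::nat"] by (simp add: q')
    then show ?thesis unfolding eq using q0 by simp
  next
    case 2
    then show ?thesis unfolding eq using q0 s4 by simp
  qed
qed

text \<open>\<open>P\<close> lies below \<open>2 ^ (s + 1)\<close>, so XOR with it preserves the
  blocks 1 to \<open>a\<close> of that length, which \<open>A\<close> and \<open>C\<close> share.
  The rest of \<open>A\<close> is \<open>{..<h}\<close>, which maps \<open>P\<close> into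
  \<open>P\<close>. The excess of \<open>C\<close> over \<open>A\<close> is at most
  \<open>2 ^ s - h \<le> k\<close>.\<close>

lemma realizable_non_neighbour_plus:
  assumes s: "2 \<le> s" and h: "1 \<le> h" "h \<le> 2 ^ (s - 2)" "2 ^ s \<le> h + k"
  shows "realizable_non_neighbour TYPE('u::infinite) s k (2 ^ s) (int k + 2 * int (a * 2 ^ (s + 1) + h))"
proof -
  define q :: nat where "q = 2 ^ (s - 2)"
  define P where "P = {b::nat. b div q \<in> {0, 1, 2, 4}}"
  note P = block_set[OF q_def s, folded P_def]
  obtain s' where s': "s = Suc (Suc s')" using s by (metis Suc_le_D numeral_2_eq_2 Suc_le_mono)
  have q0: "q > 0" and s4: "2 ^ s = 4 * q" by (simp_all add: q_def s')
  let ?B = "2 ^ (s + 1) :: nat"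
  let ?U = "{?B..<(a + 1) * ?B}"
  have B: "?B = 8 * q" using s4 by simp
  show ?thesis
  proof (rule realizable_non_neighbourI[OF _ P(2-4), of "{..<h} \<union> ?U" _ "P \<union> ?U"])
    show "finite P" unfolding P(1) by simp
    have "{..<h} \<inter> ?U = {}" using h(2) B q0 unfolding q_def by auto
    then show "card ({..<h} \<union> ?U) = a * 2 ^ (s + 1) + h" by (simp add: card_Un_disjoint)
    have "card (P \<union> ?U) \<le> card P + card ?U" by (rule card_Un_le)
    then show "card (P \<union> ?U) \<le> a * 2 ^ (s + 1) + h + k" using P(2) h(3) by simp
    show "1 \<le> a * 2 ^ (s + 1) + h" using h(1) by simp
    fix e b assume e: "e \<in> {..<h} \<union> ?U" and b: "b \<in> P"
    show "e XOR b \<in> P \<union> ?U"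
    proof (cases "e < h")
      case True
      then have "e div q = 0" using h(2) q_def by simp
      then have "(e XOR b) div q = b div q" unfolding q_def xor_div by simp
      then show ?thesis using b by (simp add: P_def)
    next
      case False
      have "b < ?B" using b unfolding P(1) B by auto
      then have "(e XOR b) div ?B = e div ?B" unfolding xor_div by simp
      moreover have "1 \<le> e div ?B" "e div ?B < a + 1"
        using False e by (auto simp: less_eq_div_iff_mult_less_eq div_less_iff_less_mult)
      ultimately have "1 \<le> (e XOR b) div ?B" "(e XOR b) div ?B < a + 1" by (simp_all only:)
      then have "1 * ?B \<le> e XOR b" "e XOR b < (a + 1) * ?B"
        by (simp_all only: less_eq_div_iff_mult_less_eq div_less_iff_less_mult zero_less_power pos2)
      then show ?thesis by simp
    qed
  qed (auto simp: P(1))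
qed

text \<open>\<open>A\<close> is chosen outside \<open>P\<close>, so \<open>e\<close> and
  \<open>b\<close> lie in different blocks of length \<open>q\<close> and their XOR never falls into
  block 0. Hence \<open>C\<close> can omit \<open>{..<q}\<close>, and \<open>h \<le> q\<close> makes
  it small enough.\<close>

lemma realizable_non_neighbour_minus:
  assumes s: "2 \<le> s" and h: "h \<le> 2 ^ (s - 2)" "2 ^ s \<le> h + k" and k: "k < 2 ^ s" and a: "1 \<le> a"
    and i: "i + k + h = a * 2 ^ (s + 1)"
  shows "realizable_non_neighbour TYPE('u::infinite) s k (2 ^ s) (int k + 2 * int i)"
proof -
  define q :: nat where "q = 2 ^ (s - 2)"
  define P where "P = {b::nat. b div q \<in> {0, 1, 2, 4}}"
  note P = block_set[OF q_def s, folded P_def]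
  obtain s' where s': "s = Suc (Suc s')" using s by (metis Suc_le_D numeral_2_eq_2 Suc_le_mono)
  have q0: "q > 0" and s4: "2 ^ s = 4 * q" by (simp_all add: q_def s')
  let ?B = "2 ^ (s + 1) :: nat"
  have B: "?B = 8 * q" using s4 by simp
  have aB: "?B \<le> a * ?B" using a by simp
  let ?D = "{..<a * ?B} - P"
  have "P \<subseteq> {..<?B}" using q0 unfolding P(1) B by auto
  then have PB: "P \<subseteq> {..<a * ?B}" using aB by (meson lessThan_subset_iff subset_trans)
  \<comment> \<open>There is room for \<open>A\<close>: \<open>i = a * ?B - (k + h)\<close> and
    \<open>k + h \<ge> 2 ^ s\<close>.\<close>
  have "card ?D = a * ?B - 2 ^ s" using PB P(2) by (subst card_Diff_subset) (auto simp: P(1))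
  then have "i \<le> card ?D" using i h(2) by linarith
  then obtain A where A: "A \<subseteq> ?D" "card A = i" "finite A" using obtain_subset_with_card_n by metis
  show ?thesis
  proof (rule realizable_non_neighbourI[OF _ P(2-4) A(3,2), of "{q..<a * ?B}"])
    show "1 \<le> i" using i aB k h(1) s4 B unfolding q_def[symmetric] by linarith
    show "card {q..<a * ?B} \<le> i + k" using i h(1) unfolding q_def by simp
    fix e b assume e: "e \<in> A" and b: "b \<in> P"
    have e': "e < a * ?B" "e div q \<notin> {0, 1, 2, 4}" using e A(1) by (auto simp: P_def)
    have bB: "b < (0 + 1) * 2 ^ (s + 1)" using b B unfolding P(1) by auto
    have "e XOR b < (a + 0) * ?B" by (rule xor_block_lt[OF e'(1) bB])
    moreover have "q \<le> e XOR b"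
    proof (rule ccontr)
      assume "\<not> q \<le> e XOR b"
      then have "(e XOR b) div q = 0" by simp
      then have "(e div q) XOR (b div q) = 0" unfolding q_def xor_div .
      then have "e div q = b div q" by (metis xor_self_eq xor.left_neutral xor.assoc xor.right_neutral)
      then show False using e'(2) b by (simp add: P_def)
    qed
    ultimately show "e XOR b \<in> {q..<a * ?B}" by simp
  qed (auto simp: P(1))
qed

text \<open>\<open>y * 2 ^ r < d\<close> means \<open>y * 2 ^ r \<le> d - 1\<close>, whence the
  division of \<open>d - 1\<close>. So \<open>y_index d r\<close> is the number of the last block
  that \<open>{..<d}\<close> meets.\<close>

lemma y_index_eq: "0 < d \<Longrightarrow> y_index d r = int ((d - 1) div 2 ^ r)"
  unfolding y_index_def
proof (rule Greatest_equality)
  assume d: "0 < d"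
  have "(d - 1) div 2 ^ r * 2 ^ r \<le> d - 1" by (rule div_times_less_eq_dividend)
  then have "(d - 1) div 2 ^ r * 2 ^ r < d" using d by linarith
  then show "int ((d - 1) div 2 ^ r) * 2 ^ r < int d" by (metis of_nat_less_iff of_nat_mult of_nat_numeral of_nat_power)
  fix y :: int assume y: "y * 2 ^ r < int d"
  show "y \<le> int ((d - 1) div 2 ^ r)"
  proof (cases "y \<le> 0")
    case False
    then obtain n where n: "y = int n" by (metis linorder_not_le less_imp_le zero_le_imp_eq_int)
    then have "int (n * 2 ^ r) < int d" using y by simp
    then have "n * 2 ^ r \<le> d - 1" by (simp only: of_nat_less_iff)
    then show ?thesis unfolding n by (simp add: less_eq_div_iff_mult_less_eq)
  qed simp
qed

text \<open>\<open>P0\<close> fits into a single block of length \<open>2 ^ R\<close>, so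
  \<open>C\<close> can be the \<open>a\<close> blocks that contain \<open>A\<close>. The index is
  \<open>a * 2 ^ R + h\<close> with \<open>- k \<le> h \<le> 0\<close>.\<close>

lemma realizable_near_multiple:
  assumes d: "2 ^ s \<le> d" "d < 2 ^ (s + 1)" "d \<le> 2 ^ R" and k: "k < d" and a: "1 \<le> a"
    and \<epsilon>: "\<epsilon> = int k + 2 * h" "\<epsilon> \<in> {- int k..int k}"
  shows "realizable TYPE('u::infinite) s k d (int a * 2 ^ (R + 1) + \<epsilon>)"
    "d = 2 ^ s \<Longrightarrow> realizable_neighbour TYPE('u) s k d (int a * 2 ^ (R + 1) + \<epsilon>)"
proof -
  define m where "m = a * 2 ^ R"
  define i where "i = nat (int m + h)"
  have m: "2 ^ R \<le> m" using a by (simp add: m_def)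
  have h: "- int k \<le> h" "h \<le> 0" using \<epsilon> by auto
  have i: "int i = int m + h" using h m k d(3) by (simp add: i_def)
  have eq: "int a * 2 ^ (R + 1) + \<epsilon> = int k + 2 * int i"
    unfolding i \<epsilon>(1) by (simp add: m_def)
  have d': "d \<le> (0 + 1) * 2 ^ R" using d(3) by simp
  have "1 \<le> i" "i \<le> m" "m \<le> i + k" using d(3) i h m k by linarith+
  then have "1 \<le> i" "i \<le> a * 2 ^ R" "(a + 0) * 2 ^ R \<le> i + k" by (simp_all add: m_def)
  from realizable_interval[OF d(1,2) d' this]
  show "realizable TYPE('u::infinite) s k d (int a * 2 ^ (R + 1) + \<epsilon>)"
    "d = 2 ^ s \<Longrightarrow> realizable_neighbour TYPE('u) s k d (int a * 2 ^ (R + 1) + \<epsilon>)"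
    unfolding eq by auto
qed

text \<open>The bounds on \<open>\<epsilon>\<close> say that \<open>{..<h}\<close> fits into
  \<open>x\<close> blocks of length \<open>2 ^ r\<close> and that \<open>x + y\<close> blocks have
  at most \<open>h + k\<close> elements. A multiple of \<open>2 ^ (s + 1)\<close> adds the same
  number of blocks on both sides.\<close>

lemma realizable_between_multiples:
  assumes d: "2 ^ s \<le> d" "d < 2 ^ (s + 1)" and r: "r \<le> s" and x: "0 < x"
    and y: "y = (d - 1) div 2 ^ r" and k: "y * 2 ^ r \<le> k" "k < d"
    and \<epsilon>: "\<epsilon> = int k + 2 * h" "\<epsilon> \<in> {(int x + int y) * 2 ^ (r + 1) - int k..int x * 2 ^ (r + 1) + int k}"
  shows "realizable TYPE('u::infinite) s k d (int a * 2 ^ (s + 2) + \<epsilon>)"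
proof -
  define m where "m = x * 2 ^ r"
  define n where "n = y * 2 ^ r"
  define i where "i = nat (int (a * 2 ^ (s + 1)) + h)"
  have dy: "d \<le> (y + 1) * 2 ^ r"
  proof -
    have "d - 1 < (y + 1) * 2 ^ r" unfolding y by (metis Suc_eq_plus1 dividend_less_times_div mult.commute mult_Suc_right pos2 zero_less_power)
    then show ?thesis by linarith
  qed
  have h: "int m + int n \<le> int k + h" "h \<le> int m"
    using \<epsilon> unfolding m_def n_def by (auto simp: algebra_simps)
  have "2 ^ r \<le> m" unfolding m_def using x by simp
  moreover have "d \<le> n + 2 ^ r" using dy unfolding n_def by (simp add: add_mult_distrib)
  \<comment> \<open>Indeed \<open>k + h \<ge> (x + y) * 2 ^ r \<ge> (y + 1) * 2 ^ r \<ge> d >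
    k\<close>.\<close>
  ultimately have hpos: "1 \<le> h" using h(1) k(2) by linarith
  have i: "int i = int (a * 2 ^ (s + 1)) + h" using hpos by (simp add: i_def)
  have x': "(x + a * 2 ^ (s + 1 - r)) * 2 ^ r = m + a * 2 ^ (s + 1)"
    using r unfolding m_def by (simp add: add_mult_distrib mult.assoc flip: power_add)
  have "1 \<le> i" "i \<le> (x + a * 2 ^ (s + 1 - r)) * 2 ^ r"
    "(x + a * 2 ^ (s + 1 - r) + y) * 2 ^ r \<le> i + k"
    unfolding add_mult_distrib[of _ y] x' n_def[symmetric] using i h hpos by linarith+
  from realizable_interval(1)[OF d dy this]
  have "realizable TYPE('u) s k d (int k + 2 * int i)" .
  moreover have "int k + 2 * int i = int a * 2 ^ (s + 2) + \<epsilon>" unfolding i \<epsilon>(1) by simp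
  ultimately show ?thesis by simp
qed

theorem proposition5p1:
  fixes s k d a :: nat and \<epsilon> :: int
  assumes "2 ^ s \<le> d" and "d < 2 ^ (s + 1)"
    and "[\<epsilon> = int k] (mod 2)"
  shows
    "(k \<ge> d \<longrightarrow>
        (\<forall>n\<in>candidates k. realizable TYPE('u::infinite) s k d n) \<and>
        (d = 2 ^ s \<and> s \<ge> 2 \<longrightarrow>
          (\<forall>n\<in>candidates k. realizable_neighbour TYPE('u) s k d n) \<and>
          (\<forall>n\<in>candidates k. realizable_non_neighbour TYPE('u) s k d n)))
     \<and>
     (k < d \<and> d = 2 ^ s \<and> a \<ge> 1 \<and> \<epsilon> \<in> {- int k..int k} \<longrightarrow>
        realizable_neighbour TYPE('u) s k d (int a * 2 ^ (s + 1) + \<epsilon>))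
     \<and>
     (d > max k (2 ^ s) \<and> a \<ge> 1 \<and> \<epsilon> \<in> {- int k..int k} \<longrightarrow>
        realizable TYPE('u) s k d (int a * 2 ^ (s + 2) + \<epsilon>))
     \<and>
     (\<forall>r x :: nat.
        r + 2 \<le> s \<and> 0 < x \<and> x \<le> 2 ^ (s - 2 - r) \<and> d = 2 ^ s \<and>
        int k \<in> {2 ^ s - 2 ^ r..<2 ^ s} \<and>
        \<epsilon> \<in> {(int x - 1) * 2 ^ (r + 1) + 2 ^ (s + 1) - int k..int x * 2 ^ (r + 1) + int k} \<longrightarrow>
          realizable_non_neighbour TYPE('u) s k d (int a * 2 ^ (s + 2) + \<epsilon>) \<and>
          (a \<ge> 1 \<longrightarrow> realizable_non_neighbour TYPE('u) s k d (int a * 2 ^ (s + 2) - \<epsilon>)))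
     \<and>
     (\<forall>r x :: nat.
        r + 1 \<le> s \<and> 0 < x \<and> int x < 2 ^ (s + 1 - r) - y_index d r \<and> d > 2 ^ s \<and>
        int k \<in> {y_index d r * 2 ^ r..<int d} \<and>
        \<epsilon> \<in> {(int x + y_index d r) * 2 ^ (r + 1) - int k..int x * 2 ^ (r + 1) + int k} \<longrightarrow>
          realizable TYPE('u) s k d (int a * 2 ^ (s + 2) + \<epsilon>))"
proof -
  have "2 dvd \<epsilon> - int k" using assms(3) by (simp add: cong_iff_dvd_diff)
  \<comment> \<open>Adding \<open>\<epsilon>\<close> to an even number \<open>2 * c\<close> gives
    \<open>k + 2 * (c + h)\<close>, so \<open>h\<close> is the shift of the isotropy index.\<close>
  then obtain h where h: "\<epsilon> = int k + 2 * h" by (metis dvdE diff_add_cancel add.commute)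
  have d0: "0 < d" using assms(1) by (metis less_le_trans zero_less_power pos2)
  have part1: "realizable TYPE('u) s k d n" "d = 2 ^ s \<Longrightarrow> realizable_neighbour TYPE('u) s k d n"
    if kd: "k \<ge> d" and n: "n \<in> candidates k" for n
  proof -
    obtain i where i: "n = int k + 2 * int i" "1 \<le> i" using n unfolding candidates_def by blast
    \<comment> \<open>Blocks of length 1: the plain bound \<open>a XOR b \<le> a + b\<close>, with
      \<open>i + d - 1\<close> possible values.\<close>
    have "d \<le> (d - 1 + 1) * 2 ^ 0" "i \<le> i * 2 ^ 0" "(i + (d - 1)) * 2 ^ 0 \<le> i + k" using kd d0 by auto
    from realizable_interval[OF assms(1,2) this(1) i(2) this(2,3)]
    show "realizable TYPE('u) s k d n" "d = 2 ^ s \<Longrightarrow> realizable_neighbour TYPE('u) s k d n"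
      unfolding i(1) by blast+
  qed
  have part1': "realizable_non_neighbour TYPE('u) s k d n"
    if "k \<ge> d" "d = 2 ^ s" "s \<ge> 2" and n: "n \<in> candidates k" for n
  proof -
    obtain i where "n = int k + 2 * int i" "1 \<le> i" using n unfolding candidates_def by blast
    then show ?thesis using realizable_non_neighbour_large that by blast
  qed
  have part4: "realizable_non_neighbour TYPE('u) s k d (int a * 2 ^ (s + 2) + \<epsilon>)"
    "a \<ge> 1 \<Longrightarrow> realizable_non_neighbour TYPE('u) s k d (int a * 2 ^ (s + 2) - \<epsilon>)"
    if r: "r + 2 \<le> s" and x: "0 < x" "x \<le> 2 ^ (s - 2 - r)" and d: "d = 2 ^ s"
      and k: "int k \<in> {2 ^ s - 2 ^ r..<2 ^ s}"
      and \<epsilon>: "\<epsilon> \<in> {(int x - 1) * 2 ^ (r + 1) + 2 ^ (s + 1) - int k..int x * 2 ^ (r + 1) + int k}" for r x :: nat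
  proof -
    define m where "m = x * 2 ^ r"
    have "m \<le> 2 ^ (s - 2 - r) * 2 ^ r" unfolding m_def using x(2) by (rule mult_le_mono1)
    then have m: "m \<le> 2 ^ (s - 2)" using r by (simp flip: power_add)
    have ks: "k < 2 ^ s"
    proof -
      have "int k < int (2 ^ s)" using k by simp
      then show ?thesis by (simp only: of_nat_less_iff)
    qed
    \<comment> \<open>In terms of \<open>h\<close> the interval gives
      \<open>2 ^ s \<le> k + h\<close> and \<open>h \<le> x * 2 ^ r \<le> 2 ^ (s - 2)\<close>, the
      bounds for the constructions with exchanged blocks.\<close>
    have hb: "2 ^ s + (int x - 1) * 2 ^ r \<le> int k + h" "h \<le> int m"
      using \<epsilon> unfolding h m_def by (auto simp: algebra_simps)
    have "0 \<le> (int x - 1) * 2 ^ r" using x(1) by simp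
    then have kh: "int (2 ^ s) \<le> int k + h" using hb(1) by simp
    then have hpos: "1 \<le> h" using ks by linarith
    define h' where "h' = nat h"
    have h': "h = int h'" using hpos by (simp add: h'_def)
    have c: "1 \<le> h'" "h' \<le> 2 ^ (s - 2)" "2 ^ s \<le> h' + k"
      using hpos hb(2) m kh unfolding h' by linarith+
    have s2: "2 \<le> s" using r by simp
    have eq: "int a * 2 ^ (s + 2) + \<epsilon> = int k + 2 * int (a * 2 ^ (s + 1) + h')"
      unfolding h h' by simp
    show "realizable_non_neighbour TYPE('u) s k d (int a * 2 ^ (s + 2) + \<epsilon>)"
      unfolding d eq by (rule realizable_non_neighbour_plus[OF s2 c])
    assume a: "a \<ge> 1"
    have le: "h' + k \<le> a * 2 ^ (s + 1)"
    proof -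
      have "(2::nat) ^ (s - 2) \<le> 2 ^ s" by (rule power_increasing) auto
      then have "h' + k \<le> 2 ^ (s + 1)" using c(2) ks unfolding power_add power_one_right by linarith
      also have "\<dots> \<le> a * 2 ^ (s + 1)" using a by simp
      finally show ?thesis .
    qed
    \<comment> \<open>Since \<open>- \<epsilon> = k + 2 * (- k - h)\<close>, the shift of the index
      is now \<open>- (k + h)\<close>; the inequality just proved keeps the subtraction from
      truncating.\<close>
    define i where "i = a * 2 ^ (s + 1) - (h' + k)"
    have i: "i + k + h' = a * 2 ^ (s + 1)" using le by (simp add: i_def)
    have "int (i + k + h') = int a * 2 ^ (s + 1)" unfolding i by simp
    then have eq: "int a * 2 ^ (s + 2) - \<epsilon> = int k + 2 * int i" unfolding h h' by simp
    show "realizable_non_neighbour TYPE('u) s k d (int a * 2 ^ (s + 2) - \<epsilon>)"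
      unfolding d eq by (rule realizable_non_neighbour_minus[OF s2 c(2,3) ks a i])
  qed
  have part5: "realizable TYPE('u) s k d (int a * 2 ^ (s + 2) + \<epsilon>)"
    if "r + 1 \<le> s" "0 < x" "int k \<in> {y_index d r * 2 ^ r..<int d}"
      "\<epsilon> \<in> {(int x + y_index d r) * 2 ^ (r + 1) - int k..int x * 2 ^ (r + 1) + int k}" for r x :: nat
  proof (rule realizable_between_multiples[OF assms(1,2) _ that(2) refl _ _ h])
    let ?y = "(d - 1) div 2 ^ r"
    have "int (?y * 2 ^ r) \<le> int k" "int k < int d" using that(3) unfolding y_index_eq[OF d0] by simp_all
    then show "?y * 2 ^ r \<le> k" "k < d" by (simp_all only: of_nat_le_iff of_nat_less_iff)
  qed (use that(1,4) in \<open>simp_all add: y_index_eq[OF d0]\<close>)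
  \<comment> \<open>For \<open>d = 2 ^ s\<close> blocks of length \<open>2 ^ s\<close> hold
    \<open>P0\<close>; for larger \<open>d\<close>, as in the claim after this one, the length is
    \<open>2 ^ (s + 1)\<close>, which doubles the period.\<close>
  have part2: "realizable_neighbour TYPE('u) s k d (int a * 2 ^ (s + 1) + \<epsilon>)"
    if "k < d" "d = 2 ^ s" "a \<ge> 1" "\<epsilon> \<in> {- int k..int k}"
    by (rule realizable_near_multiple(2)[OF assms(1,2) _ that(1,3) h that(4,2)]) (simp add: that(2))
  have part3: "realizable TYPE('u) s k d (int a * 2 ^ (s + 2) + \<epsilon>)"
    if "k < d" "a \<ge> 1" "\<epsilon> \<in> {- int k..int k}"
    using realizable_near_multiple(1)[OF assms(1,2) _ that(1,2) h that(3), of "s + 1"] assms(2) by simp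
  show ?thesis
    using part1 part1' part2 part3 part4 part5 by (intro conjI allI impI ballI) auto
qed

end
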